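(* Fix $\gamma\ge 1$. For every compact set $K\subset\{\lambda\in\mathbb{C}:\operatorname{Re}\lambda\ge 0\}$, the Evans functions $D(\lambda)=D(\lambda;v_+)$ converge to the limiting Evans function $D^0(\lambda)$ uniformly on $K$ as $v_+\to 0^+$, i.e. $\lim_{v_+\to 0^+}\ \sup_{\lambda\in K}|D(\lambda;v_+)-D^0(\lambda)|=0$.
   Context: Throughout, $\gamma\ge 1$ is fixed, $0<v_+<1/2$, $v_-=1$, ${}'=d/dx$, $^*$ denotes conjugate transpose, and $\widetilde W\cdot W=\widetilde W^*W$. Profile. Let $a=v_+^{\gamma}\frac{1-v_+}{1-v_+^{\gamma}}$. Let $\hat v$ be the unique monotone decreasing solution on $\mathbb{R}$ of $v'=v\,(v-1+a(v^{-\gamma}-1))$ with $\hat v(-\infty)=1$, $\hat v(+\infty)=v_+$, $\hat v(0)=1/2$. The limiting profile ($v_+=0$) is $\hat v_0(x)=\frac{1-\tanh(x/2)}{2}$, which solves $v'=v(v-1)$. Eigenvalue systems. Put $f(\hat v)=2\hat v-a(\gamma-1)\hat v^{-\gamma}-(a+1)$ and $f_0(\hat v_0)=2\hat v_0-1$. Consider $W'=A(x,\lambda)W$ and the limiting system $W'=A^0(x,\lambda)W$, where $$A=\begin{pmatrix}0&\lambda&1\\0&0&1\\ \lambda\hat v&\lambda\hat v&f(\hat v)-\lambda\end{pmatrix},\qquad A^0=\begin{pmatrix}0&\lambda&1\\0&0&1\\ \lambda\hat v_0&\lambda\hat v_0&f_0(\hat v_0)-\lambda\end{pmatrix}.$$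 Let $A_\pm(\lambda)=A(\pm\infty,\lambda)$, $A^0_\pm(\lambda)=A^0(\pm\infty,\lambda)$. The adjoint systems are $\widetilde W'=-A^*\widetilde W$ and $\widetilde W'=-(A^0)^*\widetilde W$. Modes at $-\infty$. For $\operatorname{Re}\lambda\ge0$, $A_-(\lambda)$ has a unique eigenvalue $\mu_1^-$ with positive real part, which is simple; likewise $A^0_-(\lambda)$ has the unique such eigenvalue $\mu_1^{0-}=\frac{1+\sqrt{1+4\lambda}}{2}$. Let $V_1^-(\lambda;v_+)$ and $V_1^{0-}(\lambda)$ be corresponding nonzero eigenvectors, chosen analytically in $\lambda$ and such that $V_1^-(\lambda;v_+)\to V_1^{0-}(\lambda)$ as $v_+\to0$, uniformly on compact subsets of $\{\operatorname{Re}\lambda\ge 0\}$. Let $W_1^-$ (resp. $W_1^{0-}$) be the unique solution of $W'=AW$ (resp. $W'=A^0W$) with $e^{-\mu_1^-x}W_1^-(x)\to V_1^-$ (resp. $e^{-\mu_1^{0-}x}W_1^{0-}(x)\to V_1^{0-}$) as $x\to-\infty$. Adjoint modes at $+\infty$. For $\operatorname{Re}\lambda\ge0$, $\lambda\neq0$, $-A_+(\lambda)^*$ has a unique eigenvalue $\tilde\mu_1^+$ with negative real part; it and its eigenvector extend continuously to $\lambda=0$ (with $\tilde\mu_1^+(0)=0$). Let $\widetilde V_1^+(\lambda;v_+)$ be a corresponding nonzero eigenvector, analytic in $\bar\lambda$, normalized so that $\widetilde V_1^+\to(0,1,(\gamma+\bar\lambda)^{-1})^T$ as $v_+\to0$,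 uniformly on compact subsets of $\{\operatorname{Re}\lambda\ge0\}$ (e.g. second component equal to $1$). Let $\widetilde W_1^+$ be the unique solution of $\widetilde W'=-A^*\widetilde W$ with $e^{-\tilde\mu_1^+x}\widetilde W_1^+(x)\to\widetilde V_1^+$ as $x\to+\infty$. Let $\widetilde W_1^{0+}$ be the unique solution of $\widetilde W'=-(A^0)^*\widetilde W$ with $\widetilde W_1^{0+}(x)\to\widetilde V_1:=(0,1,(1+\bar\lambda)^{-1})^T$ as $x\to+\infty$. Evans functions. $D(\lambda)=D(\lambda;v_+)=(\widetilde W_1^+\cdot W_1^-)|_{x=0}$ and $D^0(\lambda)=(\widetilde W_1^{0+}\cdot W_1^{0-})|_{x=0}$. *)

theory Defs
  imports "HOL-Analysis.Analysis"
begin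

text \<open>
  Powers with exponent \<open>\<gamma>\<close> or \<open>-\<gamma>\<close> are only ever taken of
  positive reals: a profile decreases to \<open>vp > 0\<close>.
\<close>

definition shock_const :: "real \<Rightarrow> real \<Rightarrow> real" where
  "shock_const \<gamma> vp = vp powr \<gamma> * ((1 - vp) / (1 - vp powr \<gamma>))"

definition is_profile :: "real \<Rightarrow> real \<Rightarrow> (real \<Rightarrow> real) \<Rightarrow> bool" where
  "is_profile \<gamma> vp v \<longleftrightarrow>
     (\<forall>x. (v has_real_derivative
            v x * (v x - 1 + shock_const \<gamma> vp * (v x powr (- \<gamma>) - 1))) (at x)) \<and>
     antimono v \<and>
     (v \<longlongrightarrow> 1) at_bot \<and> (v \<longlongrightarrow> vp) at_top \<and> v 0 = 1 / 2"

definition limit_profile :: "real \<Rightarrow> real" where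
  "limit_profile x = (1 - tanh (x / 2)) / 2"

definition coeff_f :: "real \<Rightarrow> real \<Rightarrow> real \<Rightarrow> real" where
  "coeff_f \<gamma> vp v =
     2 * v - shock_const \<gamma> vp * (\<gamma> - 1) * v powr (- \<gamma>) - (shock_const \<gamma> vp + 1)"

definition coeff_f0 :: "real \<Rightarrow> real" where
  "coeff_f0 v = 2 * v - 1"

definition coeff_matrix :: "real \<Rightarrow> real \<Rightarrow> complex \<Rightarrow> complex^3^3" where
  "coeff_matrix v f lam = vector
     [vector [0, lam, 1],
      vector [0, 0, 1],
      vector [lam * of_real v, lam * of_real v, of_real f - lam]]"

text \<open>
  The matrices are parametrised by the value \<open>v\<close> of the profile, so that
  \<open>A(x, lam)\<close> is \<open>A_mat \<gamma> vp (vhat x) lam\<close>. Its limits as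
  \<open>x\<close> tends to \<open>-\<infinity>\<close> and \<open>+\<infinity>\<close> are the
  values at the end states \<open>v = 1\<close> and \<open>v = vp\<close>.
\<close>

definition A_mat :: "real \<Rightarrow> real \<Rightarrow> real \<Rightarrow> complex \<Rightarrow> complex^3^3" where
  "A_mat \<gamma> vp v lam = coeff_matrix v (coeff_f \<gamma> vp v) lam"

definition A0_mat :: "real \<Rightarrow> complex \<Rightarrow> complex^3^3" where
  "A0_mat v lam = coeff_matrix v (coeff_f0 v) lam"

definition A_minus :: "real \<Rightarrow> real \<Rightarrow> complex \<Rightarrow> complex^3^3" where
  "A_minus \<gamma> vp lam = A_mat \<gamma> vp 1 lam"

definition A_plus :: "real \<Rightarrow> real \<Rightarrow> complex \<Rightarrow> complex^3^3" where
  "A_plus \<gamma> vp lam = A_mat \<gamma> vp vp lam"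

definition A0_minus :: "complex \<Rightarrow> complex^3^3" where
  "A0_minus lam = A0_mat 1 lam"

definition conj_transpose :: "complex^'n^'m \<Rightarrow> complex^'m^'n" where
  "conj_transpose M = (\<chi> i j. cnj (M $ j $ i))"

definition solves_linear_ode :: "(real \<Rightarrow> complex^3^3) \<Rightarrow> (real \<Rightarrow> complex^3) \<Rightarrow> bool" where
  "solves_linear_ode M W \<longleftrightarrow> (\<forall>x. (W has_vector_derivative M x *v W x) (at x))"

definition eigenpair :: "complex^3^3 \<Rightarrow> complex \<Rightarrow> complex^3 \<Rightarrow> bool" where
  "eigenpair M \<mu> V \<longleftrightarrow> V \<noteq> 0 \<and> M *v V = \<mu> *s V"

abbreviation closed_right_half_plane :: "complex set" where
  "closed_right_half_plane \<equiv> {lam. 0 \<le> Re lam}"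

definition analytic_vec_on :: "(complex \<Rightarrow> complex^3) \<Rightarrow> complex set \<Rightarrow> bool" where
  "analytic_vec_on V S \<longleftrightarrow> (\<forall>i. (\<lambda>z. V z $ i) analytic_on S)"

text \<open>
  The sign of the real part determines the eigenvalue: the matrix at \<open>-\<infinity>\<close>
  has exactly one eigenvalue with positive real part, and the negated adjoint at
  \<open>+\<infinity>\<close> has, for \<open>lam \<noteq> 0\<close>, exactly one with
  negative real part. Uniqueness is a fact and is not built into the definitions.
\<close>

definition is_minus_mode ::
  "real \<Rightarrow> real \<Rightarrow> (complex \<Rightarrow> complex) \<Rightarrow> (complex \<Rightarrow> complex^3) \<Rightarrow> bool" where
  "is_minus_mode \<gamma> vp \<mu> V \<longleftrightarrow>
     (\<forall>lam\<in>closed_right_half_plane. 0 < Re (\<mu> lam) \<and> eigenpair (A_minus \<gamma> vp lam) (\<mu> lam) (V lam)) \<and>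
     analytic_vec_on V closed_right_half_plane"

definition mu0_minus :: "complex \<Rightarrow> complex" where
  "mu0_minus lam = (1 + csqrt (1 + 4 * lam)) / 2"

definition is_minus_mode0 :: "(complex \<Rightarrow> complex^3) \<Rightarrow> bool" where
  "is_minus_mode0 V \<longleftrightarrow>
     (\<forall>lam\<in>closed_right_half_plane. eigenpair (A0_minus lam) (mu0_minus lam) (V lam)) \<and>
     analytic_vec_on V closed_right_half_plane"

text \<open>
  At \<open>lam = 0\<close> the kernel of the adjoint matrix is two-dimensional; the vector
  \<open>V 0\<close> is singled out by the continuity implied by analyticity. Analyticity in
  the conjugate variable means that \<open>V lam = g (cnj lam)\<close> with \<open>g\<close> analytic.
\<close>

definition is_adjoint_plus_mode ::
  "real \<Rightarrow> real \<Rightarrow> (complex \<Rightarrow> complex) \<Rightarrow> (complex \<Rightarrow> complex^3) \<Rightarrow> bool" where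
  "is_adjoint_plus_mode \<gamma> vp \<mu> V \<longleftrightarrow>
     (\<forall>lam\<in>closed_right_half_plane. lam \<noteq> 0 \<longrightarrow> Re (\<mu> lam) < 0) \<and>
     \<mu> 0 = 0 \<and> continuous_on closed_right_half_plane \<mu> \<and>
     (\<forall>lam\<in>closed_right_half_plane. eigenpair (- conj_transpose (A_plus \<gamma> vp lam)) (\<mu> lam) (V lam)) \<and>
     analytic_vec_on (\<lambda>z. V (cnj z)) closed_right_half_plane"

definition adjoint_plus_limit :: "real \<Rightarrow> complex \<Rightarrow> complex^3" where
  "adjoint_plus_limit c lam = vector [0, 1, inverse (of_real c + cnj lam)]"

definition has_exp_asymptotics ::
  "real filter \<Rightarrow> complex \<Rightarrow> complex^3 \<Rightarrow> (real \<Rightarrow> complex^3) \<Rightarrow> bool" where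
  "has_exp_asymptotics F \<mu> V W \<longleftrightarrow> ((\<lambda>x. exp (- \<mu> * of_real x) *s W x) \<longlongrightarrow> V) F"

definition cdot :: "complex^3 \<Rightarrow> complex^3 \<Rightarrow> complex" where
  "cdot Wt W = (\<Sum>i\<in>UNIV. cnj (Wt $ i) * W $ i)"

definition evans :: "(complex \<Rightarrow> real \<Rightarrow> complex^3) \<Rightarrow> (complex \<Rightarrow> real \<Rightarrow> complex^3) \<Rightarrow> complex \<Rightarrow> complex" where
  "evans Wt W lam = cdot (Wt lam 0) (W lam 0)"

end

theory Submission
  imports Defs
begin

text \<open>
  The Evans function \<open>D = Wt\<^sup>* W\<close> may be evaluated at any \<open>x\<close>, because the pairing of a
  solution with an adjoint solution is constant. Sending \<open>x\<close> to \<open>+\<infinity>\<close> replaces the adjoint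
  solution by its asymptotic form: with \<open>\<eta>\<close> the complex conjugate of the end vector \<open>Vt\<close>,
  and \<open>\<nu>\<close> the negated conjugate of its eigenvalue,
  \<open>D\<close> is the limit of \<open>exp (- \<nu> x) (\<eta> \<bullet> W(x))\<close>. So only the unstable solution \<open>W\<close> has to be
  followed, and the theorem splits into two statements.

  On a fixed half line \<open>x \<le> M\<close> the perturbation is regular. The profile converges
  with exponential weights at \<open>-\<infinity>\<close> (\<open>shock_layer_dist_left\<close>), hence \<open>W(x)\<close> converges to \<open>W0(x)\<close>
  (\<open>unstable_mode_convergence\<close> near \<open>-\<infinity>\<close>, then \<open>solution_convergence_forward\<close>).

  On \<open>x \<ge> M\<close> it is singular: the coefficient \<open>f\<close> stays close to \<open>-1\<close> until \<open>v\<close> is comparable with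
  \<open>vp\<close>, that is up to \<open>x\<close> of order \<open>ln (1 / vp)\<close>, and only there moves to its end value, which tends
  to \<open>-\<gamma>\<close>. What saves the argument is that \<open>f\<close> multiplies only the third component of \<open>W\<close>.
  That component decays, up to a
  forcing \<open>lam v (w1 + w2)\<close> which is of the order \<open>vp\<close> where \<open>f\<close> changes, whereas the first two components
  grow with an arbitrarily small rate. Therefore \<open>exp (- \<nu> x) (\<eta> \<bullet> W(x))\<close> is within
  \<open>C exp (- x / 8)\<close> of \<open>D\<close> with \<open>C\<close> independent of \<open>vp\<close> (\<open>evans_tail\<close>).

  Letting first \<open>vp\<close> tend to \<open>0\<close> and then \<open>x\<close> to \<open>\<infinity>\<close>, \<open>D\<close> tends to the limit of
  \<open>w2 + w3 / (\<gamma> + lam)\<close> along \<open>W0\<close>, while \<open>D0\<close> is the limit of \<open>w2 + w3 / (1 + lam)\<close>. The two end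
  vectors differ, but only in the coefficient of \<open>w3\<close>, which vanishes at \<open>+\<infinity>\<close>: both limits are
  the limit of \<open>w2\<close>. The argument is carried out along sequences \<open>vp \<longlonglongrightarrow> 0\<close>, \<open>lam \<longlonglongrightarrow> lam0\<close>
  (\<open>evans_sequence_convergence\<close>); this joint convergence implies uniformity on compact sets and, as
  a by-product, the continuity of \<open>D0\<close> that the covering argument uses.
\<close>

section \<open>Differential inequalities\<close>

lemma exp_growth_bound:
  fixes p p' :: "real \<Rightarrow> real"
  assumes "a \<le> b"
    and der: "\<And>x. a \<le> x \<Longrightarrow> x \<le> b \<Longrightarrow> (p has_real_derivative p' x) (at x)"
    and le: "\<And>x. a \<le> x \<Longrightarrow> x \<le> b \<Longrightarrow> p' x \<le> k * p x"
  shows "p b \<le> p a * exp (k * (b - a))"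
proof -
  have "p a * exp (- k * (a - a)) \<ge> p b * exp (- k * (b - a))"
  proof (rule DERIV_nonpos_imp_nonincreasing[OF \<open>a \<le> b\<close>])
    fix x assume x: "a \<le> x" "x \<le> b"
    have "((\<lambda>x. p x * exp (- k * (x - a))) has_real_derivative
        (p' x - k * p x) * exp (- k * (x - a))) (at x)"
      by (rule derivative_eq_intros der[OF x] refl)+ (simp add: algebra_simps)
    moreover have "(p' x - k * p x) * exp (- k * (x - a)) \<le> 0"
      using le[OF x] by (intro mult_nonpos_nonneg) auto
    ultimately show "\<exists>y. ((\<lambda>x. p x * exp (- k * (x - a))) has_real_derivative y) (at x) \<and> y \<le> 0"
      by blast
  qed
  then have "p b * exp (- k * (b - a)) * exp (k * (b - a)) \<le> p a * exp (k * (b - a))"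
    by (intro mult_right_mono) auto
  then show ?thesis by (simp add: mult.assoc flip: exp_add)
qed

lemma norm_square_derivative:
  fixes u :: "real \<Rightarrow> 'a::real_inner"
  assumes "(u has_vector_derivative u') (at x)"
  shows "((\<lambda>x. (norm (u x))\<^sup>2) has_real_derivative 2 * inner (u x) u') (at x)"
  using has_derivative_inner[OF assms[unfolded has_vector_derivative_def] assms[unfolded has_vector_derivative_def]]
  unfolding has_field_derivative_def power2_norm_eq_inner
  by (auto simp: inner_commute algebra_simps elim!: has_derivative_eq_rhs)

text \<open>
  Gronwall's inequality is applied to the square of the norm, since the norm itself is not
  differentiable at \<open>0\<close>; the term \<open>e\<^sup>2\<close> absorbs the inhomogeneity.
\<close>

lemma norm_gronwall:
  fixes u u' :: "real \<Rightarrow> 'a::real_inner"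
  assumes "a \<le> b"
    and der: "\<And>x. a \<le> x \<Longrightarrow> x \<le> b \<Longrightarrow> (u has_vector_derivative u' x) (at x)"
    and le: "\<And>x. a \<le> x \<Longrightarrow> x \<le> b \<Longrightarrow> norm (u' x) \<le> L * norm (u x) + e"
  shows "norm (u b) \<le> sqrt (((norm (u a))\<^sup>2 + e\<^sup>2) * exp ((2 * \<bar>L\<bar> + 1) * (b - a)))"
proof -
  have "(norm (u b))\<^sup>2 + e\<^sup>2 \<le> ((norm (u a))\<^sup>2 + e\<^sup>2) * exp ((2 * \<bar>L\<bar> + 1) * (b - a))"
  proof (rule exp_growth_bound[OF \<open>a \<le> b\<close>])
    fix x assume x: "a \<le> x" "x \<le> b"
    show "((\<lambda>x. (norm (u x))\<^sup>2 + e\<^sup>2) has_real_derivative 2 * inner (u x) (u' x)) (at x)"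
      using DERIV_add[OF norm_square_derivative[OF der[OF x]] DERIV_const[of "e\<^sup>2"]] by simp
    have "inner (u x) (u' x) \<le> norm (u x) * norm (u' x)" by (rule norm_cauchy_schwarz)
    also have "\<dots> \<le> norm (u x) * (\<bar>L\<bar> * norm (u x) + e)"
      using le[OF x] mult_right_mono[OF abs_ge_self, of "norm (u x)" L] by (intro mult_left_mono) auto
    finally have "2 * inner (u x) (u' x) \<le> 2 * \<bar>L\<bar> * (norm (u x))\<^sup>2 + 2 * norm (u x) * e"
      by (simp add: algebra_simps power2_eq_square)
    also have "2 * norm (u x) * e \<le> (norm (u x))\<^sup>2 + e\<^sup>2"
      using sum_squares_bound[of "norm (u x)" e] by simp
    finally have "2 * inner (u x) (u' x) \<le> (2 * \<bar>L\<bar> + 1) * (norm (u x))\<^sup>2 + 1 * e\<^sup>2"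
      by (simp add: algebra_simps)
    also have "\<dots> \<le> (2 * \<bar>L\<bar> + 1) * (norm (u x))\<^sup>2 + (2 * \<bar>L\<bar> + 1) * e\<^sup>2"
      by (intro add_left_mono mult_right_mono) auto
    finally show "2 * inner (u x) (u' x) \<le> (2 * \<bar>L\<bar> + 1) * ((norm (u x))\<^sup>2 + e\<^sup>2)"
      by (simp add: distrib_left)
  qed
  then have "(norm (u b))\<^sup>2 \<le> ((norm (u a))\<^sup>2 + e\<^sup>2) * exp ((2 * \<bar>L\<bar> + 1) * (b - a))"
    using zero_le_power2[of e] by linarith
  then show ?thesis by (rule real_le_rsqrt)
qed

text \<open>
  The solution is determined by its behaviour at \<open>+\<infinity>\<close>:
  \<open>u x\<close> is minus the integral of \<open>exp (\<theta> (x - y)) h y\<close> over \<open>y \<ge> x\<close>. The integral is avoided by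
  comparing \<open>exp (- \<theta> x) u x\<close> with a primitive of the bound for its derivative. All decay
  statements below, at both ends of the line, come from this lemma.
\<close>

lemma variation_of_constants_bound:
  fixes u h :: "real \<Rightarrow> complex" and \<theta> :: complex
  assumes der: "\<And>x. x \<ge> a \<Longrightarrow> (u has_vector_derivative \<theta> * u x + h x) (at x)"
    and h: "\<And>x. x \<ge> a \<Longrightarrow> norm (h x) \<le> C * exp (- b * x)"
    and pos: "Re \<theta> + b > 0"
    and lim: "((\<lambda>x. exp (- \<theta> * of_real x) * u x) \<longlongrightarrow> 0) at_top"
    and "x \<ge> a"
  shows "norm (u x) \<le> C / (Re \<theta> + b) * exp (- b * x)"
proof -
  define w where "w x = exp (- \<theta> * of_real x) * u x" for x :: real
  define r where "r = Re \<theta> + b"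
  define p where "p x = - (C / r) * exp (- r * x)" for x :: real
  have r: "r > 0" using pos by (simp add: r_def)
  have C: "C \<ge> 0" using order_trans[OF norm_ge_zero h[of a]] by (simp add: zero_le_mult_iff)
  have w_der: "(w has_vector_derivative exp (- \<theta> * of_real x) * h x) (at x)" if "x \<ge> a" for x
  proof -
    have "((\<lambda>z. exp (- \<theta> * z)) has_field_derivative (- \<theta> * exp (- \<theta> * of_real x))) (at (of_real x))"
      by (auto intro!: derivative_eq_intros)
    then have "((\<lambda>x. exp (- \<theta> * of_real x)) has_vector_derivative (- \<theta> * exp (- \<theta> * of_real x))) (at x)"
      by (rule has_vector_derivative_real_field)
    from has_vector_derivative_mult[OF this der[OF that]]
    show ?thesis unfolding w_def by (simp add: algebra_simps)
  qed
  have p_der: "(p has_vector_derivative C * exp (- r * x)) (at x)" for x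
    unfolding p_def using r
    by (auto intro!: derivative_eq_intros simp flip: has_real_derivative_iff_has_vector_derivative)
  have step: "norm (w y - w x) \<le> C / r * exp (- r * x)" if "y > x" for y
  proof -
    have "norm (w y - w x) \<le> p y - p x"
    proof (rule differentiable_bound_general[OF that])
      show "continuous_on {x..y} w"
        by (intro continuous_at_imp_continuous_on ballI has_vector_derivative_continuous[OF w_der]) (use \<open>x \<ge> a\<close> in auto)
      show "continuous_on {x..y} p"
        by (intro continuous_at_imp_continuous_on ballI has_vector_derivative_continuous[OF p_der])
      fix t assume t: "x < t" "t < y"
      then have ta: "t \<ge> a" using \<open>x \<ge> a\<close> by simp
      show "(w has_vector_derivative exp (- \<theta> * of_real t) * h t) (at t)" by (rule w_der[OF ta])
      show "(p has_vector_derivative C * exp (- r * t)) (at t)" by (rule p_der)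
      have "norm (exp (- \<theta> * of_real t) * h t) = exp (- Re \<theta> * t) * norm (h t)"
        by (simp add: norm_mult)
      also have "\<dots> \<le> exp (- Re \<theta> * t) * (C * exp (- b * t))"
        by (intro mult_left_mono h[OF ta]) auto
      also have "\<dots> = C * exp (- r * t)"
        by (simp add: r_def algebra_simps flip: exp_add)
      finally show "norm (exp (- \<theta> * of_real t) * h t) \<le> C * exp (- r * t)" .
    qed
    also have "p y - p x \<le> C / r * exp (- r * x)"
      using C r by (simp add: p_def)
    finally show ?thesis .
  qed
  have "((\<lambda>y. norm (w y - w x)) \<longlongrightarrow> norm (0 - w x)) at_top"
    unfolding w_def by (intro tendsto_intros lim)
  moreover have "eventually (\<lambda>y. norm (w y - w x) \<le> C / r * exp (- r * x)) at_top"
    using eventually_gt_at_top[of x] by eventually_elim (rule step)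
  ultimately have "norm (0 - w x) \<le> C / r * exp (- r * x)"
    by (rule tendsto_upperbound) simp
  then have "exp (Re \<theta> * x) * (exp (- Re \<theta> * x) * norm (u x)) \<le> exp (Re \<theta> * x) * (C / r * exp (- r * x))"
    by (intro mult_left_mono) (auto simp: w_def norm_mult)
  then show ?thesis
    unfolding r_def by (simp add: algebra_simps flip: exp_add)
qed

section \<open>The shock profile\<close>

text \<open>
  All that is used of the travelling waves: they solve \<open>v' = v (v - 1)\<close> up to a nonnegative error
  that vanishes at \<open>v = 1\<close> and is of the order \<open>vp\<close>. The limiting profile is the member with \<open>vp = 0\<close>,
  so that the two problems are estimated by the same lemmas.
\<close>

definition shock_layer :: "real \<Rightarrow> (real \<Rightarrow> real) \<Rightarrow> bool" where
  "shock_layer vp v \<longleftrightarrow>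
     0 \<le> vp \<and> antimono v \<and> v 0 = 1 / 2 \<and> (\<forall>x. vp \<le> v x \<and> v x \<le> 1) \<and>
     (\<exists>r. \<forall>x. (v has_real_derivative v x * (v x - 1) + r x) (at x) \<and> 0 \<le> r x \<and> r x \<le> vp * (1 - v x))"

lemma powr_le_self_of_exponent_ge_1:
  fixes s :: real
  assumes "1 \<le> \<gamma>" "0 < s" "s \<le> 1"
  shows "s powr \<gamma> \<le> s"
  using powr_mono'[of 1 \<gamma> s] assms by simp

lemma shock_const_bounds:
  assumes "1 \<le> \<gamma>" "0 < vp" "vp < 1"
  shows "0 < shock_const \<gamma> vp" "shock_const \<gamma> vp \<le> vp" "shock_const \<gamma> vp * vp powr (- \<gamma>) \<le> 1"
proof -
  have p: "0 < vp powr \<gamma>" "vp powr \<gamma> \<le> vp"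
    using powr_le_self_of_exponent_ge_1[of \<gamma> vp] assms by auto
  then have q: "0 < (1 - vp) / (1 - vp powr \<gamma>)" "(1 - vp) / (1 - vp powr \<gamma>) \<le> 1"
    using assms by (auto simp: divide_le_eq)
  show "0 < shock_const \<gamma> vp" using mult_pos_pos[OF p(1) q(1)] by (simp add: shock_const_def)
  show "shock_const \<gamma> vp \<le> vp"
    using mult_mono[OF p(2) q(2)] p q assms by (simp add: shock_const_def)
  show "shock_const \<gamma> vp * vp powr (- \<gamma>) \<le> 1"
    using p q assms by (simp add: shock_const_def powr_minus field_simps)
qed

definition pressure_term :: "real \<Rightarrow> real \<Rightarrow> real \<Rightarrow> real" where
  "pressure_term \<gamma> vp s = shock_const \<gamma> vp * (s powr (- \<gamma>) - 1)"

text \<open>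
  The upper bound is the convexity of \<open>\<sigma> powr \<gamma>\<close>: in the variable \<open>\<sigma> = 1 / s\<close>, the pressure term is a
  multiple of \<open>\<sigma> powr \<gamma> - 1\<close> on \<open>[1, 1 / vp]\<close>, and it lies below its chord, which is the pressure term
  for \<open>\<gamma> = 1\<close>. The bound is uniform in \<open>\<gamma>\<close> although the term is not small near \<open>s = vp\<close>.
\<close>

lemma pressure_term_bounds:
  assumes g: "1 \<le> \<gamma>" and vp: "0 < vp" "vp < 1" and s: "vp \<le> s" "s \<le> 1"
  shows "0 \<le> pressure_term \<gamma> vp s" "s * pressure_term \<gamma> vp s \<le> vp * (1 - s)"
proof -
  note sc = shock_const_bounds[OF g vp]
  have s0: "0 < s" using vp s by simp
  have "s powr \<gamma> \<le> 1" using powr_mono2[of \<gamma> s 1] s0 s g by simp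
  then have "s powr (- \<gamma>) \<ge> 1" using s0 by (simp add: powr_minus field_simps)
  then show "0 \<le> pressure_term \<gamma> vp s" using sc by (simp add: pressure_term_def)
  define t where "t = (1 / s - 1) / (1 / vp - 1)"
  have t: "0 \<le> t" "t \<le> 1" using s0 s vp by (auto simp: t_def field_simps)
  have comb: "1 / s = (1 - t) * 1 + t * (1 / vp)"
  proof -
    have "t * (1 / vp - 1) = 1 / s - 1" using vp by (simp add: t_def)
    then show ?thesis by (simp add: algebra_simps)
  qed
  have "((1 - t) *\<^sub>R 1 + t *\<^sub>R (1 / vp)) powr \<gamma> \<le> (1 - t) * 1 powr \<gamma> + t * (1 / vp) powr \<gamma>"
    by (rule convex_onD[OF powr_convex[OF g] t]) (use vp in auto)
  then have "(1 / s) powr \<gamma> \<le> (1 - t) + t * (1 / vp) powr \<gamma>"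
    using comb by simp
  then have "s powr (- \<gamma>) - 1 \<le> t * (vp powr (- \<gamma>) - 1)"
    using s0 vp by (simp add: powr_divide powr_minus_divide algebra_simps)
  then have "pressure_term \<gamma> vp s \<le> shock_const \<gamma> vp * (t * (vp powr (- \<gamma>) - 1))"
    unfolding pressure_term_def using sc by (intro mult_left_mono) auto
  also have "\<dots> = t * (1 - vp)"
  proof -
    have q: "vp powr \<gamma> < 1" "0 < vp powr \<gamma>" using powr_le_self_of_exponent_ge_1[of \<gamma> vp] g vp by auto
    then have "vp powr (- \<gamma>) - 1 = (1 - vp powr \<gamma>) / vp powr \<gamma>"
      by (simp add: powr_minus field_simps)
    then show ?thesis using q by (simp add: shock_const_def)
  qed
  finally have "s * pressure_term \<gamma> vp s \<le> s * (t * (1 - vp))"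
    using s0 by (intro mult_left_mono) auto
  also have "\<dots> = vp * (1 - s)"
    using s0 vp by (simp add: t_def field_simps)
  finally show "s * pressure_term \<gamma> vp s \<le> vp * (1 - s)" .
qed

lemma profile_is_shock_layer:
  assumes g: "1 \<le> \<gamma>" and vp: "0 < vp" "vp < 1" and prof: "is_profile \<gamma> vp v"
  shows "shock_layer vp v"
proof -
  have anti: "antimono v" and bot: "(v \<longlongrightarrow> 1) at_bot" and top: "(v \<longlongrightarrow> vp) at_top" and v0: "v 0 = 1 / 2"
    using prof by (auto simp: is_profile_def)
  have range: "vp \<le> v x \<and> v x \<le> 1" for x
  proof
    have "eventually (\<lambda>y. v y \<le> v x) at_top"
      using eventually_ge_at_top[of x] by eventually_elim (rule antimonoD[OF anti])
    then show "vp \<le> v x" by (rule tendsto_upperbound[OF top]) simp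
    have "eventually (\<lambda>y. v x \<le> v y) at_bot"
      using eventually_le_at_bot[of x] by eventually_elim (rule antimonoD[OF anti])
    then show "v x \<le> 1" by (rule tendsto_lowerbound[OF bot]) simp
  qed
  have "(v has_real_derivative v x * (v x - 1) + v x * pressure_term \<gamma> vp (v x)) (at x)" for x
    using prof by (simp add: is_profile_def pressure_term_def algebra_simps)
  moreover have "0 \<le> v x * pressure_term \<gamma> vp (v x)" "v x * pressure_term \<gamma> vp (v x) \<le> vp * (1 - v x)" for x
    using pressure_term_bounds[OF g vp, of "v x"] range[of x] vp by auto
  ultimately show ?thesis
    unfolding shock_layer_def using anti v0 range vp(1)[THEN less_imp_le]
    by (intro conjI exI[of _ "\<lambda>x. v x * pressure_term \<gamma> vp (v x)"] allI) auto
qed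

lemma limit_profile_derivative:
  "(limit_profile has_real_derivative limit_profile x * (limit_profile x - 1)) (at x)"
proof -
  have "cosh (x / 2) \<noteq> 0" using cosh_real_pos[of "x / 2"] by linarith
  then have "((\<lambda>x. (1 - tanh (x / 2)) / 2) has_real_derivative - ((1 - (tanh (x / 2))\<^sup>2) * (1 / 2) / 2)) (at x)"
    by (auto intro!: derivative_eq_intros)
  then show ?thesis
    unfolding limit_profile_def[abs_def]
    by (rule DERIV_cong) (simp add: power2_eq_square field_simps)
qed

lemma limit_profile_pos: "0 < limit_profile x"
  using tanh_real_lt_1[of "x / 2"] by (simp add: limit_profile_def)

lemma limit_profile_le_1: "limit_profile x \<le> 1"
  using tanh_real_gt_neg1[of "x / 2"] by (simp add: limit_profile_def)

lemma limit_profile_is_shock_layer: "shock_layer 0 limit_profile"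
proof -
  have "antimono limit_profile"
    by (rule antimonoI) (simp add: limit_profile_def)
  then show ?thesis
    unfolding shock_layer_def using limit_profile_derivative limit_profile_pos limit_profile_le_1
    by (auto intro!: exI[of _ "\<lambda>_. 0"] simp: less_imp_le limit_profile_def[of 0])
qed

lemma shock_layerE:
  assumes "shock_layer vp v"
  obtains r where "0 \<le> vp" "vp \<le> 1 / 2" "antimono v" "v 0 = 1 / 2" "\<And>x. vp \<le> v x" "\<And>x. v x \<le> 1"
    "\<And>x. (v has_real_derivative v x * (v x - 1) + r x) (at x)"
    "\<And>x. 0 \<le> r x" "\<And>x. r x \<le> vp * (1 - v x)"
proof -
  from assms obtain r where r: "0 \<le> vp" "antimono v" "v 0 = 1 / 2" "\<And>x. vp \<le> v x" "\<And>x. v x \<le> 1"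
    "\<And>x. (v has_real_derivative v x * (v x - 1) + r x) (at x)"
    "\<And>x. 0 \<le> r x" "\<And>x. r x \<le> vp * (1 - v x)"
    unfolding shock_layer_def by blast
  show ?thesis by (rule that[OF r(1) _ r(2-)]) (use r(3) r(4)[of 0] in auto)
qed

text \<open>
  The error bound in \<open>shock_layer\<close> gives \<open>v' \<le> - (v - vp) (1 - v)\<close>, hence a rate at each end that
  does not depend on \<open>vp\<close>.
\<close>

lemma shock_layer_decay_right:
  assumes "shock_layer vp v" "0 \<le> x"
  shows "v x \<le> 1 / 2" "v x - vp \<le> exp (- x / 2) / 2"
proof -
  from assms(1) obtain r where anti: "antimono v" and v0: "v 0 = 1 / 2" and rng: "\<And>x. vp \<le> v x"
    and der: "\<And>x. (v has_real_derivative v x * (v x - 1) + r x) (at x)"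
    and r: "\<And>x. r x \<le> vp * (1 - v x)" and vp: "0 \<le> vp"
    by (elim shock_layerE) blast
  have half: "v t \<le> 1 / 2" if "0 \<le> t" for t
    using antimonoD[OF anti that] v0 by simp
  then show "v x \<le> 1 / 2" using assms by simp
  have "v x - vp \<le> (v 0 - vp) * exp (- (1 / 2) * (x - 0))"
  proof (rule exp_growth_bound[OF \<open>0 \<le> x\<close>])
    fix t assume t: "0 \<le> t" "t \<le> x"
    show "((\<lambda>x. v x - vp) has_real_derivative v t * (v t - 1) + r t) (at t)"
      by (auto intro!: derivative_eq_intros der)
    have "v t * (v t - 1) + r t \<le> - ((v t - vp) * (1 - v t))"
      using r[of t] by (simp add: algebra_simps)
    also have "\<dots> \<le> - ((v t - vp) * (1 / 2))"
      using half[OF t(1)] rng[of t] by (intro le_imp_neg_le mult_left_mono) auto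
    finally show "v t * (v t - 1) + r t \<le> - (1 / 2) * (v t - vp)" by simp
  qed
  also have "\<dots> \<le> 1 / 2 * exp (- (1 / 2) * (x - 0))"
    using v0 vp by (intro mult_right_mono) auto
  finally show "v x - vp \<le> exp (- x / 2) / 2" by simp
qed

lemma shock_layer_decay_left:
  assumes "shock_layer vp v" "vp \<le> 1 / 4" "x \<le> 0"
  shows "1 / 2 \<le> v x" "1 - v x \<le> exp (x / 4) / 2"
proof -
  from assms(1) obtain r where anti: "antimono v" and v0: "v 0 = 1 / 2" and rng: "\<And>x. v x \<le> 1"
    and der: "\<And>x. (v has_real_derivative v x * (v x - 1) + r x) (at x)"
    and r: "\<And>x. r x \<le> vp * (1 - v x)"
    by (elim shock_layerE) blast
  have half: "1 / 2 \<le> v t" if "t \<le> 0" for t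
    using antimonoD[OF anti that] v0 by simp
  then show "1 / 2 \<le> v x" using assms by simp
  have "v 0 - 1 \<le> (v x - 1) * exp (1 / 4 * (0 - x))"
  proof (rule exp_growth_bound[OF \<open>x \<le> 0\<close>])
    fix t assume t: "x \<le> t" "t \<le> 0"
    show "((\<lambda>x. v x - 1) has_real_derivative v t * (v t - 1) + r t) (at t)"
      by (auto intro!: derivative_eq_intros der)
    have "v t * (v t - 1) + r t \<le> - ((v t - vp) * (1 - v t))"
      using r[of t] by (simp add: algebra_simps)
    also have "\<dots> \<le> - (1 / 4 * (1 - v t))"
      using half[OF t(2)] rng[of t] assms(2) by (intro le_imp_neg_le mult_right_mono) auto
    also have "\<dots> = 1 / 4 * (v t - 1)" by argo
    finally show "v t * (v t - 1) + r t \<le> 1 / 4 * (v t - 1)" .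
  qed
  then have "(1 - v x) * exp (- x / 4) * exp (x / 4) \<le> 1 / 2 * exp (x / 4)"
    using v0 by (intro mult_right_mono) (auto simp: algebra_simps)
  then show "1 - v x \<le> exp (x / 4) / 2"
    by (simp add: mult.assoc flip: exp_add)
qed

lemma shock_layer_dist:
  assumes v: "shock_layer vp v" and w: "shock_layer 0 w"
  shows "\<bar>v x - w x\<bar> \<le> vp * exp (3 / 2 * \<bar>x\<bar>)"
proof -
  from v obtain r where v0: "v 0 = 1 / 2" and vp: "0 \<le> vp" and vrng: "\<And>x. vp \<le> v x" "\<And>x. v x \<le> 1"
    and vder: "\<And>x. (v has_real_derivative v x * (v x - 1) + r x) (at x)"
    and r: "\<And>x. 0 \<le> r x" "\<And>x. r x \<le> vp * (1 - v x)"
    by (elim shock_layerE) blast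
  from w obtain q where w0: "w 0 = 1 / 2" and wrng: "\<And>x. 0 \<le> w x" "\<And>x. w x \<le> 1"
    and wder: "\<And>x. (w has_real_derivative w x * (w x - 1) + q x) (at x)"
    and q: "\<And>x. 0 \<le> q x" "\<And>x. q x \<le> 0 * (1 - w x)"
    by (elim shock_layerE) blast
  have q0: "q x = 0" for x using q[of x] by simp
  define d where "d t = v t - w t" for t
  have d_der: "(d has_real_derivative (v t + w t - 1) * d t + r t) (at t)" for t
    unfolding d_def using vder[of t] wder[of t]
    by (auto intro!: derivative_eq_intros simp: q0 algebra_simps)
  have bnd: "\<bar>(v t + w t - 1) * d t + r t\<bar> \<le> 1 * \<bar>d t\<bar> + vp" for t
  proof -
    have "\<bar>(v t + w t - 1) * d t\<bar> \<le> 1 * \<bar>d t\<bar>"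
      unfolding abs_mult using vrng[of t] wrng[of t] vp by (intro mult_right_mono) (auto simp: abs_le_iff)
    moreover have "vp * (1 - v t) \<le> vp * 1"
      using vp vrng[of t] by (intro mult_left_mono) auto
    ultimately show ?thesis using r[of t] by (simp add: abs_le_iff)
  qed
  have d0: "d 0 = 0" by (simp add: d_def v0 w0)
  have sq: "sqrt (vp\<^sup>2 * exp (3 * \<bar>x\<bar>)) = vp * exp (3 / 2 * \<bar>x\<bar>)"
  proof -
    have "vp\<^sup>2 * exp (3 * \<bar>x\<bar>) = (vp * exp (3 / 2 * \<bar>x\<bar>))\<^sup>2"
      by (simp add: power_mult_distrib flip: exp_of_nat_mult)
    then show ?thesis using vp by simp
  qed
  have "\<bar>d x\<bar> \<le> sqrt (vp\<^sup>2 * exp (3 * \<bar>x\<bar>))"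
  proof (cases "0 \<le> x")
    case True
    have "norm (d x) \<le> sqrt (((norm (d 0))\<^sup>2 + vp\<^sup>2) * exp ((2 * \<bar>1\<bar> + 1) * (x - 0)))"
      by (rule norm_gronwall[OF True, where u' = "\<lambda>t. (v t + w t - 1) * d t + r t"])
        (use d_der bnd in \<open>auto simp: has_real_derivative_iff_has_vector_derivative\<close>)
    then show ?thesis using True d0 by simp
  next
    case False
    have der: "((\<lambda>t. d (- t)) has_real_derivative - ((v (- t) + w (- t) - 1) * d (- t) + r (- t))) (at t)" for t
      by (rule DERIV_chain'[THEN DERIV_cong, OF _ d_der]) (auto intro!: derivative_eq_intros)
    have bnd': "\<bar>- ((v (- t) + w (- t) - 1) * d (- t) + r (- t))\<bar> \<le> 1 * \<bar>d (- t)\<bar> + vp" for t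
      using bnd[of "- t"] by (simp only: abs_minus_cancel)
    have "norm (d (- (- x))) \<le> sqrt (((norm (d (- 0)))\<^sup>2 + vp\<^sup>2) * exp ((2 * \<bar>1\<bar> + 1) * (- x - 0)))"
      by (rule norm_gronwall[where u = "\<lambda>t. d (- t)" and u' = "\<lambda>t. - ((v (- t) + w (- t) - 1) * d (- t) + r (- t))"])
        (use False der bnd' in \<open>auto simp: has_real_derivative_iff_has_vector_derivative\<close>)
    then show ?thesis using False d0 by simp
  qed
  then show ?thesis unfolding sq by (simp add: d_def)
qed

text \<open>
  An interpolation: the difference is at most \<open>vp exp (- 3 x / 2)\<close> by Gronwall and at most
  \<open>exp (x / 4)\<close> by the decay of both profiles, and the weights \<open>1 / 14\<close> and \<open>13 / 14\<close> turn these
  into smallness with the decay rate \<open>1 / 8\<close>.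
\<close>

lemma shock_layer_dist_left:
  assumes v: "shock_layer vp v" and vp: "vp \<le> 1 / 4" and w: "shock_layer 0 w" and x: "x \<le> 0"
  shows "\<bar>v x - w x\<bar> \<le> vp powr (1 / 14) * exp (x / 8)"
proof -
  let ?m = "\<bar>v x - w x\<bar>"
  have vp0: "0 \<le> vp" using v by (elim shock_layerE)
  have le1: "v x \<le> 1" "w x \<le> 1" using v w by (auto elim!: shock_layerE)
  have A: "?m \<le> vp * exp (- 3 / 2 * x)" using shock_layer_dist[OF v w, of x] x by simp
  have B: "?m \<le> exp (x / 4)"
    using shock_layer_decay_left[OF v vp x] shock_layer_decay_left[OF w _ x] le1 exp_gt_zero[of "x / 4"]
    by (simp add: abs_le_iff)
  have "?m = ?m powr (1 / 14) * ?m powr (13 / 14)"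
    by (simp flip: powr_add)
  also have "\<dots> \<le> (vp * exp (- 3 / 2 * x)) powr (1 / 14) * exp (x / 4) powr (13 / 14)"
    by (intro mult_mono powr_mono2 A B) auto
  also have "\<dots> = vp powr (1 / 14) * exp (x / 8)"
    using vp0 by (simp add: powr_mult exp_powr_real algebra_simps flip: exp_add)
  finally show ?thesis .
qed

section \<open>The coefficient of the eigenvalue system\<close>

lemma coeff_f_eq: "coeff_f \<gamma> vp s = 2 * s - 1 - (\<gamma> - 1) * pressure_term \<gamma> vp s - \<gamma> * shock_const \<gamma> vp"
  by (simp add: coeff_f_def pressure_term_def algebra_simps)

lemma coeff_f_le:
  assumes "1 \<le> \<gamma>" "0 < vp" "vp < 1" "vp \<le> s" "s \<le> 1"
  shows "coeff_f \<gamma> vp s \<le> 2 * s - 1"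
proof -
  have "0 \<le> (\<gamma> - 1) * pressure_term \<gamma> vp s" "0 \<le> \<gamma> * shock_const \<gamma> vp"
    using pressure_term_bounds(1)[of \<gamma> vp s] shock_const_bounds(1)[of \<gamma> vp] assms by auto
  then show ?thesis by (simp add: coeff_f_eq)
qed

lemma coeff_f_dist_minus:
  assumes g: "1 \<le> \<gamma>" "0 < vp" "vp < 1" "vp \<le> s" "1 / 2 \<le> s" "s \<le> 1"
  shows "\<bar>(coeff_f \<gamma> vp s - coeff_f \<gamma> vp 1) - 2 * (s - 1)\<bar> \<le> 2 * (\<gamma> - 1) * vp * (1 - s)"
proof -
  have p: "0 \<le> pressure_term \<gamma> vp s" "s * pressure_term \<gamma> vp s \<le> vp * (1 - s)"
    using pressure_term_bounds[of \<gamma> vp s] g by auto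
  have "1 / 2 * pressure_term \<gamma> vp s \<le> s * pressure_term \<gamma> vp s"
    using g p by (intro mult_right_mono) auto
  then have "(\<gamma> - 1) * pressure_term \<gamma> vp s \<le> (\<gamma> - 1) * (2 * vp * (1 - s))"
    using g p by (intro mult_left_mono) auto
  moreover have "0 \<le> (\<gamma> - 1) * pressure_term \<gamma> vp s" using g p by simp
  moreover have "pressure_term \<gamma> vp 1 = 0" by (simp add: pressure_term_def)
  ultimately show ?thesis by (simp add: coeff_f_eq abs_le_iff algebra_simps)
qed

text \<open>
  The distance of \<open>f\<close> from its end value can be of order one wherever \<open>v\<close> is much larger than \<open>vp\<close>.
  Only the product with \<open>vp\<close> is controlled by the distance of \<open>v\<close> from its end value; this product
  is what the forcing of the third component supplies.
\<close>

lemma coeff_f_dist_plus: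
  assumes g: "1 \<le> \<gamma>" "0 < vp" "vp < 1" "vp \<le> s" "s \<le> 1"
  shows "\<bar>coeff_f \<gamma> vp s - coeff_f \<gamma> vp vp\<bar> \<le> \<gamma> + 1"
    "vp * \<bar>coeff_f \<gamma> vp s - coeff_f \<gamma> vp vp\<bar> \<le> (\<gamma>\<^sup>2 + 1) * (s - vp)"
proof -
  define d where "d = pressure_term \<gamma> vp vp - pressure_term \<gamma> vp s"
  note sc = shock_const_bounds[OF g(1-3)]
  have p: "0 \<le> pressure_term \<gamma> vp s" using pressure_term_bounds[of \<gamma> vp s] g by auto
  have "pressure_term \<gamma> vp vp \<le> 1 - vp" using pressure_term_bounds(2)[of \<gamma> vp vp] g by simp
  then have d1: "d \<le> 1" using p g by (simp add: d_def)
  have "s powr (- \<gamma>) \<le> vp powr (- \<gamma>)" using g by (intro powr_mono2') auto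
  then have d0: "0 \<le> d" using sc by (simp add: d_def pressure_term_def)
  have "ln (s / vp) \<le> s / vp - 1" using g by (intro ln_le_minus_one) auto
  then have "1 - \<gamma> * (s / vp - 1) \<le> 1 + (- \<gamma> * ln (s / vp))"
    using mult_left_mono[of "ln (s / vp)" "s / vp - 1" \<gamma>] g by simp
  also have "\<dots> \<le> exp (- \<gamma> * ln (s / vp))" by (rule exp_ge_add_one_self)
  also have "\<dots> = (s / vp) powr (- \<gamma>)" using g by (simp add: powr_def)
  also have "\<dots> = s powr (- \<gamma>) / vp powr (- \<gamma>)" using g by (intro powr_divide)
  finally have "vp powr (- \<gamma>) * (1 - \<gamma> * (s / vp - 1)) \<le> s powr (- \<gamma>)"
    using g by (simp add: pos_le_divide_eq mult.commute)
  then have "shock_const \<gamma> vp * (vp powr (- \<gamma>) * (1 - \<gamma> * (s / vp - 1))) \<le> shock_const \<gamma> vp * s powr (- \<gamma>)"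
    using sc by (intro mult_left_mono) auto
  then have "d \<le> shock_const \<gamma> vp * vp powr (- \<gamma>) * (\<gamma> * (s / vp - 1))"
    by (simp add: d_def pressure_term_def algebra_simps)
  also have "\<dots> \<le> 1 * (\<gamma> * (s / vp - 1))"
    using sc g by (intro mult_right_mono) auto
  finally have d2: "vp * d \<le> \<gamma> * (s - vp)"
    using g by (simp add: field_simps)
  have e: "coeff_f \<gamma> vp s - coeff_f \<gamma> vp vp = 2 * (s - vp) + (\<gamma> - 1) * d"
    by (simp add: coeff_f_eq d_def algebra_simps)
  have nn: "0 \<le> (\<gamma> - 1) * d" using g d0 by simp
  have ab: "\<bar>coeff_f \<gamma> vp s - coeff_f \<gamma> vp vp\<bar> = 2 * (s - vp) + (\<gamma> - 1) * d"
    unfolding e using nn g by simp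
  have "(\<gamma> - 1) * d \<le> (\<gamma> - 1) * 1" using g d1 by (intro mult_left_mono) auto
  then show "\<bar>coeff_f \<gamma> vp s - coeff_f \<gamma> vp vp\<bar> \<le> \<gamma> + 1" unfolding ab using g by simp
  have "(\<gamma> - 1) * (vp * d) \<le> (\<gamma> - 1) * (\<gamma> * (s - vp))" using g d2 by (intro mult_left_mono) auto
  moreover have "2 * vp * (s - vp) \<le> 2 * (s - vp)" using g by (intro mult_right_mono) auto
  moreover have "1 * (s - vp) \<le> \<gamma> * (s - vp)" using g by (intro mult_right_mono) auto
  ultimately show "vp * \<bar>coeff_f \<gamma> vp s - coeff_f \<gamma> vp vp\<bar> \<le> (\<gamma>\<^sup>2 + 1) * (s - vp)"
    unfolding ab by (simp add: algebra_simps power2_eq_square)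
qed

lemma coeff_f_dist_limit:
  assumes g: "1 \<le> \<gamma>" "0 < vp" "vp < 1" "vp \<le> s" "s \<le> 1"
  shows "\<bar>coeff_f \<gamma> vp s - coeff_f0 s\<bar> \<le> \<gamma> * vp / s + \<gamma> * vp"
proof -
  note sc = shock_const_bounds[OF g(1-3)]
  have s0: "0 < s" using g by simp
  have p: "0 \<le> pressure_term \<gamma> vp s" "s * pressure_term \<gamma> vp s \<le> vp * (1 - s)"
    using pressure_term_bounds[of \<gamma> vp s] g by auto
  have "vp * (1 - s) \<le> vp" using g by (simp add: algebra_simps)
  with p have p1: "pressure_term \<gamma> vp s \<le> vp / s" using s0 by (simp add: field_simps)
  have "(\<gamma> - 1) * pressure_term \<gamma> vp s \<le> \<gamma> * (vp / s)"
    using g p p1 by (intro mult_mono) auto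
  moreover have "\<gamma> * shock_const \<gamma> vp \<le> \<gamma> * vp" using sc g by (intro mult_left_mono) auto
  moreover have "0 \<le> (\<gamma> - 1) * pressure_term \<gamma> vp s" "0 \<le> \<gamma> * shock_const \<gamma> vp"
    using p sc g by auto
  ultimately show ?thesis by (simp add: coeff_f_eq coeff_f0_def abs_le_iff)
qed

lemma coeff_matrix_mult:
  "(coeff_matrix v f lam *v w) $ 1 = lam * w $ 2 + w $ 3"
  "(coeff_matrix v f lam *v w) $ 2 = w $ 3"
  "(coeff_matrix v f lam *v w) $ 3 = lam * of_real v * (w $ 1 + w $ 2) + (of_real f - lam) * w $ 3"
  by (simp_all add: coeff_matrix_def matrix_vector_mult_def sum_3 algebra_simps)

lemma norm_vec3_le: "norm (w :: complex^3) \<le> norm (w $ 1) + norm (w $ 2) + norm (w $ 3)"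
  unfolding norm_vec_def by (rule order_trans[OF L2_set_le_sum]) (simp_all add: sum_3)

lemma coeff_matrix_diff_bound:
  "norm (coeff_matrix v f lam *v w - coeff_matrix v' f' lam' *v w)
     \<le> (2 * norm (lam - lam') + 2 * norm (lam * of_real v - lam' * of_real v') + \<bar>f - f'\<bar>) * norm w"
proof -
  let ?L = "norm (lam - lam')" and ?M = "norm (lam * of_real v - lam' * of_real v')"
  define d where "d = coeff_matrix v f lam *v w - coeff_matrix v' f' lam' *v w"
  define p where "p = (lam * of_real v - lam' * of_real v') * (w $ 1 + w $ 2)"
  define q where "q = (of_real (f - f') - (lam - lam')) * w $ 3"
  have d: "d $ 1 = (lam - lam') * w $ 2" "d $ 2 = 0" "d $ 3 = p + q"
    by (simp_all add: d_def p_def q_def coeff_matrix_mult algebra_simps)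
  have "norm (d $ 1) \<le> ?L * norm w"
    unfolding d norm_mult by (intro mult_left_mono Finite_Cartesian_Product.norm_nth_le) auto
  moreover have "norm p \<le> ?M * (norm w + norm w)"
    unfolding p_def norm_mult
    by (intro mult_left_mono order_trans[OF norm_triangle_ineq] add_mono Finite_Cartesian_Product.norm_nth_le) auto
  moreover have "norm q \<le> (\<bar>f - f'\<bar> + ?L) * norm w"
    unfolding q_def norm_mult using norm_triangle_ineq4[of "complex_of_real (f - f')" "lam - lam'"]
    by (intro mult_mono Finite_Cartesian_Product.norm_nth_le) (auto simp del: of_real_diff)
  ultimately have "norm d \<le> ?L * norm w + (?M * (norm w + norm w) + (\<bar>f - f'\<bar> + ?L) * norm w)"
    using norm_vec3_le[of d] norm_triangle_ineq[of p q] d by simp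
  then show ?thesis by (simp add: d_def algebra_simps)
qed

lemma eigenvalue_cubic:
  assumes "V \<noteq> 0" "coeff_matrix v f lam *v V = k *s V" "k \<noteq> 0"
  shows "k ^ 3 + (lam - of_real f) * k\<^sup>2 - 2 * lam * of_real v * k - lam\<^sup>2 * of_real v = 0"
proof -
  have e: "lam * V $ 2 + V $ 3 = k * V $ 1" "V $ 3 = k * V $ 2"
    "lam * of_real v * (V $ 1 + V $ 2) + (of_real f - lam) * V $ 3 = k * V $ 3"
    using assms(2) by (auto simp: vec_eq_iff forall_3 coeff_matrix_mult)
  have "V $ 2 \<noteq> 0"
  proof
    assume "V $ 2 = 0"
    with e assms(3) have "V $ 1 = 0" "V $ 3 = 0" by auto
    with \<open>V $ 2 = 0\<close> have "V = 0" by (simp add: vec_eq_iff forall_3)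
    with assms(1) show False by simp
  qed
  moreover have "(k ^ 3 + (lam - of_real f) * k\<^sup>2 - 2 * lam * of_real v * k - lam\<^sup>2 * of_real v) * V $ 2 = 0"
    using e by algebra
  ultimately show ?thesis by simp
qed

section \<open>The unstable solution near minus infinity\<close>

lemma bounded_halfline_of_tendsto_0:
  fixes u :: "real \<Rightarrow> 'a::real_normed_vector"
  assumes "continuous_on {a..} u" "(u \<longlongrightarrow> 0) at_top"
  obtains B where "0 < B" "\<And>x. a \<le> x \<Longrightarrow> norm (u x) \<le> B"
proof -
  obtain b where b: "\<And>x. b \<le> x \<Longrightarrow> norm (u x) < 1"
    using tendstoD[OF assms(2), of 1] by (auto simp: eventually_at_top_linorder)
  have cpt: "compact (u ` {a..max a b})"
    by (intro compact_continuous_image continuous_on_subset[OF assms(1)]) auto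
  obtain C where "\<forall>y\<in>u ` {a..max a b}. norm y \<le> C"
    using compact_imp_bounded[OF cpt] unfolding bounded_iff by blast
  then have C: "norm (u x) \<le> C" if "x \<in> {a..max a b}" for x
    using that by blast
  show ?thesis
  proof (rule that[of "max 1 C"])
    fix x assume "a \<le> x"
    then show "norm (u x) \<le> max 1 C"
      using b[of x] C[of x] by (cases "x \<le> max a b") (auto simp: max_def split: if_splits)
  qed simp
qed

lemma exp_times_bounded_tendsto_0:
  fixes u :: "real \<Rightarrow> complex"
  assumes "(u \<longlongrightarrow> 0) at_top" "0 \<le> Re \<theta>"
  shows "((\<lambda>x. exp (- \<theta> * of_real x) * u x) \<longlongrightarrow> 0) at_top"
proof (rule Lim_null_comparison)
  show "eventually (\<lambda>x. norm (exp (- \<theta> * of_real x) * u x) \<le> norm (u x)) at_top"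
    using eventually_ge_at_top[of 0]
  proof eventually_elim
    case (elim x)
    then have "norm (exp (- \<theta> * of_real x)) \<le> 1" using assms(2) by simp
    then show ?case unfolding norm_mult by (intro mult_left_le_one_le) auto
  qed
  show "((\<lambda>x. norm (u x)) \<longlongrightarrow> 0) at_top" using assms(1) by (rule tendsto_norm_zero)
qed

text \<open>
  The factor by which bounds for \<open>y1\<close>, \<open>y2\<close> and the combination \<open>c\<close> of the next proof dominate the
  whole vector and the coefficients in the equation for \<open>c\<close>.
\<close>

definition tail_factor :: "real \<Rightarrow> real" where
  "tail_factor Q = 2 * Q * (32 * Q + 12) + 1"

text \<open>
  Time is reversed, so \<open>t\<close> tending to \<open>\<infinity>\<close> is \<open>x\<close> tending to \<open>-\<infinity>\<close>, and the growth of the mode has been divided out. The row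
  \<open>(l1, l2, 1)\<close> is a left eigenvector of the end matrix for the eigenvalue \<open>mu\<close>, so that
  \<open>c = l1 y1 + l2 y2 + y3\<close> has no autonomous dynamics: its derivative consists of exponentially small
  terms. Expressed through \<open>c\<close>, the equations for \<open>y1\<close> and \<open>y2\<close> have the gap \<open>1 / 2\<close> and the weak
  coupling \<open>lam - l2\<close>, which vanishes in the limiting problem. A bound for \<open>(y1, y2, c)\<close>
  on the half line is thereby improved by the factor \<open>1 / 2\<close> up to a multiple of the forcing, and
  iteration leaves only the forcing. The iteration starts from the mere
  boundedness of \<open>y\<close>, and the rate of decay comes out of it.
\<close>

lemma unstable_mode_tail:
  fixes y k :: "real \<Rightarrow> complex^3" and v f :: "real \<Rightarrow> real"
  assumes \<alpha>: "0 < \<alpha>" and Q: "1 \<le> Q" "norm lam \<le> Q" "norm l1 \<le> Q" "norm l2 \<le> Q"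
    and gap: "1 / 2 \<le> Re (l1 + mu)" "1 / 2 \<le> Re (l2 + mu)"
    and small: "norm (lam - l2) * (32 * Q + 4) \<le> 1"
    and left: "l1 * mu = lam" "l2 * mu = lam * l1 + lam" "l1 + l2 = mu + lam - of_real phi"
    and der: "\<And>t i. T \<le> t \<Longrightarrow> ((\<lambda>t. y t $ i) has_vector_derivative
        - (coeff_matrix (v t) (f t) lam *v y t - mu *s y t + k t) $ i) (at t)"
    and k: "\<And>t. T \<le> t \<Longrightarrow> norm (k t) \<le> \<kappa> * exp (- \<alpha> * t)"
    and v: "\<And>t. T \<le> t \<Longrightarrow> \<bar>v t - 1\<bar> \<le> C * exp (- \<alpha> * t)"
    and f: "\<And>t. T \<le> t \<Longrightarrow> \<bar>f t - phi\<bar> \<le> C * exp (- \<alpha> * t)"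
    and lim: "(y \<longlongrightarrow> 0) at_top"
    and T: "C * tail_factor Q / \<alpha> * exp (- \<alpha> * T) \<le> 1 / 2" "T \<le> t"
  shows "norm (y t) \<le> 6 * tail_factor Q * ((2 * Q + 1) / \<alpha> + 1) * \<kappa> * exp (- \<alpha> * t)"
proof -
  define S where "S = tail_factor Q"
  define b where "b = 32 * Q + 4"
  have S: "S = 2 * Q * (8 + b) + 1" by (simp add: S_def tail_factor_def b_def)
  have b: "0 < b" using Q by (simp add: b_def)
  have S1: "1 \<le> S" using Q b by (simp add: S)
  define y1 y2 y3 where "y1 = (\<lambda>t. y t $ 1)" and "y2 = (\<lambda>t. y t $ 2)" and "y3 = (\<lambda>t. y t $ 3)"
  define k1 k2 k3 where "k1 = (\<lambda>t. k t $ 1)" and "k2 = (\<lambda>t. k t $ 2)" and "k3 = (\<lambda>t. k t $ 3)"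
  define c where "c t = l1 * y1 t + l2 * y2 t + y3 t" for t
  define g where "g t = - (lam * of_real (v t - 1) * (y1 t + y2 t) + of_real (f t - phi) * y3 t
      + l1 * k1 t + l2 * k2 t + k3 t)" for t
  have d1: "(y1 has_vector_derivative - (lam * y2 t + y3 t - mu * y1 t + k1 t)) (at t)"
    and d2: "(y2 has_vector_derivative - (y3 t - mu * y2 t + k2 t)) (at t)"
    and d3: "(y3 has_vector_derivative - (lam * of_real (v t) * (y1 t + y2 t) + (of_real (f t) - lam) * y3 t - mu * y3 t + k3 t)) (at t)"
    if "T \<le> t" for t
    using der[OF that, of 1] der[OF that, of 2] der[OF that, of 3]
    by (simp_all add: coeff_matrix_mult y1_def y2_def y3_def k1_def k2_def k3_def)
  have y3_eq: "y3 t = c t - l1 * y1 t - l2 * y2 t" for t by (simp add: c_def)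
  have e1: "(y1 has_vector_derivative (l1 + mu) * y1 t + (- ((lam - l2) * y2 t + c t + k1 t))) (at t)"
    if "T \<le> t" for t
    using d1[OF that] unfolding y3_eq by (simp add: algebra_simps)
  have e2: "(y2 has_vector_derivative (l2 + mu) * y2 t + (- (- (l1 * y1 t) + c t + k2 t))) (at t)"
    if "T \<le> t" for t
    using d2[OF that] unfolding y3_eq by (simp add: algebra_simps)
  have ec: "(c has_vector_derivative 0 * c t + g t) (at t)" if "T \<le> t" for t
  proof -
    have "(c has_vector_derivative l1 * (- (lam * y2 t + y3 t - mu * y1 t + k1 t))
        + l2 * (- (y3 t - mu * y2 t + k2 t))
        + (- (lam * of_real (v t) * (y1 t + y2 t) + (of_real (f t) - lam) * y3 t - mu * y3 t + k3 t))) (at t)"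
      unfolding c_def using d1[OF that] d2[OF that] d3[OF that]
      by (intro derivative_intros)
    moreover have "l1 * (- (lam * y2 t + y3 t - mu * y1 t + k1 t))
        + l2 * (- (y3 t - mu * y2 t + k2 t))
        + (- (lam * of_real (v t) * (y1 t + y2 t) + (of_real (f t) - lam) * y3 t - mu * y3 t + k3 t)) = g t"
    proof -
      have "l1 * (- (lam * y2 t + y3 t - mu * y1 t + k1 t))
        + l2 * (- (y3 t - mu * y2 t + k2 t))
        + (- (lam * of_real (v t) * (y1 t + y2 t) + (of_real (f t) - lam) * y3 t - mu * y3 t + k3 t))
        = g t + (l1 * mu - lam) * y1 t + (l2 * mu - (lam * l1 + lam)) * y2 t
          - (l1 + l2 - (mu + lam - of_real phi)) * y3 t"
        by (simp add: g_def algebra_simps)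
      then show ?thesis using left by simp
    qed
    ultimately show ?thesis by simp
  qed
  have lims: "(y1 \<longlongrightarrow> 0) at_top" "(y2 \<longlongrightarrow> 0) at_top" "(y3 \<longlongrightarrow> 0) at_top"
    unfolding y1_def y2_def y3_def by (auto intro!: tendsto_eq_intros lim)
  have limc: "(c \<longlongrightarrow> 0) at_top"
    unfolding c_def[abs_def] by (auto intro!: tendsto_eq_intros lims)
  define H where "H = \<kappa> * exp (- \<alpha> * t)"
  have kap: "0 \<le> \<kappa>" using order_trans[OF norm_ge_zero k[of T]] by (simp add: zero_le_mult_iff)
  have C0: "0 \<le> C" using order_trans[OF abs_ge_zero v[of T]] by (simp add: zero_le_mult_iff)
  have H0: "0 \<le> H" using kap by (simp add: H_def)
  have kH: "norm (k1 s) \<le> H" "norm (k2 s) \<le> H" if "t \<le> s" for s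
  proof -
    have "norm (k s) \<le> \<kappa> * exp (- \<alpha> * s)" using k[of s] T(2) that by simp
    also have "\<dots> \<le> H" unfolding H_def using \<alpha> kap that by (intro mult_left_mono) auto
    finally show "norm (k1 s) \<le> H" "norm (k2 s) \<le> H"
      unfolding k1_def k2_def using Finite_Cartesian_Product.norm_nth_le order_trans by blast+
  qed
  \<comment> \<open>The weights \<open>8\<close> and \<open>b = 32 Q + 4\<close> are chosen so that all three components contract at once.\<close>
  define P where "P B \<longleftrightarrow> (\<forall>s\<ge>t. norm (y1 s) \<le> 8 * B \<and> norm (y2 s) \<le> b * B \<and> norm (c s) \<le> B)" for B
  define K where "K = ((2 * Q + 1) / \<alpha> + 1) * H"
  have KH: "H \<le> K" unfolding K_def using Q \<alpha> H0 by (intro mult_le_cancel_right1[THEN iffD2]) auto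
  have step: "P (B / 2 + K)" if "P B" for B
  proof -
    have B: "norm (y1 s) \<le> 8 * B" "norm (y2 s) \<le> b * B" "norm (c s) \<le> B" if "t \<le> s" for s
      using \<open>P B\<close> that by (auto simp: P_def)
    have B0: "0 \<le> B" using order_trans[OF norm_ge_zero B(3)[of t]] by simp
    have "norm (y1 s) \<le> 8 * (B / 2 + K)" if s: "t \<le> s" for s
    proof -
      have "norm (y1 s) \<le> (2 * B + H) / (Re (l1 + mu) + 0) * exp (- 0 * s)"
      proof (rule variation_of_constants_bound[OF e1 _ _ _ s])
        fix x assume x: "t \<le> x"
        have "norm ((lam - l2) * y2 x) \<le> norm (lam - l2) * (b * B)"
          unfolding norm_mult by (intro mult_left_mono B(2) x) auto
        also have "\<dots> = (norm (lam - l2) * b) * B" by simp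
        also have "\<dots> \<le> 1 * B" using small B0 unfolding b_def by (intro mult_right_mono) auto
        finally have "norm ((lam - l2) * y2 x + c x + k1 x) \<le> B + B + H"
          using B(3)[OF x] kH(1)[OF x] by (intro order_trans[OF norm_triangle_ineq] add_mono) auto
        then show "norm (- ((lam - l2) * y2 x + c x + k1 x)) \<le> (2 * B + H) * exp (- 0 * x)"
          unfolding norm_minus_cancel by simp
        show "T \<le> x" using x T(2) by simp
      next
        show "((\<lambda>x. exp (- (l1 + mu) * of_real x) * y1 x) \<longlongrightarrow> 0) at_top"
          using gap by (intro exp_times_bounded_tendsto_0 lims) auto
      qed (use gap in auto)
      also have "\<dots> \<le> (2 * B + H) / (1 / 2)"
        using gap B0 H0 unfolding mult_zero_left minus_zero exp_zero mult_1_right add_0_right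
        by (intro divide_left_mono) auto
      finally show ?thesis using KH H0 by simp
    qed
    moreover have "norm (y2 s) \<le> b * (B / 2 + K)" if s: "t \<le> s" for s
    proof -
      have "norm (y2 s) \<le> (Q * (8 * B) + B + H) / (Re (l2 + mu) + 0) * exp (- 0 * s)"
      proof (rule variation_of_constants_bound[OF e2 _ _ _ s])
        fix x assume x: "t \<le> x"
        have "norm (- (l1 * y1 x)) \<le> Q * (8 * B)"
          unfolding norm_mult norm_minus_cancel by (intro mult_mono B(1) x Q) (use Q in auto)
        then have "norm (- (l1 * y1 x) + c x + k2 x) \<le> Q * (8 * B) + B + H"
          using B(3)[OF x] kH(2)[OF x] by (intro order_trans[OF norm_triangle_ineq] add_mono) auto
        then show "norm (- (- (l1 * y1 x) + c x + k2 x)) \<le> (Q * (8 * B) + B + H) * exp (- 0 * x)"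
          unfolding norm_minus_cancel by simp
        show "T \<le> x" using x T(2) by simp
      next
        show "((\<lambda>x. exp (- (l2 + mu) * of_real x) * y2 x) \<longlongrightarrow> 0) at_top"
          using gap by (intro exp_times_bounded_tendsto_0 lims) auto
      qed (use gap in auto)
      also have "\<dots> \<le> (Q * (8 * B) + B + H) / (1 / 2)"
        using gap B0 H0 Q unfolding mult_zero_left minus_zero exp_zero mult_1_right add_0_right
        by (intro divide_left_mono) auto
      also have "\<dots> = b * B / 2 + 2 * H" by (simp add: b_def field_simps)
      also have "2 * H \<le> b * K"
        using KH H0 Q by (intro mult_mono) (auto simp: b_def)
      finally show ?thesis by (simp add: algebra_simps)
    qed
    moreover have "norm (c s) \<le> B / 2 + K" if s: "t \<le> s" for s
    proof -
      have "norm (c s) \<le> (C * S * B + (2 * Q + 1) * \<kappa>) / (Re 0 + \<alpha>) * exp (- \<alpha> * s)"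
      proof (rule variation_of_constants_bound[OF ec _ _ _ s])
        fix x assume x: "t \<le> x"
        then show x0: "T \<le> x" using T(2) by simp
        let ?e = "exp (- \<alpha> * x)"
        have n12: "norm (y1 x + y2 x) \<le> 8 * B + b * B"
          using B(1,2)[OF x] by (intro order_trans[OF norm_triangle_ineq] add_mono)
        have n3: "norm (y3 x) \<le> B + Q * (8 * B) + Q * (b * B)"
          unfolding y3_eq using B[OF x] Q
          by (intro order_trans[OF norm_triangle_ineq4] add_mono) (auto simp: norm_mult intro!: mult_mono)
        have a1: "norm (lam * of_real (v x - 1) * (y1 x + y2 x)) \<le> Q * (C * ?e) * (8 * B + b * B)"
          unfolding norm_mult norm_of_real using v[OF x0] Q n12 C0
          by (intro mult_mono) auto
        have a2: "norm (of_real (f x - phi) * y3 x) \<le> (C * ?e) * (B + Q * (8 * B) + Q * (b * B))"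
          unfolding norm_mult norm_of_real using f[OF x0] n3 C0
          by (intro mult_mono) auto
        have kx: "norm (k1 x) \<le> \<kappa> * ?e" "norm (k2 x) \<le> \<kappa> * ?e" "norm (k3 x) \<le> \<kappa> * ?e"
          unfolding k1_def k2_def k3_def using Finite_Cartesian_Product.norm_nth_le order_trans k[OF x0] by blast+
        have a3: "norm (l1 * k1 x) \<le> Q * (\<kappa> * ?e)" "norm (l2 * k2 x) \<le> Q * (\<kappa> * ?e)"
          unfolding norm_mult using kx Q by (intro mult_mono; auto)+
        have "norm (g x) \<le> Q * (C * ?e) * (8 * B + b * B) + (C * ?e) * (B + Q * (8 * B) + Q * (b * B))
            + Q * (\<kappa> * ?e) + Q * (\<kappa> * ?e) + \<kappa> * ?e"
          unfolding g_def norm_minus_cancel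
          by (intro order_trans[OF norm_triangle_ineq] add_mono a1 a2 a3 kx)
        also have "\<dots> = (C * S * B + (2 * Q + 1) * \<kappa>) * ?e"
          by (simp add: S algebra_simps)
        finally show "norm (g x) \<le> (C * S * B + (2 * Q + 1) * \<kappa>) * ?e" .
      next
        show "((\<lambda>x. exp (- 0 * of_real x) * c x) \<longlongrightarrow> 0) at_top" using limc by simp
      qed (use \<alpha> in auto)
      also have "\<dots> \<le> (C * S * B + (2 * Q + 1) * \<kappa>) / (Re 0 + \<alpha>) * exp (- \<alpha> * t)"
        using \<alpha> s C0 B0 S1 Q kap by (intro mult_left_mono) (auto intro!: divide_nonneg_pos)
      also have "\<dots> = (C * S / \<alpha> * exp (- \<alpha> * t)) * B + (2 * Q + 1) / \<alpha> * H"
        using \<alpha> by (simp add: H_def field_simps)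
      also have "\<dots> \<le> 1 / 2 * B + K"
      proof (intro add_mono mult_right_mono)
        have "C * S / \<alpha> * exp (- \<alpha> * t) \<le> C * S / \<alpha> * exp (- \<alpha> * T)"
          using \<alpha> T C0 S1 by (intro mult_left_mono) auto
        then show "C * S / \<alpha> * exp (- \<alpha> * t) \<le> 1 / 2" using T(1) unfolding S_def by linarith
        show "(2 * Q + 1) / \<alpha> * H \<le> K" using H0 by (simp add: K_def algebra_simps)
      qed (rule B0)
      finally show ?thesis by simp
    qed
    ultimately show ?thesis unfolding P_def by blast
  qed
  obtain B0 where B0: "0 < B0" "P B0"
  proof -
    have cont: "continuous_on {t..} y1" "continuous_on {t..} y2" "continuous_on {t..} c"
      using T(2) by (auto intro!: continuous_at_imp_continuous_on has_vector_derivative_continuous[OF e1]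
        has_vector_derivative_continuous[OF e2] has_vector_derivative_continuous[OF ec])
    obtain A1 where A1: "0 < A1" "\<And>x. t \<le> x \<Longrightarrow> norm (y1 x) \<le> A1"
      using bounded_halfline_of_tendsto_0[OF cont(1) lims(1)] by blast
    obtain A2 where A2: "0 < A2" "\<And>x. t \<le> x \<Longrightarrow> norm (y2 x) \<le> A2"
      using bounded_halfline_of_tendsto_0[OF cont(2) lims(2)] by blast
    obtain A3 where A3: "0 < A3" "\<And>x. t \<le> x \<Longrightarrow> norm (c x) \<le> A3"
      using bounded_halfline_of_tendsto_0[OF cont(3) limc] by blast
    have "P (A1 + A2 / b + A3)"
      unfolding P_def
    proof (intro allI impI conjI)
      fix s assume s: "t \<le> s"
      show "norm (y1 s) \<le> 8 * (A1 + A2 / b + A3)" using A1(2)[OF s] A1(1) A2(1) A3(1) b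
        divide_pos_pos[OF A2(1) b] by argo
      have "A2 = b * (A2 / b)" using b by simp
      also have "\<dots> \<le> b * (A1 + A2 / b + A3)" using b A1 A3 by (intro mult_left_mono) auto
      finally show "norm (y2 s) \<le> b * (A1 + A2 / b + A3)" using A2(2)[OF s] by simp
      show "norm (c s) \<le> A1 + A2 / b + A3" using A3(2)[OF s] A1(1) divide_pos_pos[OF A2(1) b] by argo
    qed
    moreover have "0 < A1 + A2 / b + A3" using A1(1) A2(1) A3(1) b by (simp add: add_pos_pos)
    ultimately show ?thesis using that by blast
  qed
  have Pn: "P (B0 / 2 ^ n + 2 * K)" for n
  proof (induction n)
    case 0
    have "K \<ge> 0" using KH H0 by simp
    then have "8 * B0 \<le> 8 * (B0 + 2 * K)" "b * B0 \<le> b * (B0 + 2 * K)" "B0 \<le> B0 + 2 * K"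
      using b by (auto intro!: mult_left_mono)
    then show ?case using B0(2) unfolding P_def by (auto intro: order_trans)
  next
    case (Suc n)
    from step[OF this] show ?case by (simp add: add_divide_distrib algebra_simps)
  qed
  have tend: "(\<lambda>n. B0 / 2 ^ n + 2 * K) \<longlonglongrightarrow> 0 + 2 * K"
    by (intro tendsto_intros) (rule LIMSEQ_divide_realpow_zero, simp)
  have fin: "norm (y1 t) \<le> 8 * (0 + 2 * K)" "norm (y2 t) \<le> b * (0 + 2 * K)" "norm (c t) \<le> 0 + 2 * K"
  proof -
    have *: "norm (y1 t) \<le> 8 * (B0 / 2 ^ n + 2 * K)" "norm (y2 t) \<le> b * (B0 / 2 ^ n + 2 * K)"
      "norm (c t) \<le> B0 / 2 ^ n + 2 * K" for n
      using Pn[of n, unfolded P_def, rule_format, of t] by blast+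
    show "norm (y1 t) \<le> 8 * (0 + 2 * K)" "norm (y2 t) \<le> b * (0 + 2 * K)"
      by (rule LIMSEQ_le_const[OF tendsto_mult[OF tendsto_const tend]], use * in blast)+
    show "norm (c t) \<le> 0 + 2 * K"
      by (rule LIMSEQ_le_const[OF tend]) (use * in blast)
  qed
  have "norm (y3 t) \<le> norm (c t) + Q * norm (y1 t) + Q * norm (y2 t)"
    unfolding y3_eq using Q
    by (intro order_trans[OF norm_triangle_ineq4] add_mono) (auto simp: norm_mult intro!: mult_mono)
  also have "\<dots> \<le> 2 * K + Q * (16 * K) + Q * (b * (2 * K))"
    using fin Q by (intro add_mono mult_left_mono) auto
  also have "\<dots> \<le> 2 * S * K"
  proof -
    have "0 \<le> K" using KH H0 by simp
    then have "0 \<le> Q * K" "0 \<le> Q * (b * K)" using Q b by auto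
    then show ?thesis by (simp add: S algebra_simps)
  qed
  finally have f3: "norm (y3 t) \<le> 2 * S * K" .
  have K0: "0 \<le> K" using KH H0 by simp
  have "8 + b \<le> Q * (8 + b)" using b Q(1) mult_right_mono[OF Q(1), of "8 + b"] by simp
  moreover have "S = 2 * (Q * (8 + b)) + 1" by (simp add: S)
  ultimately have "8 \<le> S" "b \<le> S" using b by linarith+
  then have "8 * K \<le> S * K" "b * K \<le> S * K" using K0 by (auto intro!: mult_right_mono)
  moreover have "norm (y1 t) \<le> 2 * (8 * K)" "norm (y2 t) \<le> 2 * (b * K)" using fin by simp_all
  ultimately have "norm (y1 t) \<le> 2 * (S * K)" "norm (y2 t) \<le> 2 * (S * K)" by simp_all
  then have "norm (y1 t) \<le> 2 * S * K" "norm (y2 t) \<le> 2 * S * K" by (simp_all add: mult.assoc)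
  with f3 have "norm (y t) \<le> 6 * S * K"
    using norm_vec3_le[of "y t"] by (simp add: y1_def y2_def y3_def)
  then show ?thesis by (simp add: K_def H_def S_def mult.assoc)
qed

lemma solves_componentD:
  assumes "solves_linear_ode M W"
  shows "((\<lambda>x. W x $ i) has_vector_derivative (M x *v W x) $ i) (at x)"
  using bounded_linear.has_vector_derivative[OF bounded_linear_vec_nth] assms
  unfolding solves_linear_ode_def by blast

lemma reflected_mode_derivative:
  assumes "solves_linear_ode M W"
  shows "((\<lambda>t. (exp (mu * of_real t) *s W (- t)) $ i) has_vector_derivative
     - (M (- t) *v (exp (mu * of_real t) *s W (- t)) - mu *s (exp (mu * of_real t) *s W (- t))) $ i) (at t)"
proof -
  have "((\<lambda>z. exp (mu * z)) has_field_derivative (mu * exp (mu * of_real t))) (at (of_real t))"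
    by (auto intro!: derivative_eq_intros)
  then have e: "((\<lambda>t. exp (mu * of_real t)) has_vector_derivative (mu * exp (mu * of_real t))) (at t)"
    by (rule has_vector_derivative_real_field)
  have "((\<lambda>t::real. - t) has_vector_derivative - 1) (at t)"
    by (auto intro!: derivative_eq_intros)
  from vector_diff_chain_at[OF this solves_componentD[OF assms, of i "- t"]]
  have "((\<lambda>t. W (- t) $ i) has_vector_derivative - (M (- t) *v W (- t)) $ i) (at t)"
    by (simp add: o_def)
  from has_vector_derivative_mult[OF e this]
  show ?thesis by (simp add: vector_scalar_commute algebra_simps)
qed

lemma norm_smult_vec: "norm (c *s (w :: complex^'n)) = norm c * norm w"
  by (simp add: norm_vec_def norm_mult L2_set_right_distrib)

text \<open>
  Both normalised solutions are compared with their end vectors, so that the differences \<open>y\<close> and \<open>y0\<close>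
  vanish at \<open>-\<infinity>\<close>. The difference \<open>y - y0\<close> solves the perturbed equation with a forcing that is a null
  sequence times an exponential: this needs the decay of \<open>y0\<close>, since the difference of the end matrices
  is small but not integrable. Hence \<open>unstable_mode_tail\<close> is applied first to \<open>y0\<close> and then to
  \<open>y - y0\<close>.
\<close>

lemma unstable_mode_convergence:
  fixes lam mu :: "nat \<Rightarrow> complex" and phi e :: "nat \<Rightarrow> real" and v f :: "nat \<Rightarrow> real \<Rightarrow> real"
    and V :: "nat \<Rightarrow> complex^3" and W :: "nat \<Rightarrow> real \<Rightarrow> complex^3"
  assumes lam: "lam \<longlonglongrightarrow> lam0" and mu: "mu \<longlonglongrightarrow> mu0" and phi: "phi \<longlonglongrightarrow> 1"
    and V: "V \<longlonglongrightarrow> V0" and e: "e \<longlonglongrightarrow> 0"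
    and eig: "\<And>n. V n \<noteq> 0" "\<And>n. mu n \<noteq> 0" "\<And>n. coeff_matrix 1 (phi n) (lam n) *v V n = mu n *s V n"
    and eig0: "mu0\<^sup>2 = mu0 + lam0" "1 \<le> Re (lam0 / mu0 + mu0)" "1 \<le> Re (lam0 + mu0)" "mu0 \<noteq> 0"
      "coeff_matrix 1 1 lam0 *v V0 = mu0 *s V0"
    and \<alpha>: "0 < \<alpha>"
    and v: "\<And>n x. x \<le> 0 \<Longrightarrow> \<bar>v n x - 1\<bar> \<le> C * exp (\<alpha> * x)"
    and f: "\<And>n x. x \<le> 0 \<Longrightarrow> \<bar>f n x - phi n\<bar> \<le> C * exp (\<alpha> * x)"
    and v0: "\<And>x. x \<le> 0 \<Longrightarrow> \<bar>v0 x - 1\<bar> \<le> C * exp (\<alpha> * x)"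
    and f0: "\<And>x. x \<le> 0 \<Longrightarrow> \<bar>f0 x - 1\<bar> \<le> C * exp (\<alpha> * x)"
    and vd: "\<And>n x. x \<le> 0 \<Longrightarrow> \<bar>v n x - v0 x\<bar> \<le> e n * exp (\<alpha> * x)"
    and fd: "\<And>n x. x \<le> 0 \<Longrightarrow> \<bar>(f n x - phi n) - (f0 x - 1)\<bar> \<le> e n * exp (\<alpha> * x)"
    and W: "\<And>n. solves_linear_ode (\<lambda>x. coeff_matrix (v n x) (f n x) (lam n)) (W n)"
      "\<And>n. has_exp_asymptotics at_bot (mu n) (V n) (W n)"
    and W0: "solves_linear_ode (\<lambda>x. coeff_matrix (v0 x) (f0 x) lam0) W0"
      "has_exp_asymptotics at_bot mu0 V0 W0"
  shows "\<exists>X\<le>0. (\<lambda>n. W n X) \<longlonglongrightarrow> W0 X"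
proof -
  define l1 where "l1 n = lam n / mu n" for n
  define l2 where "l2 n = lam n * (lam n + mu n) / (mu n)\<^sup>2" for n
  define m1 where "m1 = lam0 / mu0"
  define m2 where "m2 = lam0 * (lam0 + mu0) / mu0\<^sup>2"
  have l1: "l1 \<longlonglongrightarrow> m1" and l2: "l2 \<longlonglongrightarrow> m2"
    unfolding l1_def m1_def l2_def m2_def using eig0(4) by (auto intro!: tendsto_intros lam mu)
  have m2: "m2 = lam0" 
  proof -
    have "lam0 + mu0 = mu0\<^sup>2" using eig0(1) by simp
    then show ?thesis using eig0(4) by (simp add: m2_def)
  qed
  define Q where "Q = norm lam0 + norm m1 + 1"
  have Q: "1 \<le> Q" "norm lam0 < Q" "norm m1 < Q" "norm m2 < Q"
    using norm_ge_zero[of lam0] norm_ge_zero[of m1] unfolding Q_def m2 by linarith+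
  have C0: "0 \<le> C" using order_trans[OF abs_ge_zero v0[of 0]] by simp
  have cubic: "mu n ^ 3 + (lam n - of_real (phi n)) * (mu n)\<^sup>2 - 2 * lam n * mu n - (lam n)\<^sup>2 = 0" for n
    using eigenvalue_cubic[OF eig(1,3,2), of n] by simp
  have left: "l1 n * mu n = lam n" "l2 n * mu n = lam n * l1 n + lam n"
    "l1 n + l2 n = mu n + lam n - of_real (phi n)" for n
  proof -
    show "l1 n * mu n = lam n" "l2 n * mu n = lam n * l1 n + lam n"
      using eig(2)[of n] by (simp_all add: l1_def l2_def power2_eq_square field_simps)
    have "(mu n)\<^sup>2 * (l1 n + l2 n) = 2 * lam n * mu n + (lam n)\<^sup>2"
      using eig(2)[of n] by (simp add: l1_def l2_def power2_eq_square field_simps)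
    also have "\<dots> = (mu n)\<^sup>2 * (mu n + lam n - of_real (phi n))"
      using cubic[of n] by (simp add: power2_eq_square power3_eq_cube algebra_simps)
    finally show "l1 n + l2 n = mu n + lam n - of_real (phi n)"
      using eig(2)[of n] by simp
  qed
  \<comment> \<open>For end value \<open>1\<close> the cubic factors as \<open>(mu + lam) (mu\<^sup>2 - mu - lam)\<close>; this makes \<open>m2 = lam0\<close>.\<close>
  have left0: "m1 * mu0 = lam0" "m2 * mu0 = lam0 * m1 + lam0" "m1 + m2 = mu0 + lam0 - of_real 1"
  proof -
    show m1: "m1 * mu0 = lam0" using eig0(4) by (simp add: m1_def)
    have "mu0 * (m2 * mu0) = lam0 * mu0\<^sup>2" by (simp add: m2 power2_eq_square)
    also have "\<dots> = lam0 * (mu0 + m1 * mu0)" using m1 eig0(1) by simp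
    also have "\<dots> = mu0 * (lam0 * m1 + lam0)" by (simp add: algebra_simps)
    finally have "mu0 * (m2 * mu0) = mu0 * (lam0 * m1 + lam0)" .
    then show "m2 * mu0 = lam0 * m1 + lam0" using eig0(4) by simp
    have "mu0 * (m1 + m2) = mu0 * (mu0 + lam0 - of_real 1)"
      using m1 eig0(1) by (simp add: m2 algebra_simps power2_eq_square)
    then show "m1 + m2 = mu0 + lam0 - of_real 1" using eig0(4) by simp
  qed
  define T where "T = max 0 (ln (2 * (C * tail_factor Q / \<alpha>) + 1) / \<alpha>)"
  have tf: "0 \<le> tail_factor Q" using Q(1) by (simp add: tail_factor_def)
  have T: "0 \<le> T" "C * tail_factor Q / \<alpha> * exp (- \<alpha> * T) \<le> 1 / 2"
  proof -
    show "0 \<le> T" by (simp add: T_def)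
    let ?z = "C * tail_factor Q / \<alpha>"
    have z: "0 \<le> ?z" using C0 tf \<alpha> by simp
    have "ln (2 * ?z + 1) / \<alpha> \<le> T" by (simp add: T_def)
    then have "ln (2 * ?z + 1) \<le> \<alpha> * T" using \<alpha> by (simp add: field_simps)
    then have "exp (ln (2 * ?z + 1)) \<le> exp (\<alpha> * T)" by simp
    then have "2 * ?z + 1 \<le> exp (\<alpha> * T)" using z by simp
    then have "?z / exp (\<alpha> * T) \<le> 1 / 2"
      by (subst pos_divide_le_eq, simp) linarith
    moreover have "exp (- \<alpha> * T) = 1 / exp (\<alpha> * T)" by (simp add: exp_minus inverse_eq_divide)
    ultimately show "?z * exp (- \<alpha> * T) \<le> 1 / 2" by (simp only: times_divide_eq_right mult_1_right)
  qed
  define y where "y n t = exp (mu n * of_real t) *s W n (- t) - V n" for n and t :: real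
  define y0 where "y0 t = exp (mu0 * of_real t) *s W0 (- t) - V0" for t :: real
  let ?A = "\<lambda>n t. coeff_matrix (v n (- t)) (f n (- t)) (lam n)"
  let ?L = "\<lambda>t. coeff_matrix (v0 (- t)) (f0 (- t)) lam0"
  let ?B = "\<lambda>n. coeff_matrix 1 (phi n) (lam n)"
  let ?M = "coeff_matrix 1 1 lam0"
  have y_der: "((\<lambda>t. y n t $ i) has_vector_derivative
      - (?A n t *v y n t - mu n *s y n t + (?A n t *v V n - ?B n *v V n)) $ i) (at t)" for n t i
  proof -
    have "((\<lambda>t. y n t $ i) has_vector_derivative
      - (?A n t *v (y n t + V n) - mu n *s (y n t + V n)) $ i) (at t)"
      using has_vector_derivative_diff[OF reflected_mode_derivative[OF W(1)] has_vector_derivative_const[of "V n $ i"]]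
      by (simp add: y_def)
    then show ?thesis
      by (simp add: eig matrix_vector_right_distrib algebra_simps vector_add_ldistrib)
  qed
  have y0_der: "((\<lambda>t. y0 t $ i) has_vector_derivative
      - (?L t *v y0 t - mu0 *s y0 t + (?L t *v V0 - ?M *v V0)) $ i) (at t)" for t i
  proof -
    have "((\<lambda>t. y0 t $ i) has_vector_derivative
      - (?L t *v (y0 t + V0) - mu0 *s (y0 t + V0)) $ i) (at t)"
      using has_vector_derivative_diff[OF reflected_mode_derivative[OF W0(1)] has_vector_derivative_const[of "V0 $ i"]]
      by (simp add: y0_def)
    then show ?thesis
      by (simp add: eig0 matrix_vector_right_distrib algebra_simps vector_add_ldistrib)
  qed
  have refl: "((\<lambda>t. exp (m * of_real t) *s w (- t) - u) \<longlongrightarrow> 0) at_top"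
    if "has_exp_asymptotics at_bot m u w" for m u w
  proof -
    have "((\<lambda>t. exp (- m * of_real (- t)) *s w (- t)) \<longlongrightarrow> u) at_top"
      using that unfolding has_exp_asymptotics_def
      by (rule filterlim_compose[OF _ filterlim_uminus_at_bot_at_top])
    then have "((\<lambda>t. exp (m * of_real t) *s w (- t)) \<longlongrightarrow> u) at_top" by simp
    then show ?thesis by (rule LIM_zero)
  qed
  have y_lim: "(y n \<longlongrightarrow> 0) at_top" for n unfolding y_def[abs_def] by (rule refl[OF W(2)])
  have y0_lim: "(y0 \<longlongrightarrow> 0) at_top" unfolding y0_def[abs_def] by (rule refl[OF W0(2)])
  define R where "R = 6 * tail_factor Q * ((2 * Q + 1) / \<alpha> + 1)"
  define c0 where "c0 = R * ((2 * norm lam0 * C + C) * norm V0)"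
  have y0_bound: "norm (y0 t) \<le> c0 * exp (- \<alpha> * t)" if t: "T \<le> t" for t
    unfolding c0_def R_def
  proof (rule unstable_mode_tail[OF \<alpha> Q(1) _ _ _ _ _ _ left0 y0_der _ _ _ y0_lim T(2) t])
    fix s :: real assume "T \<le> s"
    then have s: "0 \<le> s" using T by simp
    show "\<bar>v0 (- s) - 1\<bar> \<le> C * exp (- \<alpha> * s)" "\<bar>f0 (- s) - 1\<bar> \<le> C * exp (- \<alpha> * s)"
      using v0[of "- s"] f0[of "- s"] s by auto
    have "lam0 * of_real (v0 (- s)) - lam0 * of_real 1 = lam0 * of_real (v0 (- s) - 1)"
      by (simp add: algebra_simps)
    then have "norm (lam0 * of_real (v0 (- s)) - lam0 * of_real 1) = norm lam0 * \<bar>v0 (- s) - 1\<bar>"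
      by (simp only: norm_mult norm_of_real)
    also have "\<dots> \<le> norm lam0 * (C * exp (- \<alpha> * s))"
      using v0[of "- s"] s by (intro mult_left_mono) auto
    finally have "2 * norm (lam0 - lam0) + 2 * norm (lam0 * of_real (v0 (- s)) - lam0 * of_real 1) + \<bar>f0 (- s) - 1\<bar>
        \<le> (2 * norm lam0 * C + C) * exp (- \<alpha> * s)"
      using f0[of "- s"] s by (simp add: algebra_simps)
    from order_trans[OF coeff_matrix_diff_bound mult_right_mono[OF this norm_ge_zero]]
    show "norm (?L s *v V0 - ?M *v V0) \<le> (2 * norm lam0 * C + C) * norm V0 * exp (- \<alpha> * s)"
      by (simp add: algebra_simps)
  qed (use Q eig0 m1_def m2 in auto)
  define s where "s n = V n $ 1 + V n $ 2" for n
  define s0 where "s0 = V0 $ 1 + V0 $ 2"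
  have sl: "s \<longlonglongrightarrow> s0" unfolding s_def s0_def by (intro tendsto_intros V)
  define g where "g n = (4 + 2 * C) * norm (lam n - lam0) + 2 * norm lam0 * e n + e n + \<bar>phi n - 1\<bar> + norm (mu n - mu0)" for n
  define kap where "kap n = g n * c0 + (C * norm (lam n * s n - lam0 * s0) + norm (lam0 * s0) * e n)
      + (C * norm (V n $ 3 - V0 $ 3) + norm (V0 $ 3) * e n)" for n
  have kap0: "kap \<longlonglongrightarrow> 0"
  proof -
    have "kap \<longlonglongrightarrow> ((4 + 2 * C) * norm (lam0 - lam0) + 2 * norm lam0 * 0 + 0 + \<bar>1 - 1\<bar> + norm (mu0 - mu0)) * c0
       + (C * norm (lam0 * s0 - lam0 * s0) + norm (lam0 * s0) * 0) + (C * norm (V0 $ 3 - V0 $ 3) + norm (V0 $ 3) * 0)"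
      unfolding kap_def[abs_def] g_def by (intro tendsto_intros lam mu V e phi sl)
    then show ?thesis by simp
  qed
  define k where "k n t = (?A n t *v y0 t - ?L t *v y0 t) - (mu n - mu0) *s y0 t
      + ((?A n t *v V n - ?B n *v V n) - (?L t *v V0 - ?M *v V0))" for n t
  define d where "d n t = y n t - y0 t" for n t
  have d_der: "((\<lambda>t. d n t $ i) has_vector_derivative - (?A n t *v d n t - mu n *s d n t + k n t) $ i) (at t)" for n t i
    using has_vector_derivative_diff[OF y_der[of n i t] y0_der[of i t]]
    by (simp add: d_def k_def matrix_vector_mult_diff_distrib algebra_simps)
  have d_lim: "(d n \<longlongrightarrow> 0) at_top" for n
    unfolding d_def[abs_def] using tendsto_diff[OF y_lim[of n] y0_lim] by simp
  have c00: "0 \<le> c0" 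
    using order_trans[OF norm_ge_zero y0_bound[of T]] by (simp add: zero_le_mult_iff)
  have k_bound: "norm (k n t) \<le> kap n * exp (- \<alpha> * t)" if t: "T \<le> t" for n t
  proof -
    let ?e = "exp (- \<alpha> * t)"
    have t0: "- t \<le> 0" using t T by simp
    have e1: "?e \<le> 1" using \<alpha> t0 by simp
    have en: "0 \<le> e n" using order_trans[OF abs_ge_zero vd[of 0 n]] by simp
    have e_le: "e n * ?e \<le> e n" using mult_left_mono[OF e1 en] by simp
    have vb: "\<bar>v n (- t)- 1\<bar> \<le> C * ?e" "\<bar>f n (- t) - phi n\<bar> \<le> C * ?e" "\<bar>v n (- t) - v0 (- t)\<bar> \<le> e n * ?e"
      "\<bar>(f n (- t) - phi n) - (f0 (- t) - 1)\<bar> \<le> e n * ?e"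
      using v[OF t0, of n] f[OF t0, of n] vd[OF t0, of n] fd[OF t0, of n] by (simp_all)
    have "lam n * of_real (v n (- t)) - lam0 * of_real (v0 (- t))
       = (lam n - lam0) * of_real (v n (- t)) + lam0 * of_real (v n (- t) - v0 (- t))"
      by (simp add: algebra_simps)
    also have "norm \<dots> \<le> norm (lam n - lam0) * (1 + C) + norm lam0 * e n"
    proof (intro order_trans[OF norm_triangle_ineq] add_mono)
      have "C * ?e \<le> C" using mult_left_mono[OF e1 C0] by simp
      then have "\<bar>v n (- t)\<bar> \<le> 1 + C" using vb(1) by (simp add: abs_le_iff)
      then show "norm ((lam n - lam0) * of_real (v n (- t))) \<le> norm (lam n - lam0) * (1 + C)"
        unfolding norm_mult norm_of_real by (rule mult_left_mono) simp
      show "norm (lam0 * of_real (v n (- t) - v0 (- t))) \<le> norm lam0 * e n"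
        unfolding norm_mult norm_of_real using vb(3) e_le by (intro mult_left_mono) auto
    qed
    finally have lv: "norm (lam n * of_real (v n (- t)) - lam0 * of_real (v0 (- t)))
        \<le> norm (lam n - lam0) * (1 + C) + norm lam0 * e n" .
    have ff: "\<bar>f n (- t) - f0 (- t)\<bar> \<le> e n + \<bar>phi n - 1\<bar>"
      using vb(4) e_le by linarith
    have "2 * norm (lam n - lam0) + 2 * norm (lam n * of_real (v n (- t)) - lam0 * of_real (v0 (- t))) + \<bar>f n (- t) - f0 (- t)\<bar>
        \<le> (4 + 2 * C) * norm (lam n - lam0) + 2 * norm lam0 * e n + (e n + \<bar>phi n - 1\<bar>)"
      using lv ff by (simp add: algebra_simps)
    from order_trans[OF coeff_matrix_diff_bound mult_right_mono[OF this norm_ge_zero]]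
    have "norm (?A n t *v y0 t - ?L t *v y0 t)
        \<le> ((4 + 2 * C) * norm (lam n - lam0) + 2 * norm lam0 * e n + (e n + \<bar>phi n - 1\<bar>)) * norm (y0 t)" .
    moreover have "norm ((mu n - mu0) *s y0 t) \<le> norm (mu n - mu0) * norm (y0 t)"
      unfolding norm_smult_vec ..
    ultimately have "norm ((?A n t *v y0 t - ?L t *v y0 t) - (mu n - mu0) *s y0 t) \<le> g n * norm (y0 t)"
      unfolding g_def by (intro order_trans[OF norm_triangle_ineq4]) (simp add: algebra_simps)
    also have "\<dots> \<le> g n * (c0 * ?e)"
      using y0_bound[OF t] C0 en by (intro mult_left_mono) (auto simp: g_def)
    finally have part1: "norm ((?A n t *v y0 t - ?L t *v y0 t) - (mu n - mu0) *s y0 t) \<le> g n * (c0 * ?e)" .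
    define w where "w = (?A n t *v V n - ?B n *v V n) - (?L t *v V0 - ?M *v V0)"
    have w12: "w $ 1 = 0" "w $ 2 = 0" by (simp_all add: w_def coeff_matrix_mult)
    have w3: "w $ 3 = of_real (v n (- t) - 1) * (lam n * s n - lam0 * s0) + lam0 * s0 * of_real (v n (- t) - v0 (- t))
        + (of_real (f n (- t) - phi n) * (V n $ 3 - V0 $ 3)
        + of_real ((f n (- t) - phi n) - (f0 (- t) - 1)) * V0 $ 3)"
      by (simp add: w_def s_def s0_def coeff_matrix_mult algebra_simps)
    have "norm (w $ 3) \<le> (C * ?e) * norm (lam n * s n - lam0 * s0) + norm (lam0 * s0) * (e n * ?e)
        + ((C * ?e) * norm (V n $ 3 - V0 $ 3) + (e n * ?e) * norm (V0 $ 3))"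
      unfolding w3
    proof (intro order_trans[OF norm_triangle_ineq] add_mono)
      show "norm (of_real (v n (- t) - 1) * (lam n * s n - lam0 * s0)) \<le> (C * ?e) * norm (lam n * s n - lam0 * s0)"
        "norm (of_real (f n (- t) - phi n) * (V n $ 3 - V0 $ 3)) \<le> (C * ?e) * norm (V n $ 3 - V0 $ 3)"
        "norm (of_real ((f n (- t) - phi n) - (f0 (- t) - 1)) * V0 $ 3) \<le> (e n * ?e) * norm (V0 $ 3)"
        unfolding norm_mult norm_of_real using vb by (intro mult_right_mono; simp)+
      show "norm (lam0 * s0 * of_real (v n (- t) - v0 (- t))) \<le> norm (lam0 * s0) * (e n * ?e)"
        unfolding norm_mult[of "lam0 * s0"] norm_of_real using vb by (intro mult_left_mono) auto
    qed
    moreover have "norm w \<le> norm (w $ 3)" using norm_vec3_le[of w] w12 by simp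
    ultimately have part2: "norm w \<le> ((C * norm (lam n * s n - lam0 * s0) + norm (lam0 * s0) * e n)
      + (C * norm (V n $ 3 - V0 $ 3) + norm (V0 $ 3) * e n)) * ?e"
      by (simp add: algebra_simps)
    have "norm (k n t) \<le> g n * (c0 * ?e) + ((C * norm (lam n * s n - lam0 * s0) + norm (lam0 * s0) * e n)
      + (C * norm (V n $ 3 - V0 $ 3) + norm (V0 $ 3) * e n)) * ?e"
      unfolding k_def w_def[symmetric]
      by (intro order_trans[OF norm_triangle_ineq] add_mono part1 part2)
    then show ?thesis by (simp add: kap_def algebra_simps)
  qed
  have ev: "eventually (\<lambda>n. norm (d n T) \<le> R * kap n) sequentially"
  proof -
    have "(\<lambda>n. norm (lam n - l2 n) * (32 * Q + 4)) \<longlonglongrightarrow> norm (lam0 - m2) * (32 * Q + 4)"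
      by (intro tendsto_intros lam l2)
    then have "eventually (\<lambda>n. norm (lam n - l2 n) * (32 * Q + 4) < 1) sequentially"
      by (rule order_tendstoD) (simp add: m2)
    moreover have "eventually (\<lambda>n. norm (lam n) < Q) sequentially"
      by (rule order_tendstoD[OF tendsto_norm[OF lam]]) (rule Q)
    moreover have "eventually (\<lambda>n. norm (l1 n) < Q) sequentially"
      by (rule order_tendstoD[OF tendsto_norm[OF l1]]) (rule Q)
    moreover have "eventually (\<lambda>n. norm (l2 n) < Q) sequentially"
      by (rule order_tendstoD[OF tendsto_norm[OF l2]]) (rule Q)
    moreover have "eventually (\<lambda>n. 1 / 2 < Re (l1 n + mu n)) sequentially"
      by (rule order_tendstoD[OF tendsto_Re[OF tendsto_add[OF l1 mu]]]) (use eig0 m1_def in auto)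
    moreover have "eventually (\<lambda>n. 1 / 2 < Re (l2 n + mu n)) sequentially"
      by (rule order_tendstoD[OF tendsto_Re[OF tendsto_add[OF l2 mu]]]) (use eig0 m2 in auto)
    ultimately show ?thesis
    proof eventually_elim
      case (elim n)
      have "norm (d n T) \<le> R * kap n * exp (- \<alpha> * T)"
        unfolding R_def
      proof (rule unstable_mode_tail[OF \<alpha> Q(1) _ _ _ _ _ _ left d_der k_bound _ _ d_lim T(2) order_refl])
        fix t assume "T \<le> t"
        then have t: "- t \<le> 0" using T by simp
        show "\<bar>v n (- t) - 1\<bar> \<le> C * exp (- \<alpha> * t)" "\<bar>f n (- t) - phi n\<bar> \<le> C * exp (- \<alpha> * t)"
          using v[OF t] f[OF t] by auto
      qed (use elim in auto)
      also have "\<dots> \<le> R * kap n * 1"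
      proof (rule mult_left_mono)
        have "0 \<le> kap n" using order_trans[OF norm_ge_zero k_bound[of T n]] by (simp add: zero_le_mult_iff)
        then show "0 \<le> R * kap n" unfolding R_def using tf Q \<alpha> by simp
      qed (use \<alpha> T in simp)
      finally show ?case by simp
    qed
  qed
  have "(\<lambda>n. d n T) \<longlonglongrightarrow> 0"
    by (rule Lim_null_comparison[OF ev]) (use tendsto_mult_right_zero[OF kap0] in simp)
  then have "(\<lambda>n. d n T + y0 T + V n) \<longlonglongrightarrow> 0 + y0 T + V0" by (intro tendsto_intros V)
  then have Y: "(\<lambda>n. exp (mu n * of_real T) *s W n (- T)) \<longlonglongrightarrow> exp (mu0 * of_real T) *s W0 (- T)"
    by (simp add: d_def y_def y0_def)
  have "(\<lambda>n. W n (- T)) \<longlonglongrightarrow> W0 (- T)"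
  proof (rule vec_tendstoI)
    fix i
    have "(\<lambda>n. exp (- mu n * of_real T) * (exp (mu n * of_real T) *s W n (- T)) $ i)
       \<longlonglongrightarrow> exp (- mu0 * of_real T) * (exp (mu0 * of_real T) *s W0 (- T)) $ i"
      by (intro tendsto_intros mu Y)
    then show "(\<lambda>n. W n (- T) $ i) \<longlonglongrightarrow> W0 (- T) $ i"
      by (simp flip: exp_add mult.assoc)
  qed
  then show ?thesis using T(1) by (intro exI[of _ "- T"]) auto
qed

section \<open>Continuous dependence on bounded intervals\<close>

lemma coeff_matrix_bound:
  "norm (coeff_matrix v f lam *v w) \<le> (2 + 2 * norm lam + 2 * norm lam * \<bar>v\<bar> + \<bar>f\<bar>) * norm w"
proof -
  let ?u = "coeff_matrix v f lam *v w"
  have n: "norm (w $ i) \<le> norm w" for i by (rule Finite_Cartesian_Product.norm_nth_le)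
  have "norm (?u $ 1) \<le> norm lam * norm w + norm w"
    unfolding coeff_matrix_mult
    by (intro order_trans[OF norm_triangle_ineq] add_mono n) (auto simp: norm_mult intro!: mult_left_mono n)
  moreover have "norm (?u $ 2) \<le> norm w" unfolding coeff_matrix_mult by (rule n)
  moreover have "norm (?u $ 3) \<le> norm lam * \<bar>v\<bar> * (norm w + norm w) + (\<bar>f\<bar> + norm lam) * norm w"
    unfolding coeff_matrix_mult
  proof (intro order_trans[OF norm_triangle_ineq] add_mono)
    show "norm (lam * of_real v * (w $ 1 + w $ 2)) \<le> norm lam * \<bar>v\<bar> * (norm w + norm w)"
      unfolding norm_mult norm_of_real
      by (intro mult_left_mono order_trans[OF norm_triangle_ineq] add_mono n) auto
    have "norm (of_real f - lam) \<le> \<bar>f\<bar> + norm lam"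
      using norm_triangle_ineq4[of "of_real f" lam] by simp
    then show "norm ((of_real f - lam) * w $ 3) \<le> (\<bar>f\<bar> + norm lam) * norm w"
      unfolding norm_mult by (intro mult_mono n) auto
  qed
  ultimately show ?thesis using norm_vec3_le[of ?u] by (simp add: algebra_simps)
qed

lemma solution_convergence_forward:
  fixes lam :: "nat \<Rightarrow> complex" and v f :: "nat \<Rightarrow> real \<Rightarrow> real" and W :: "nat \<Rightarrow> real \<Rightarrow> complex^3"
  assumes "a \<le> b" and lam: "lam \<longlonglongrightarrow> lam0" and e: "e \<longlonglongrightarrow> 0"
    and v: "\<And>n x. a \<le> x \<Longrightarrow> x \<le> b \<Longrightarrow> \<bar>v n x\<bar> \<le> 1"
    and vd: "\<And>n x. a \<le> x \<Longrightarrow> x \<le> b \<Longrightarrow> \<bar>v n x - v0 x\<bar> \<le> e n"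
    and f0: "\<And>x. a \<le> x \<Longrightarrow> x \<le> b \<Longrightarrow> \<bar>f0 x\<bar> \<le> F"
    and fd: "\<And>n x. a \<le> x \<Longrightarrow> x \<le> b \<Longrightarrow> \<bar>f n x - f0 x\<bar> \<le> e n"
    and W: "\<And>n. solves_linear_ode (\<lambda>x. coeff_matrix (v n x) (f n x) (lam n)) (W n)"
    and W0: "solves_linear_ode (\<lambda>x. coeff_matrix (v0 x) (f0 x) lam0) W0"
    and start: "(\<lambda>n. W n a) \<longlonglongrightarrow> W0 a"
  shows "(\<lambda>n. W n b) \<longlonglongrightarrow> W0 b"
proof -
  define d where "d n x = W n x - W0 x" for n x
  have W0c: "continuous_on {a..b} W0"
    using W0 unfolding solves_linear_ode_def
    by (intro continuous_at_imp_continuous_on ballI) (blast intro: has_vector_derivative_continuous)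
  have "bounded (W0 ` {a..b})"
    by (intro compact_imp_bounded compact_continuous_image W0c) auto
  then obtain B where "\<forall>y\<in>W0 ` {a..b}. norm y \<le> B" unfolding bounded_iff by blast
  then have B: "norm (W0 x) \<le> B" if "a \<le> x" "x \<le> b" for x using that by auto
  have B0: "0 \<le> B" using order_trans[OF norm_ge_zero B[of a]] \<open>a \<le> b\<close> by simp
  define L where "L = 2 + 4 * (norm lam0 + 1) + (F + 1)"
  define k where "k n = (4 * norm (lam n - lam0) + 2 * norm lam0 * e n + e n) * B" for n
  have k: "k \<longlonglongrightarrow> 0"
  proof -
    have "k \<longlonglongrightarrow> (4 * norm (lam0 - lam0) + 2 * norm lam0 * 0 + 0) * B"
      unfolding k_def[abs_def] by (intro tendsto_intros lam e)
    then show ?thesis by simp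
  qed
  define c where "c = exp ((2 * \<bar>L\<bar> + 1) * (b - a))"
  have "eventually (\<lambda>n. norm (lam n) < norm lam0 + 1) sequentially"
    by (rule order_tendstoD[OF tendsto_norm[OF lam]]) simp
  moreover have "eventually (\<lambda>n. e n < 1) sequentially"
    by (rule order_tendstoD[OF e]) simp
  ultimately have ev: "eventually (\<lambda>n. norm (d n b) \<le> sqrt (((norm (d n a))\<^sup>2 + (k n)\<^sup>2) * c)) sequentially"
  proof eventually_elim
    case (elim n)
    show ?case unfolding c_def
    proof (rule norm_gronwall[OF \<open>a \<le> b\<close>])
      fix x assume x: "a \<le> x" "x \<le> b"
      let ?A = "coeff_matrix (v n x) (f n x) (lam n)" and ?L = "coeff_matrix (v0 x) (f0 x) lam0"
      show "(d n has_vector_derivative ?A *v W n x - ?L *v W0 x) (at x)"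
        unfolding d_def[abs_def] using W W0 unfolding solves_linear_ode_def
        by (intro derivative_intros) auto
      have "?A *v W n x - ?L *v W0 x = ?A *v d n x + (?A *v W0 x - ?L *v W0 x)"
        by (simp add: d_def matrix_vector_mult_diff_distrib)
      also have "norm \<dots> \<le> L * norm (d n x) + k n"
      proof (intro order_trans[OF norm_triangle_ineq] add_mono)
        have "\<bar>f n x\<bar> \<le> F + 1" using fd[OF x, of n] f0[OF x] elim by linarith
        moreover have "norm (lam n) * \<bar>v n x\<bar> \<le> (norm lam0 + 1) * 1"
          using v[OF x, of n] elim by (intro mult_mono) auto
        ultimately have "2 + 2 * norm (lam n) + 2 * norm (lam n) * \<bar>v n x\<bar> + \<bar>f n x\<bar> \<le> L"
          using elim by (simp add: L_def)
        from order_trans[OF coeff_matrix_bound mult_right_mono[OF this norm_ge_zero]]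
        show "norm (?A *v d n x) \<le> L * norm (d n x)" .
        have "lam n * of_real (v n x) - lam0 * of_real (v0 x)
            = (lam n - lam0) * of_real (v n x) + lam0 * of_real (v n x - v0 x)"
          by (simp add: algebra_simps)
        also have "norm \<dots> \<le> norm (lam n - lam0) * 1 + norm lam0 * e n"
        proof (intro order_trans[OF norm_triangle_ineq] add_mono)
          show "norm ((lam n - lam0) * of_real (v n x)) \<le> norm (lam n - lam0) * 1"
            unfolding norm_mult norm_of_real by (rule mult_left_mono[OF v[OF x]]) simp
          show "norm (lam0 * of_real (v n x - v0 x)) \<le> norm lam0 * e n"
            unfolding norm_mult norm_of_real by (rule mult_left_mono[OF vd[OF x]]) simp
        qed
        finally have "2 * norm (lam n - lam0) + 2 * norm (lam n * of_real (v n x) - lam0 * of_real (v0 x)) + \<bar>f n x - f0 x\<bar>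
            \<le> 4 * norm (lam n - lam0) + 2 * norm lam0 * e n + e n"
          using fd[OF x, of n] by simp
        from order_trans[OF coeff_matrix_diff_bound mult_mono[OF this B[OF x] _ norm_ge_zero]]
        show "norm (?A *v W0 x - ?L *v W0 x) \<le> k n"
          unfolding k_def using order_trans[OF abs_ge_zero vd[OF x, of n]] by simp
      qed
      finally show "norm (?A *v W n x - ?L *v W0 x) \<le> L * norm (d n x) + k n" .
    qed
  qed
  have "(\<lambda>n. sqrt (((norm (d n a))\<^sup>2 + (k n)\<^sup>2) * c)) \<longlonglongrightarrow> sqrt (((norm (W0 a - W0 a))\<^sup>2 + 0\<^sup>2) * c)"
    unfolding d_def by (intro tendsto_intros start k)
  then have "(\<lambda>n. d n b) \<longlonglongrightarrow> 0"
    by (intro Lim_null_comparison[OF ev]) simp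
  then show ?thesis unfolding d_def by (rule LIM_zero_cancel)
qed

section \<open>Splitting of the spectrum at plus infinity\<close>

text \<open>
  \<open>k1\<close>, \<open>k2\<close>, \<open>k3\<close> are the eigenvalues, with multiplicity, of \<open>coeff_matrix v f lam\<close>.
\<close>

definition vieta :: "real \<Rightarrow> real \<Rightarrow> complex \<Rightarrow> complex \<Rightarrow> complex \<Rightarrow> complex \<Rightarrow> bool" where
  "vieta v f lam k1 k2 k3 \<longleftrightarrow> k1 + k2 + k3 = of_real f - lam \<and>
     k1 * k2 + k1 * k3 + k2 * k3 = - 2 * lam * of_real v \<and> k1 * k2 * k3 = lam\<^sup>2 * of_real v"

text \<open>
  The characteristic equation reads \<open>k\<^sup>2 (k + lam + G) = v (k + lam)\<^sup>2\<close> with \<open>G = v - f\<close>. In terms of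
  \<open>T = (k + lam) / k\<close> this gives \<open>v T\<^sup>2 = k + lam + G\<close> and \<open>k = v T - G / T\<close>, a rational
  parametrisation of the curve. If \<open>k\<close> and \<open>lam\<close> lie in the closed right half plane, then
  \<open>Re (v T\<^sup>2) \<ge> G\<close>, which confines \<open>T\<close> to the regions to the left and to the right of the two branches of a hyperbola,
  and the sign of \<open>Re k\<close> selects the one on the right.
\<close>

lemma unstable_root_ratio:
  assumes v: "0 < v" "f < 0" and lam: "0 \<le> Re lam" and k: "k \<noteq> 0" "0 \<le> Re k"
    and cubic: "k ^ 3 + (lam - of_real f) * k\<^sup>2 - 2 * lam * of_real v * k - lam\<^sup>2 * of_real v = 0"
  shows "sqrt ((v - f) / v) \<le> Re ((k + lam) / k)"
proof -
  define T where "T = (k + lam) / k"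
  define G where "G = v - f"
  define p q where "p = Re T" and "q = Im T"
  have G: "0 < G" using v by (simp add: G_def)
  have kT: "k * T = k + lam" using k by (simp add: T_def)
  have "k\<^sup>2 * (of_real v * T\<^sup>2) = of_real v * (k * T)\<^sup>2" by (simp add: power_mult_distrib)
  also have "\<dots> = k\<^sup>2 * (k + lam + of_real G)"
    using cubic unfolding kT G_def by (simp add: power2_eq_square power3_eq_cube algebra_simps)
  finally have e: "of_real v * T\<^sup>2 = k * T + of_real G" unfolding kT using k by simp
  have "Re (of_real v * T\<^sup>2) = Re k + Re lam + G" unfolding e kT by simp
  moreover have "Re (of_real v * T\<^sup>2) = v * (p\<^sup>2 - q\<^sup>2)" by (simp add: p_def q_def Re_power2)
  ultimately have re: "v * (p\<^sup>2 - q\<^sup>2) \<ge> G" using lam k by simp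
  then have p2: "G / v \<le> p\<^sup>2 - q\<^sup>2" using v by (simp add: field_simps)
  have T0: "T \<noteq> 0"
    using re G by (auto simp: p_def q_def)
  have "Re (k * (T * cnj T)) = Re ((k * T) * cnj T)" by (simp add: mult.assoc)
  also have "k * T = of_real v * T\<^sup>2 - of_real G" using e by simp
  also have "Re ((of_real v * T\<^sup>2 - of_real G) * cnj T) = p * (v * (p\<^sup>2 + q\<^sup>2) - G)"
    by (simp add: p_def q_def power2_eq_square algebra_simps)
  finally have rk: "Re k * (p\<^sup>2 + q\<^sup>2) = p * (v * (p\<^sup>2 + q\<^sup>2) - G)"
    by (simp add: complex_mult_cnj p_def q_def)
  have "0 \<le> p"
  proof (rule ccontr)
    assume "\<not> 0 \<le> p"
    then have pn: "p < 0" by simp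
    have "0 \<le> Re k * (p\<^sup>2 + q\<^sup>2)" using k by simp
    then have "v * (p\<^sup>2 + q\<^sup>2) \<le> G" unfolding rk using pn by (simp add: zero_le_mult_iff)
    with re v have "v * q\<^sup>2 \<le> 0" by (simp add: algebra_simps)
    then have q: "q = 0" using v by (simp add: mult_le_0_iff)
    with re \<open>v * (p\<^sup>2 + q\<^sup>2) \<le> G\<close> have vp: "v * p\<^sup>2 = G" by simp
    have "T = of_real p" using q by (simp add: complex_eq_iff p_def q_def)
    then have "k * T = 0" using e vp by (simp flip: of_real_power of_real_mult)
    with k T0 show False by simp
  qed
  moreover have "G / v \<le> p\<^sup>2" using p2 zero_le_power2[of q] by linarith
  ultimately show ?thesis
    unfolding T_def[symmetric] p_def[symmetric] G_def[symmetric] using real_sqrt_le_mono[of "G / v" "p\<^sup>2"] by simp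
qed

lemma vieta_cubic:
  assumes "vieta v f lam k1 k2 k3"
  shows "k1 ^ 3 + (lam - of_real f) * k1\<^sup>2 - 2 * lam * of_real v * k1 - lam\<^sup>2 * of_real v = 0"
proof -
  have e: "lam - of_real f = - (k1 + k2 + k3)" "- 2 * lam * of_real v = k1 * k2 + k1 * k3 + k2 * k3"
    "lam\<^sup>2 * of_real v = k1 * k2 * k3"
    using assms by (auto simp: vieta_def)
  have "k1 ^ 3 + (lam - of_real f) * k1\<^sup>2 - 2 * lam * of_real v * k1 - lam\<^sup>2 * of_real v
      = k1 ^ 3 + (lam - of_real f) * k1\<^sup>2 + (- 2 * lam * of_real v) * k1 - lam\<^sup>2 * of_real v"
    by simp
  also have "\<dots> = 0"
    unfolding e by (simp add: power2_eq_square power3_eq_cube algebra_simps)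
  finally show ?thesis .
qed

lemma vieta_commute: "vieta v f lam k1 k2 k3 \<Longrightarrow> vieta v f lam k2 k1 k3"
  "vieta v f lam k1 k2 k3 \<Longrightarrow> vieta v f lam k1 k3 k2"
  by (auto simp: vieta_def algebra_simps)

text \<open>
  The three ratios \<open>T\<close> have sum \<open>1\<close> and product \<open>- R\<^sup>2\<close> with \<open>R\<^sup>2 = (v - f) / v > 1\<close>. If two of them had
  real part at least \<open>R\<close>, the third would have modulus at most \<open>1\<close> by the product and at least
  \<open>2 R - 1 > 1\<close> by the sum.
\<close>

lemma single_unstable_root:
  assumes v: "0 < v" "f < 0" and lam: "0 \<le> Re lam" "lam \<noteq> 0" and V: "vieta v f lam k1 k2 k3"
    and k1: "0 \<le> Re k1"
  shows "Re k2 < 0"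
proof (rule ccontr)
  assume "\<not> Re k2 < 0"
  then have k2: "0 \<le> Re k2" by simp
  have prod: "k1 * k2 * k3 = lam\<^sup>2 * of_real v" using V by (simp add: vieta_def)
  then have nz: "k1 \<noteq> 0" "k2 \<noteq> 0" "k3 \<noteq> 0" using lam v by auto
  define T1 T2 T3 where "T1 = (k1 + lam) / k1" and "T2 = (k2 + lam) / k2" and "T3 = (k3 + lam) / k3"
  define R where "R = sqrt ((v - f) / v)"
  have R2: "R\<^sup>2 = (v - f) / v" using v by (simp add: R_def)
  have R1: "1 < R" unfolding R_def using v by (simp add: field_simps)
  have r: "R \<le> Re T1" "R \<le> Re T2"
    unfolding R_def T1_def T2_def
    using unstable_root_ratio[OF v lam(1) nz(1) k1 vieta_cubic[OF V]]
      unstable_root_ratio[OF v lam(1) nz(2) k2 vieta_cubic[OF vieta_commute(1)[OF V]]] by auto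
  have nz3: "k1 * k2 * k3 \<noteq> 0" using nz by simp
  have "(k1 * k2 * k3) * (T1 + T2 + T3) = 3 * (k1 * k2 * k3) + lam * (k1 * k2 + k1 * k3 + k2 * k3)"
    using nz by (simp add: T1_def T2_def T3_def field_simps)
  also have "\<dots> = (k1 * k2 * k3) * 1"
    using V by (simp add: vieta_def power2_eq_square algebra_simps)
  finally have sum: "T1 + T2 + T3 = 1" using nz3 by (simp only: mult_cancel_left) auto
  have "(k1 * k2 * k3) * (T1 * T2 * T3) = (k1 + lam) * (k2 + lam) * (k3 + lam)"
    using nz by (simp add: T1_def T2_def T3_def field_simps)
  also have "\<dots> = lam ^ 3 + lam\<^sup>2 * (k1 + k2 + k3) + lam * (k1 * k2 + k1 * k3 + k2 * k3) + k1 * k2 * k3"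
    by (simp add: power2_eq_square power3_eq_cube algebra_simps)
  also have "\<dots> = lam ^ 3 + lam\<^sup>2 * (of_real f - lam) + lam * (- 2 * lam * of_real v) + lam\<^sup>2 * of_real v"
    using V by (simp only: vieta_def)
  also have "\<dots> = lam\<^sup>2 * (of_real f - of_real v)"
    by (simp add: power2_eq_square power3_eq_cube algebra_simps)
  finally have "lam\<^sup>2 * (of_real v * (T1 * T2 * T3)) = lam\<^sup>2 * (of_real f - of_real v)"
    unfolding prod by (simp add: mult.assoc)
  then have "of_real v * (T1 * T2 * T3) = of_real f - of_real v" using lam by simp
  then have "T1 * T2 * T3 = - of_real (R\<^sup>2)" using v by (simp add: R2 field_simps)
  then have "norm (T1 * T2 * T3) = R\<^sup>2" by (simp add: norm_power)
  then have n: "norm T1 * norm T2 * norm T3 = R\<^sup>2" by (simp add: norm_mult)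
  have "R \<le> norm T1" "R \<le> norm T2" using r complex_Re_le_cmod order_trans by blast+
  then have "R * R \<le> norm T1 * norm T2" using R1 by (intro mult_mono) auto
  have "2 * R - 1 \<le> Re (T1 + T2 - 1)" using r by simp
  also have "\<dots> = Re (- T3)" using sum by (metis add_diff_cancel_left' diff_add_cancel minus_diff_eq)
  also have "\<dots> \<le> norm T3" using complex_Re_le_cmod[of "- T3"] by simp
  finally have "1 < norm T3" using R1 by simp
  then have "R * R * 1 < norm T1 * norm T2 * norm T3"
    using \<open>R * R \<le> norm T1 * norm T2\<close> R1 by (intro mult_le_less_imp_less) auto
  with n show False by (simp add: power2_eq_square)
qed

lemma remaining_roots:
  assumes "nu ^ 3 + (lam - of_real f) * nu\<^sup>2 - 2 * lam * of_real v * nu - lam\<^sup>2 * of_real v = 0"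
  obtains k2 k3 where "vieta v f lam nu k2 k3"
proof -
  define s where "s = of_real f - lam - nu"
  define p where "p = - 2 * lam * of_real v - nu * s"
  define r where "r = csqrt (s\<^sup>2 - 4 * p)"
  have r: "r\<^sup>2 = s\<^sup>2 - 4 * p" by (simp add: r_def)
  have prod: "((s + r) / 2) * ((s - r) / 2) = p"
  proof -
    have "((s + r) / 2) * ((s - r) / 2) = (s\<^sup>2 - r\<^sup>2) / 4" by (simp add: power2_eq_square algebra_simps)
    then show ?thesis unfolding r by simp
  qed
  have sum: "(s + r) / 2 + (s - r) / 2 = s" by (simp add: field_simps)
  have "nu * p = lam\<^sup>2 * of_real v"
    using assms by (simp add: p_def s_def power2_eq_square power3_eq_cube algebra_simps)
  moreover have "nu * ((s + r) / 2) + nu * ((s - r) / 2) = nu * s"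
    using sum by (metis distrib_left)
  ultimately have "vieta v f lam nu ((s + r) / 2) ((s - r) / 2)"
    unfolding vieta_def using prod sum by (simp add: mult.assoc add.assoc) (simp add: p_def s_def)
  then show ?thesis by (rule that)
qed

text \<open>
  The second alternative covers \<open>lam = 0\<close> and the limiting problem \<open>v = 0\<close>, where the eigenvalue \<open>0\<close> is
  double and \<open>\<nu> = 0\<close>.
\<close>

lemma dominant_root:
  assumes f: "f < 0" and lam: "0 \<le> Re lam"
    and nu: "0 < v \<and> lam \<noteq> 0 \<and> 0 < Re nu \<and>
        nu ^ 3 + (lam - of_real f) * nu\<^sup>2 - 2 * lam * of_real v * nu - lam\<^sup>2 * of_real v = 0
      \<or> nu = 0 \<and> (lam = 0 \<or> v = 0)"
  obtains k2 k3 where "vieta v f lam nu k2 k3" "Re k2 \<le> Re nu" "Re k3 \<le> Re nu"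
  using nu
proof
  assume a: "0 < v \<and> lam \<noteq> 0 \<and> 0 < Re nu \<and>
        nu ^ 3 + (lam - of_real f) * nu\<^sup>2 - 2 * lam * of_real v * nu - lam\<^sup>2 * of_real v = 0"
  then obtain k2 k3 where V: "vieta v f lam nu k2 k3" by (blast elim: remaining_roots)
  have "Re k2 < 0" "Re k3 < 0"
    using single_unstable_root[OF _ f lam _ V] single_unstable_root[OF _ f lam _ vieta_commute(2)[OF V]] a by auto
  with V a show ?thesis by (intro that) auto
next
  assume "nu = 0 \<and> (lam = 0 \<or> v = 0)"
  then have "vieta v f lam nu 0 (of_real f - lam)" by (auto simp: vieta_def)
  with f lam \<open>nu = 0 \<and> (lam = 0 \<or> v = 0)\<close> show ?thesis by (intro that) auto
qed

section \<open>Exponential convergence of the adjoint mode\<close>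

text \<open>
  Conjugating the adjoint system turns it into the system for row vectors, \<open>z' = - z A\<close>, which is
  free of conjugates and analytic in \<open>lam\<close>.
\<close>

definition row_adjoint :: "real \<Rightarrow> real \<Rightarrow> complex \<Rightarrow> complex^3^3" where
  "row_adjoint v f lam = - transpose (coeff_matrix v f lam)"

definition cnj_vec :: "complex^3 \<Rightarrow> complex^3" where
  "cnj_vec w = (\<chi> i. cnj (w $ i))"

lemma row_adjoint_mult:
  "(row_adjoint v f lam *v w) $ 1 = - (lam * of_real v * w $ 3)"
  "(row_adjoint v f lam *v w) $ 2 = - (lam * w $ 1) - lam * of_real v * w $ 3"
  "(row_adjoint v f lam *v w) $ 3 = - (w $ 1) - w $ 2 + (lam - of_real f) * w $ 3"
  by (simp_all add: row_adjoint_def transpose_def coeff_matrix_def matrix_vector_mult_def sum_3 algebra_simps)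

lemma cnj_vec_adjoint:
  "cnj_vec (- conj_transpose (coeff_matrix v f lam) *v w) = row_adjoint v f lam *v cnj_vec w"
  by (simp add: vec_eq_iff cnj_vec_def row_adjoint_def conj_transpose_def transpose_def matrix_vector_mult_def)

lemma cayley_hamilton_row_adjoint:
  assumes "vieta v f lam k1 k2 k3"
  defines "N \<equiv> row_adjoint v f lam"
  shows "N *v (N *v (N *v w + k3 *s w) + k2 *s (N *v w + k3 *s w))
     + k1 *s (N *v (N *v w + k3 *s w) + k2 *s (N *v w + k3 *s w)) = 0"
proof -
  define a b c where "a = N *v w" and "b = N *v a" and "c = N *v b"
  have c: "c = - ((of_real f - lam) *s b + (- 2 * lam * of_real v) *s a + (lam\<^sup>2 * of_real v) *s w)"
    unfolding c_def b_def a_def N_def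
    by (simp add: vec_eq_iff forall_3 row_adjoint_mult power2_eq_square algebra_simps)
  have "N *v (N *v (N *v w + k3 *s w) + k2 *s (N *v w + k3 *s w))
     + k1 *s (N *v (N *v w + k3 *s w) + k2 *s (N *v w + k3 *s w))
     = c + (k1 + k2 + k3) *s b + (k1 * k2 + k1 * k3 + k2 * k3) *s a + (k1 * k2 * k3) *s w"
    by (simp add: a_def b_def c_def matrix_vector_right_distrib vector_scalar_commute vec_eq_iff algebra_simps)
  also have "\<dots> = 0"
  proof -
    have e: "k1 + k2 + k3 = of_real f - lam" "k1 * k2 + k1 * k3 + k2 * k3 = - 2 * lam * of_real v"
      "k1 * k2 * k3 = lam\<^sup>2 * of_real v" using assms by (auto simp: vieta_def)
    show ?thesis unfolding e c by simp
  qed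
  finally show ?thesis .
qed

definition exp_decaying :: "real \<Rightarrow> (real \<Rightarrow> complex^3) \<Rightarrow> bool" where
  "exp_decaying \<beta> u \<longleftrightarrow> (\<exists>C. \<forall>x\<ge>0. norm (u x) \<le> C * exp (- \<beta> * x))"

lemma exp_decaying_add: "exp_decaying \<beta> u \<Longrightarrow> exp_decaying \<beta> w \<Longrightarrow> exp_decaying \<beta> (\<lambda>x. u x + w x)"
proof -
  assume "exp_decaying \<beta> u" "exp_decaying \<beta> w"
  then obtain C D where CD: "\<And>x. 0 \<le> x \<Longrightarrow> norm (u x) \<le> C * exp (- \<beta> * x)" "\<And>x. 0 \<le> x \<Longrightarrow> norm (w x) \<le> D * exp (- \<beta> * x)"
    unfolding exp_decaying_def by blast
  have "norm (u x + w x) \<le> (C + D) * exp (- \<beta> * x)" if "0 \<le> x" for x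
    using CD[OF that] norm_triangle_ineq[of "u x" "w x"] by (simp add: algebra_simps)
  then show ?thesis unfolding exp_decaying_def by blast
qed

lemma exp_decaying_smult: "exp_decaying \<beta> u \<Longrightarrow> exp_decaying \<beta> (\<lambda>x. c *s u x)"
proof -
  assume "exp_decaying \<beta> u"
  then obtain C where C: "\<And>x. 0 \<le> x \<Longrightarrow> norm (u x) \<le> C * exp (- \<beta> * x)"
    unfolding exp_decaying_def by blast
  have "norm (c *s u x) \<le> (norm c * C) * exp (- \<beta> * x)" if "0 \<le> x" for x
    unfolding norm_smult_vec mult.assoc by (intro mult_left_mono C that) simp
  then show ?thesis unfolding exp_decaying_def by blast
qed

lemma exp_decaying_matrix: "exp_decaying \<beta> u \<Longrightarrow> exp_decaying \<beta> (\<lambda>x. M *v u x)"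
proof -
  assume "exp_decaying \<beta> u"
  then obtain C where C: "\<And>x. 0 \<le> x \<Longrightarrow> norm (u x) \<le> C * exp (- \<beta> * x)"
    unfolding exp_decaying_def by blast
  have "bounded_linear ((*v) M)" by (rule matrix_vector_mul_bounded_linear)
  then obtain K where K: "0 < K" "\<And>w. norm (M *v w) \<le> norm w * K"
    using bounded_linear.pos_bounded by blast
  have "norm (M *v u x) \<le> (K * C) * exp (- \<beta> * x)" if "0 \<le> x" for x
    using K(2)[of "u x"] mult_left_mono[OF C[OF that] less_imp_le[OF K(1)]] by (simp add: mult_ac)
  then show ?thesis unfolding exp_decaying_def by blast
qed

lemma exp_decaying_step:
  assumes \<beta>: "0 < \<beta>" and h: "exp_decaying \<beta> h" and \<theta>: "0 \<le> Re \<theta>" and lim: "(u \<longlongrightarrow> 0) at_top"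
    and der: "\<And>x i. 0 \<le> x \<Longrightarrow> ((\<lambda>x. u x $ i) has_vector_derivative (\<theta> *s u x + h x) $ i) (at x)"
  shows "exp_decaying \<beta> u"
proof -
  obtain C where C: "\<And>x. 0 \<le> x \<Longrightarrow> norm (h x) \<le> C * exp (- \<beta> * x)"
    using h unfolding exp_decaying_def by blast
  define D where "D = C / (Re \<theta> + \<beta>)"
  have comp: "norm (u x $ i) \<le> D * exp (- \<beta> * x)" if "0 \<le> x" for x i
    unfolding D_def
  proof (rule variation_of_constants_bound[OF _ _ _ _ that])
    fix t :: real assume t: "0 \<le> t"
    show "((\<lambda>x. u x $ i) has_vector_derivative \<theta> * u t $ i + h t $ i) (at t)"
      using der[OF t, of i] by simp
    show "norm (h t $ i) \<le> C * exp (- \<beta> * t)"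
      using C[OF t] Finite_Cartesian_Product.norm_nth_le order_trans by blast
  next
    show "0 < Re \<theta> + \<beta>" using \<beta> \<theta> by simp
    show "((\<lambda>x. exp (- \<theta> * of_real x) * u x $ i) \<longlongrightarrow> 0) at_top"
      using lim \<theta> by (intro exp_times_bounded_tendsto_0) (auto intro!: tendsto_eq_intros)
  qed
  have "norm (u x) \<le> (3 * D) * exp (- \<beta> * x)" if "0 \<le> x" for x
    using norm_vec3_le[of "u x"] comp[OF that, of 1] comp[OF that, of 2] comp[OF that, of 3] by simp
  then show ?thesis unfolding exp_decaying_def by blast
qed

lemma matrix_component_derivative:
  fixes M :: "complex^3^3"
  assumes "\<And>i. ((\<lambda>x. u x $ i) has_vector_derivative u' $ i) (at x)"
  shows "((\<lambda>x. (M *v u x) $ i) has_vector_derivative (M *v u') $ i) (at (x::real))"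
  unfolding matrix_vector_mult_def
  by (auto intro!: derivative_eq_intros assms)

text \<open>
  The difference \<open>y\<close> from the end vector solves \<open>y' = (N + \<nu>) y + h\<close> with \<open>h\<close> exponentially small.
  By Cayley-Hamilton, \<open>(N + \<nu>) (N + k2) (N + k3) = 0\<close>, so the vectors \<open>q1 = (N + k2) (N + k3) y\<close>,
  \<open>q2 = (N + k3) y\<close> and \<open>y\<close> solve a triangular chain of scalar-type equations with exponents \<open>0\<close>, \<open>\<nu> - k2\<close>
  and \<open>\<nu> - k3\<close>. None of these has negative real part, and \<open>y\<close> vanishes at infinity, so the rate passes
  from \<open>h\<close> to \<open>q1\<close>, \<open>q2\<close> and \<open>y\<close>. Working with this chain instead of eigenvectors covers coinciding eigenvalues as well. The
  implied constant depends on \<open>vp\<close> and \<open>lam\<close>, which is enough for taking limits at fixed parameters.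
\<close>

lemma adjoint_mode_decay:
  fixes Wt :: "real \<Rightarrow> complex^3"
  assumes \<beta>: "0 < \<beta>"
    and v: "\<And>x. 0 \<le> x \<Longrightarrow> \<bar>v x - vi\<bar> \<le> C * exp (- \<beta> * x)"
    and f: "\<And>x. 0 \<le> x \<Longrightarrow> \<bar>f x - fi\<bar> \<le> C * exp (- \<beta> * x)"
    and Wt: "solves_linear_ode (\<lambda>x. - conj_transpose (coeff_matrix (v x) (f x) lam)) Wt"
    and V: "vieta vi fi lam nu k2 k3" "Re k2 \<le> Re nu" "Re k3 \<le> Re nu"
    and eig: "row_adjoint vi fi lam *v \<eta> = - nu *s \<eta>"
    and lim: "((\<lambda>x. exp (nu * of_real x) *s cnj_vec (Wt x)) \<longlongrightarrow> \<eta>) at_top"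
  shows "exp_decaying \<beta> (\<lambda>x. exp (nu * of_real x) *s cnj_vec (Wt x) - \<eta>)"
proof -
  define z where "z x = exp (nu * of_real x) *s cnj_vec (Wt x)" for x :: real
  define N where "N = row_adjoint vi fi lam"
  define y where "y x = z x - \<eta>" for x
  define h where "h x = row_adjoint (v x) (f x) lam *v z x - N *v z x" for x
  define q2 where "q2 x = N *v y x + k3 *s y x" for x
  define q1 where "q1 x = N *v q2 x + k2 *s q2 x" for x
  define h2 where "h2 x = N *v h x + k3 *s h x" for x
  define h1 where "h1 x = N *v h2 x + k2 *s h2 x" for x
  have CH: "N *v q1 x + nu *s q1 x = 0" for x
    unfolding q1_def q2_def N_def by (rule cayley_hamilton_row_adjoint[OF V(1)])
  have z_der: "((\<lambda>x. z x $ i) has_vector_derivative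
      (row_adjoint (v x) (f x) lam *v z x + nu *s z x) $ i) (at x)" for x i
  proof -
    have "((\<lambda>z. exp (nu * z)) has_field_derivative (nu * exp (nu * of_real x))) (at (of_real x))"
      by (auto intro!: derivative_eq_intros)
    then have e: "((\<lambda>t. exp (nu * of_real t)) has_vector_derivative (nu * exp (nu * of_real x))) (at x)"
      by (rule has_vector_derivative_real_field)
    have "((\<lambda>x. cnj (Wt x $ i)) has_vector_derivative
        cnj ((- conj_transpose (coeff_matrix (v x) (f x) lam) *v Wt x) $ i)) (at x)"
      by (rule bounded_linear.has_vector_derivative[OF bounded_linear_cnj solves_componentD[OF Wt]])
    then have "((\<lambda>x. cnj_vec (Wt x) $ i) has_vector_derivative (row_adjoint (v x) (f x) lam *v cnj_vec (Wt x)) $ i) (at x)"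
      unfolding cnj_vec_adjoint[symmetric] by (simp add: cnj_vec_def)
    from has_vector_derivative_mult[OF e this]
    show ?thesis by (simp add: z_def vector_scalar_commute algebra_simps)
  qed
  have y_der: "((\<lambda>x. y x $ i) has_vector_derivative (N *v y x + nu *s y x + h x) $ i) (at x)" for x i
  proof -
    have "((\<lambda>x. y x $ i) has_vector_derivative (row_adjoint (v x) (f x) lam *v z x + nu *s z x) $ i) (at x)"
      using has_vector_derivative_diff[OF z_der[of i x] has_vector_derivative_const[of "\<eta> $ i"]]
      by (simp add: y_def)
    moreover have "row_adjoint (v x) (f x) lam *v z x + nu *s z x = N *v y x + nu *s y x + h x"
      using eig by (simp add: h_def y_def N_def matrix_vector_mult_diff_distrib vec_eq_iff algebra_simps)
    ultimately show ?thesis by simp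
  qed
  have step: "((\<lambda>x. (N *v q x + k *s q x) $ i) has_vector_derivative
      (N *v (N *v q x + k *s q x) + nu *s (N *v q x + k *s q x) + (N *v g x + k *s g x)) $ i) (at x)"
    if "\<And>i. ((\<lambda>x. q x $ i) has_vector_derivative (N *v q x + nu *s q x + g x) $ i) (at x)" for q g k x i
  proof -
    have "((\<lambda>x. (N *v q x) $ i + k * q x $ i) has_vector_derivative
        (N *v (N *v q x + nu *s q x + g x)) $ i + k * (N *v q x + nu *s q x + g x) $ i) (at x)"
      by (intro has_vector_derivative_add matrix_component_derivative has_vector_derivative_mult_right that)
    then show ?thesis
      by (simp add: matrix_vector_right_distrib vector_scalar_commute algebra_simps)
  qed
  have q2_der: "((\<lambda>x. q2 x $ i) has_vector_derivative (N *v q2 x + nu *s q2 x + h2 x) $ i) (at x)" for x i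
    unfolding q2_def h2_def by (rule step[OF y_der])
  have q1_der: "((\<lambda>x. q1 x $ i) has_vector_derivative (N *v q1 x + nu *s q1 x + h1 x) $ i) (at x)" for x i
    unfolding q1_def h1_def by (rule step[OF q2_der])
  have y_lim: "(y \<longlongrightarrow> 0) at_top"
    unfolding y_def[abs_def] z_def using lim by (rule LIM_zero)
  have lin_lim: "((\<lambda>x. N *v q x + k *s q x) \<longlongrightarrow> 0) at_top" if "(q \<longlongrightarrow> 0) at_top" for q k
  proof -
    have "((\<lambda>x. N *v q x) \<longlongrightarrow> N *v 0) at_top"
      by (rule bounded_linear.tendsto[OF matrix_vector_mul_bounded_linear that])
    moreover have "((\<lambda>x. k *s q x) \<longlongrightarrow> 0) at_top"
      by (rule vec_tendstoI) (use that in \<open>auto intro!: tendsto_eq_intros\<close>)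
    ultimately show ?thesis using tendsto_add by fastforce
  qed
  have q2_lim: "(q2 \<longlongrightarrow> 0) at_top" unfolding q2_def[abs_def] by (rule lin_lim[OF y_lim])
  have q1_lim: "(q1 \<longlongrightarrow> 0) at_top" unfolding q1_def[abs_def] by (rule lin_lim[OF q2_lim])
  have h: "exp_decaying \<beta> h"
  proof -
    have "continuous_on {0..} (\<lambda>x. \<chi> i. y x $ i)"
      by (rule continuous_on_vec_lambda) (auto intro!: continuous_at_imp_continuous_on has_vector_derivative_continuous[OF y_der])
    then have "continuous_on {0..} y" by simp
    then obtain B where B: "0 < B" "\<And>x. 0 \<le> x \<Longrightarrow> norm (y x) \<le> B"
      using bounded_halfline_of_tendsto_0[OF _ y_lim] by blast
    have zB: "norm (z x) \<le> B + norm \<eta>" if "0 \<le> x" for x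
      using B(2)[OF that] norm_triangle_ineq[of "y x" \<eta>] by (simp add: y_def)
    have "norm (h x) \<le> ((2 * norm lam + 1) * C * (B + norm \<eta>)) * exp (- \<beta> * x)" if x: "0 \<le> x" for x
    proof -
      have h12: "h x $ 1 = - (lam * of_real (v x - vi) * z x $ 3)" "h x $ 2 = - (lam * of_real (v x - vi) * z x $ 3)"
        and h3: "h x $ 3 = - (of_real (f x - fi) * z x $ 3)"
        by (simp_all add: h_def N_def row_adjoint_mult algebra_simps)
      have z3: "norm (z x $ 3) \<le> B + norm \<eta>"
        using zB[OF x] Finite_Cartesian_Product.norm_nth_le order_trans by blast
      have "norm (lam * of_real (v x - vi) * z x $ 3) \<le> norm lam * (C * exp (- \<beta> * x)) * (B + norm \<eta>)"
        unfolding norm_mult norm_of_real using v[OF x] z3 by (intro mult_mono) auto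
      moreover have "norm (of_real (f x - fi) * z x $ 3) \<le> (C * exp (- \<beta> * x)) * (B + norm \<eta>)"
        unfolding norm_mult norm_of_real using f[OF x] z3 by (intro mult_mono) auto
      ultimately show ?thesis
        using norm_vec3_le[of "h x"] unfolding h12 h3 norm_minus_cancel by (simp add: algebra_simps)
    qed
    then show ?thesis unfolding exp_decaying_def by blast
  qed
  have h2: "exp_decaying \<beta> h2" unfolding h2_def[abs_def]
    by (intro exp_decaying_add exp_decaying_matrix exp_decaying_smult h)
  have h1: "exp_decaying \<beta> h1" unfolding h1_def[abs_def]
    by (intro exp_decaying_add exp_decaying_matrix exp_decaying_smult h2)
  have q1: "exp_decaying \<beta> q1"
    by (rule exp_decaying_step[OF \<beta> h1 _ q1_lim, of 0]) (use q1_der CH in auto)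
  have q2: "exp_decaying \<beta> q2"
  proof (rule exp_decaying_step[OF \<beta> exp_decaying_add[OF q1 h2] _ q2_lim, of "nu - k2"])
    fix x i
    show "((\<lambda>x. q2 x $ i) has_vector_derivative ((nu - k2) *s q2 x + (q1 x + h2 x)) $ i) (at x)"
      using q2_der[of i x] by (simp add: q1_def algebra_simps)
  qed (use V in auto)
  have "exp_decaying \<beta> y"
  proof (rule exp_decaying_step[OF \<beta> exp_decaying_add[OF q2 h] _ y_lim, of "nu - k3"])
    fix x i
    show "((\<lambda>x. y x $ i) has_vector_derivative ((nu - k3) *s y x + (q2 x + h x)) $ i) (at x)"
      using y_der[of i x] by (simp add: q2_def algebra_simps)
  qed (use V in auto)
  then show ?thesis by (simp add: y_def[abs_def] z_def)
qed

section \<open>Growth of solutions on the right half line\<close>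

lemma inner_le_norms:
  fixes a b :: complex
  shows "norm a \<le> A \<Longrightarrow> norm b \<le> B \<Longrightarrow> inner a b \<le> A * B"
  using norm_cauchy_schwarz[of a b] mult_mono[of "norm a" A "norm b" B] norm_ge_zero[of a] norm_ge_zero[of b]
  by linarith

lemma inner_mult_self:
  fixes c z :: complex
  shows "inner z (c * z) = Re c * (norm z)\<^sup>2"
  unfolding cmod_power2 by (simp add: inner_complex_def power2_eq_square algebra_simps)

definition growth_const :: "real \<Rightarrow> real \<Rightarrow> real" where
  "growth_const L R = 65 * (32 * L + 34) * R"

text \<open>
  For \<open>v = 0\<close> the first two components grow linearly at most and the third decays. A small weight
  \<open>\<delta>\<close> on the first component makes the coupling \<open>lam w2\<close> small, a large weight on the third does the
  same for \<open>w3\<close>, and smallness of \<open>v\<close> then controls the feedback \<open>lam v (w1 + w2)\<close>. The resulting growth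
  rate of the norm is \<open>1 / 32\<close>, well below the rates of decay it has to compete with.
\<close>

lemma forward_growth:
  fixes W :: "real \<Rightarrow> complex^3"
  assumes lam: "norm lam \<le> L" "0 \<le> Re lam" and X: "0 \<le> X"
    and v: "\<And>x. X \<le> x \<Longrightarrow> 0 \<le> v x" "\<And>x. X \<le> x \<Longrightarrow> v x \<le> 1 / (131072 * (L + 1)\<^sup>2)"
    and f: "\<And>x. X \<le> x \<Longrightarrow> f x \<le> 0"
    and W: "solves_linear_ode (\<lambda>x. coeff_matrix (v x) (f x) lam) W"
    and R: "norm (W X) \<le> R" and x: "X \<le> x"
  shows "norm (W x) \<le> growth_const L R * exp (x / 32)"
proof -
  have L0: "0 \<le> L" using lam(1) norm_ge_zero order_trans by blast
  have R0: "0 \<le> R" using R norm_ge_zero order_trans by blast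
  \<comment> \<open>Chosen so that \<open>2 \<delta> L \<le> 1 / 16\<close>, the rate aimed at for the square of the norm.\<close>
  define \<delta> where "\<delta> = 1 / (32 * (L + 1))"
  have \<delta>: "0 < \<delta>" "\<delta> \<le> 1 / 32" using L0 by (auto simp: \<delta>_def field_simps)
  have \<delta>L: "2 * \<delta> * L \<le> 1 / 16" using L0 by (simp add: \<delta>_def field_simps)
  define w1 w2 w3 where "w1 = (\<lambda>x. W x $ 1)" and "w2 = (\<lambda>x. W x $ 2)" and "w3 = (\<lambda>x. W x $ 3)"
  define E where "E x = \<delta>\<^sup>2 * (norm (w1 x))\<^sup>2 + (norm (w2 x))\<^sup>2 + 4096 * (norm (w3 x))\<^sup>2" for x
  define E' where "E' x = \<delta>\<^sup>2 * (2 * inner (w1 x) (lam * w2 x + w3 x)) + 2 * inner (w2 x) (w3 x)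
      + 4096 * (2 * inner (w3 x) (lam * of_real (v x) * (w1 x + w2 x) + (of_real (f x) - lam) * w3 x))" for x
  have E_der: "(E has_real_derivative E' x) (at x)" for x
  proof -
    have "(w1 has_vector_derivative lam * w2 x + w3 x) (at x)" "(w2 has_vector_derivative w3 x) (at x)"
      "(w3 has_vector_derivative lam * of_real (v x) * (w1 x + w2 x) + (of_real (f x) - lam) * w3 x) (at x)"
      using solves_componentD[OF W, of 1 x] solves_componentD[OF W, of 2 x] solves_componentD[OF W, of 3 x]
      by (simp_all add: coeff_matrix_mult w1_def w2_def w3_def)
    note d = this[THEN norm_square_derivative]
    show ?thesis unfolding E_def[abs_def] E'_def
      by (intro DERIV_add DERIV_cmult d)
  qed
  have E'_le: "E' x \<le> 1 / 16 * E x" if x: "X \<le> x" for x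
  proof -
    define a b c where "a = \<delta> * norm (w1 x)" and "b = norm (w2 x)" and "c = 64 * norm (w3 x)"
    have abc: "0 \<le> a" "0 \<le> b" "0 \<le> c" using \<delta> by (auto simp: a_def b_def c_def)
    \<comment> \<open>The constant \<open>131072 = 32 * 4096\<close> in the hypothesis makes \<open>L v\<close> at most \<open>\<delta> / 4096\<close>.\<close>
    have vL: "128 * L * v x \<le> \<delta> / 32"
    proof -
      have "L * v x \<le> (L + 1) * (1 / (131072 * (L + 1)\<^sup>2))"
        using v[OF x] L0 by (intro mult_mono) auto
      also have "\<dots> = \<delta> / 4096" using L0 by (simp add: \<delta>_def power2_eq_square)
      finally show ?thesis by simp
    qed
    have i1: "inner (w1 x) (lam * w2 x + w3 x) \<le> norm (w1 x) * (L * norm (w2 x) + norm (w3 x))"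
      using lam by (intro inner_le_norms order_trans[OF norm_triangle_ineq] add_mono)
        (auto simp: norm_mult intro!: mult_right_mono)
    have i2: "inner (w2 x) (w3 x) \<le> norm (w2 x) * norm (w3 x)" by (rule norm_cauchy_schwarz)
    have i3: "inner (w3 x) (lam * of_real (v x) * (w1 x + w2 x)) \<le> norm (w3 x) * (L * v x * (norm (w1 x) + norm (w2 x)))"
      using lam v[OF x] L0 by (intro inner_le_norms)
        (auto simp: norm_mult intro!: mult_mono norm_triangle_ineq)
    have "inner (w3 x) ((of_real (f x) - lam) * w3 x) = (f x - Re lam) * (norm (w3 x))\<^sup>2"
      by (simp add: inner_mult_self)
    also have "\<dots> \<le> 0" using f[OF x] lam by (intro mult_nonpos_nonneg) auto
    finally have i4: "inner (w3 x) ((of_real (f x) - lam) * w3 x) \<le> 0" .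
    have "E' x \<le> \<delta>\<^sup>2 * (2 * (norm (w1 x) * (L * norm (w2 x) + norm (w3 x)))) + 2 * (norm (w2 x) * norm (w3 x))
       + 4096 * (2 * (norm (w3 x) * (L * v x * (norm (w1 x) + norm (w2 x)))))"
      unfolding E'_def inner_add_right[of "w3 x"] using i1 i2 i3 i4
      by (intro add_mono mult_left_mono) auto
    also have "\<dots> = (2 * \<delta> * L) * (a * b) + (\<delta> / 32) * (a * c) + 1 / 32 * (b * c)
       + (128 * L * v x) * (c * (norm (w1 x) + norm (w2 x)))"
      by (simp add: a_def b_def c_def power2_eq_square algebra_simps)
    also have "\<dots> \<le> (2 * \<delta> * L) * (a * b) + (\<delta> / 32) * (a * c) + 1 / 32 * (b * c)
       + (\<delta> / 32) * (c * (norm (w1 x) + norm (w2 x)))"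
      using abc vL by (intro add_left_mono mult_right_mono) auto
    also have "\<dots> = (2 * \<delta> * L) * (a * b) + (\<delta> / 32 + 1 / 32) * (a * c) + (1 / 32 + \<delta> / 32) * (b * c)"
      by (simp add: a_def b_def algebra_simps)
    also have "\<dots> \<le> 1 / 16 * (a * b) + 1 / 16 * (a * c) + 1 / 16 * (b * c)"
      using abc \<delta> \<delta>L by (intro add_mono mult_right_mono) auto
    also have "\<dots> \<le> 1 / 16 * (a\<^sup>2 + b\<^sup>2 + c\<^sup>2)"
      using sum_squares_bound[of a b] sum_squares_bound[of a c] sum_squares_bound[of b c] by simp
    also have "a\<^sup>2 + b\<^sup>2 + c\<^sup>2 = E x"
      by (simp add: E_def a_def b_def c_def power_mult_distrib)
    finally show ?thesis .
  qed
  have "E x \<le> E X * exp (1 / 16 * (x - X))"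
    by (rule exp_growth_bound[OF x E_der E'_le])
  also have "\<dots> \<le> (4225 * R\<^sup>2) * exp (x / 16)"
  proof (rule mult_mono)
    have n: "(norm (W X $ i))\<^sup>2 \<le> R\<^sup>2" for i
      using R Finite_Cartesian_Product.norm_nth_le[of "W X" i] by (intro power_mono) auto
    have "\<delta>\<^sup>2 * (norm (w1 X))\<^sup>2 \<le> 1 * R\<^sup>2"
      using n \<delta> by (intro mult_mono) (auto simp: w1_def power_le_one)
    then show "E X \<le> 4225 * R\<^sup>2" unfolding E_def w2_def w3_def using n[of 2] n[of 3] zero_le_power2[of R] by linarith
  qed (use X in auto)
  also have "\<dots> = (65 * R * exp (x / 32))\<^sup>2"
    by (simp add: power_mult_distrib flip: exp_double)
  finally have EB: "E x \<le> (65 * R * exp (x / 32))\<^sup>2" .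
  let ?B = "65 * R * exp (x / 32)"
  have B0: "0 \<le> ?B" using R0 by simp
  have "(\<delta> * norm (w1 x))\<^sup>2 \<le> ?B\<^sup>2" "(norm (w2 x))\<^sup>2 \<le> ?B\<^sup>2" "(norm (w3 x))\<^sup>2 \<le> ?B\<^sup>2"
    using EB unfolding E_def power_mult_distrib[of \<delta>] by (smt (verit) zero_le_power2 mult_nonneg_nonneg)+
  then have c: "\<delta> * norm (w1 x) \<le> ?B" "norm (w2 x) \<le> ?B" "norm (w3 x) \<le> ?B"
    using B0 by (auto intro: power2_le_imp_le)
  have "norm (w1 x) = 32 * (L + 1) * (\<delta> * norm (w1 x))" using L0 by (simp add: \<delta>_def)
  also have "\<dots> \<le> 32 * (L + 1) * ?B" using c L0 by (intro mult_left_mono) auto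
  finally have "norm (W x) \<le> 32 * (L + 1) * ?B + ?B + ?B"
    using norm_vec3_le[of "W x"] c by (simp add: w1_def w2_def w3_def)
  then show ?thesis by (simp add: growth_const_def algebra_simps)
qed

definition fast_const :: "real \<Rightarrow> real \<Rightarrow> real \<Rightarrow> real" where
  "fast_const L R X = 64 * (L * growth_const L R)\<^sup>2 + R\<^sup>2 * exp (X / 4)"

text \<open>
  The square of \<open>w3\<close> is compared with the explicit supersolution
  \<open>K (vi\<^sup>2 exp (x / 16) + exp (- x / 4))\<close>. The first term reflects that \<open>w3\<close> follows \<open>v (w1 + w2)\<close>, which
  does not decay when the end value \<open>vi\<close> is positive.
\<close>

lemma fast_component_decay:
  fixes W :: "real \<Rightarrow> complex^3"
  assumes lam: "norm lam \<le> L" "0 \<le> Re lam" and X: "0 \<le> X" and vi: "0 \<le> vi"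
    and v: "\<And>x. X \<le> x \<Longrightarrow> 0 \<le> v x" "\<And>x. X \<le> x \<Longrightarrow> v x \<le> 1 / (131072 * (L + 1)\<^sup>2)"
      "\<And>x. X \<le> x \<Longrightarrow> v x \<le> vi + exp (- x / 2)"
    and f: "\<And>x. X \<le> x \<Longrightarrow> f x \<le> - 1 / 2"
    and W: "solves_linear_ode (\<lambda>x. coeff_matrix (v x) (f x) lam) W"
    and R: "norm (W X) \<le> R" and x: "X \<le> x"
  shows "norm (W x $ 3) \<le> sqrt (fast_const L R X) * (vi * exp (x / 32) + exp (- x / 8))"
proof -
  have L0: "0 \<le> L" using lam(1) norm_ge_zero order_trans by blast
  have R0: "0 \<le> R" using R norm_ge_zero order_trans by blast
  have f0: "f x \<le> 0" if "X \<le> x" for x using f[OF that] by simp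
  define G where "G = growth_const L R"
  have G: "norm (W x) \<le> G * exp (x / 32)" if "X \<le> x" for x
    unfolding G_def by (rule forward_growth[OF lam X v(1,2) f0 W R that])
  define K where "K = fast_const L R X"
  have K0: "0 \<le> K" by (simp add: K_def fast_const_def)
  define \<psi> where "\<psi> x = K * (vi\<^sup>2 * exp (x / 16) + exp (- x / 4))" for x
  define h where "h x = lam * of_real (v x) * (W x $ 1 + W x $ 2)" for x
  define p where "p x = (norm (W x $ 3))\<^sup>2 - \<psi> x" for x
  define p' where "p' x = 2 * inner (W x $ 3) (h x + (of_real (f x) - lam) * W x $ 3)
     - K * (vi\<^sup>2 * (exp (x / 16) * (1 / 16)) + exp (- x / 4) * (- 1 / 4))" for x
  have "p x \<le> p X * exp (- (1 / 2) * (x - X))"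
  proof (rule exp_growth_bound[OF x])
    fix t assume t: "X \<le> t" "t \<le> x"
    have "((\<lambda>x. W x $ 3) has_vector_derivative h t + (of_real (f t) - lam) * W t $ 3) (at t)"
      using solves_componentD[OF W, of 3 t] by (simp add: coeff_matrix_mult h_def)
    moreover have "(\<psi> has_real_derivative K * (vi\<^sup>2 * (exp (t / 16) * (1 / 16)) + exp (- t / 4) * (- 1 / 4))) (at t)"
      unfolding \<psi>_def[abs_def] by (auto intro!: derivative_eq_intros)
    ultimately show "(p has_real_derivative p' t) (at t)"
      unfolding p_def[abs_def] p'_def by (intro DERIV_diff norm_square_derivative)
    let ?w = "norm (W t $ 3)"
    have nh: "norm (h t) \<le> 2 * (L * G) * ((vi + exp (- t / 2)) * exp (t / 32))"
    proof -
      have "norm (W t $ 1 + W t $ 2) \<le> G * exp (t / 32) + G * exp (t / 32)"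
        using G[OF t(1)] Finite_Cartesian_Product.norm_nth_le[of "W t"]
        by (intro order_trans[OF norm_triangle_ineq] add_mono) (blast intro: order_trans)+
      then have "norm (h t) \<le> L * (vi + exp (- t / 2)) * (G * exp (t / 32) + G * exp (t / 32))"
        unfolding h_def norm_mult norm_of_real using lam v(1,3)[OF t(1)] L0 by (intro mult_mono) auto
      then show ?thesis by (simp add: algebra_simps)
    qed
    have "(norm (h t))\<^sup>2 \<le> (2 * (L * G) * ((vi + exp (- t / 2)) * exp (t / 32)))\<^sup>2"
      using nh by (rule power_mono) simp
    also have "\<dots> = 4 * (L * G)\<^sup>2 * ((vi + exp (- t / 2))\<^sup>2 * exp (t / 16))"
      by (simp add: power_mult_distrib flip: exp_double)
    also have "\<dots> \<le> 4 * (L * G)\<^sup>2 * (2 * (vi\<^sup>2 * exp (t / 16) + exp (- t / 4)))"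
    proof (rule mult_left_mono)
      have "(vi + exp (- t / 2))\<^sup>2 \<le> 2 * (vi\<^sup>2 + (exp (- t / 2))\<^sup>2)"
        using sum_squares_bound[of vi "exp (- t / 2)"] by (simp add: power2_sum)
      then have "(vi + exp (- t / 2))\<^sup>2 * exp (t / 16) \<le> 2 * (vi\<^sup>2 + (exp (- t / 2))\<^sup>2) * exp (t / 16)"
        by (rule mult_right_mono) simp
      also have "\<dots> = 2 * (vi\<^sup>2 * exp (t / 16) + exp (- t) * exp (t / 16))"
        by (simp add: algebra_simps flip: exp_double)
      also have "exp (- t) * exp (t / 16) \<le> exp (- t / 4)"
        using t X by (simp flip: exp_add)
      finally show "(vi + exp (- t / 2))\<^sup>2 * exp (t / 16) \<le> 2 * (vi\<^sup>2 * exp (t / 16) + exp (- t / 4))" by simp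
    qed simp
    finally have h2: "2 * (norm (h t))\<^sup>2 \<le> 16 * (L * G)\<^sup>2 * (vi\<^sup>2 * exp (t / 16) + exp (- t / 4))" by (simp add: algebra_simps)
    also have "\<dots> \<le> K / 4 * (vi\<^sup>2 * exp (t / 16) + exp (- t / 4))"
      by (intro mult_right_mono) (auto simp: K_def fast_const_def G_def)
    finally have h3: "2 * (norm (h t))\<^sup>2 \<le> K / 4 * (vi\<^sup>2 * exp (t / 16) + exp (- t / 4))" .
    have "inner (W t $ 3) ((of_real (f t) - lam) * W t $ 3) = (f t - Re lam) * ?w\<^sup>2"
      by (simp add: inner_mult_self)
    also have "\<dots> \<le> - 1 / 2 * ?w\<^sup>2" using f[OF t(1)] lam by (intro mult_right_mono) auto
    finally have i1: "inner (W t $ 3) ((of_real (f t) - lam) * W t $ 3) \<le> - 1 / 2 * ?w\<^sup>2" .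
    have i2: "2 * inner (W t $ 3) (h t) \<le> 1 / 2 * ?w\<^sup>2 + 2 * (norm (h t))\<^sup>2"
    proof -
      have "inner (W t $ 3) (h t) \<le> ?w * norm (h t)" by (rule norm_cauchy_schwarz)
      moreover have "4 * (?w * norm (h t)) \<le> ?w\<^sup>2 + 4 * (norm (h t))\<^sup>2"
        using sum_squares_bound[of ?w "2 * norm (h t)"] by (simp add: power_mult_distrib)
      ultimately show ?thesis by simp
    qed
    have "p' t \<le> - 1 / 2 * ?w\<^sup>2 + K / 4 * (vi\<^sup>2 * exp (t / 16) + exp (- t / 4))
        - K * (vi\<^sup>2 * (exp (t / 16) * (1 / 16)) + exp (- t / 4) * (- 1 / 4))"
      unfolding p'_def inner_add_right using i1 i2 h3 by simp
    also have "\<dots> \<le> - (1 / 2) * p t"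
    proof -
      have "0 \<le> K * (vi\<^sup>2 * exp (t / 16))" using K0 by simp
      then show ?thesis by (simp add: p_def \<psi>_def algebra_simps)
    qed
    finally show "p' t \<le> - (1 / 2) * p t" .
  qed
  also have "\<dots> \<le> 0"
  proof (rule mult_nonpos_nonneg)
    have "(norm (W X $ 3))\<^sup>2 \<le> R\<^sup>2"
      using R Finite_Cartesian_Product.norm_nth_le[of "W X" 3] by (intro power_mono) auto
    also have "R\<^sup>2 = R\<^sup>2 * exp (X / 4) * exp (- X / 4)" by (simp flip: exp_add mult.assoc)
    also have "\<dots> \<le> K * exp (- X / 4)" by (intro mult_right_mono) (auto simp: K_def fast_const_def)
    also have "\<dots> \<le> \<psi> X" unfolding \<psi>_def using K0 by (intro mult_left_mono) auto
    finally show "p X \<le> 0" by (simp add: p_def)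
  qed simp
  finally have "(norm (W x $ 3))\<^sup>2 \<le> K * (vi\<^sup>2 * exp (x / 16) + exp (- x / 4))" by (simp add: p_def \<psi>_def)
  also have "\<dots> \<le> K * (vi * exp (x / 32) + exp (- x / 8))\<^sup>2"
  proof (rule mult_left_mono[OF _ K0])
    have "(vi * exp (x / 32) + exp (- x / 8))\<^sup>2 = vi\<^sup>2 * exp (x / 16) + exp (- x / 4) + 2 * (vi * exp (x / 32) * exp (- x / 8))"
      by (simp add: power2_sum power_mult_distrib flip: exp_double)
    moreover have "0 \<le> vi * exp (x / 32) * exp (- x / 8)" using vi by simp
    ultimately show "vi\<^sup>2 * exp (x / 16) + exp (- x / 4) \<le> (vi * exp (x / 32) + exp (- x / 8))\<^sup>2" by linarith
  qed
  also have "\<dots> = (sqrt K * (vi * exp (x / 32) + exp (- x / 8)))\<^sup>2" using K0 by (simp add: power_mult_distrib)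
  finally show ?thesis unfolding K_def[symmetric] by (rule power2_le_imp_le) (use vi K0 in auto)
qed

section \<open>The Evans function as a limit at plus infinity\<close>

definition row_pair :: "complex^3 \<Rightarrow> complex^3 \<Rightarrow> complex" where
  "row_pair z w = (\<Sum>i\<in>UNIV. z $ i * w $ i)"

lemma evans_constant:
  assumes W: "solves_linear_ode A W" and Wt: "solves_linear_ode (\<lambda>x. - conj_transpose (A x)) Wt"
  shows "cdot (Wt x) (W x) = cdot (Wt 0) (W 0)"
proof -
  have "((\<lambda>x. cdot (Wt x) (W x)) has_vector_derivative 0) (at x)" for x
  proof -
    have "((\<lambda>x. cdot (Wt x) (W x)) has_vector_derivative
       (\<Sum>i\<in>UNIV. cnj (Wt x $ i) * (A x *v W x) $ i + cnj ((- conj_transpose (A x) *v Wt x) $ i) * W x $ i)) (at x)"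
      unfolding cdot_def
      by (intro has_vector_derivative_sum has_vector_derivative_mult solves_componentD[OF W]
          bounded_linear.has_vector_derivative[OF bounded_linear_cnj] solves_componentD[OF Wt])
    moreover have "(\<Sum>i\<in>UNIV. cnj (Wt x $ i) * (A x *v W x) $ i + cnj ((- conj_transpose (A x) *v Wt x) $ i) * W x $ i) = 0"
      by (simp add: matrix_vector_mult_def conj_transpose_def sum_3 algebra_simps)
    ultimately show ?thesis by simp
  qed
  then obtain c where "\<And>x. cdot (Wt x) (W x) = c"
    using has_vector_derivative_zero_constant[of UNIV "\<lambda>x. cdot (Wt x) (W x)"] by auto
  then show ?thesis by simp
qed

text \<open>
  Since \<open>\<eta>\<close> is a left eigenvector of the end matrix, the derivative of \<open>exp (- \<nu> x) (\<eta> \<bullet> W(x))\<close>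
  involves only the deviation of the coefficients from their end values. In the term \<open>(f - fi) w3\<close> the
  two parts of the bound for \<open>w3\<close> meet the two bounds for \<open>f - fi\<close>: the part of the order \<open>vi\<close> is
  absorbed by \<open>vi |f - fi| \<le> F exp (- x / 2)\<close>, the decaying part needs only \<open>|f - fi| \<le> F\<close>. The
  constant does not depend on \<open>vi\<close>; the unspecified constant in the last assumption on \<open>f\<close> enters
  only in identifying the limit with the Evans function.
\<close>

lemma evans_tail:
  fixes W Wt :: "real \<Rightarrow> complex^3"
  assumes lam: "norm lam \<le> L" "0 \<le> Re lam" and X: "0 \<le> X"
    and v: "\<And>x. 0 \<le> x \<Longrightarrow> vi \<le> v x" "\<And>x. X \<le> x \<Longrightarrow> v x \<le> 1 / (131072 * (L + 1)\<^sup>2)"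
      "\<And>x. 0 \<le> x \<Longrightarrow> v x - vi \<le> exp (- x / 2)"
    and f: "\<And>x. X \<le> x \<Longrightarrow> f x \<le> - 1 / 2" "fi < 0"
      "\<And>x. 0 \<le> x \<Longrightarrow> \<bar>f x - fi\<bar> \<le> F" "\<And>x. 0 \<le> x \<Longrightarrow> vi * \<bar>f x - fi\<bar> \<le> F * exp (- x / 2)"
      "\<exists>C. \<forall>x\<ge>0. \<bar>f x - fi\<bar> \<le> C * exp (- x / 2)"
    and W: "solves_linear_ode (\<lambda>x. coeff_matrix (v x) (f x) lam) W"
    and Wt: "solves_linear_ode (\<lambda>x. - conj_transpose (coeff_matrix (v x) (f x) lam)) Wt"
    and R: "norm (W X) \<le> R" and vi: "0 \<le> vi"
    and nu: "0 \<le> Re nu" "0 < vi \<and> lam \<noteq> 0 \<and> 0 < Re nu \<and>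
        nu ^ 3 + (lam - of_real fi) * nu\<^sup>2 - 2 * lam * of_real vi * nu - lam\<^sup>2 * of_real vi = 0
      \<or> nu = 0 \<and> (lam = 0 \<or> vi = 0)"
    and eig: "row_adjoint vi fi lam *v \<eta> = - nu *s \<eta>" and \<eta>: "norm (\<eta> $ 3) \<le> S"
    and lim: "((\<lambda>x. exp (nu * of_real x) *s cnj_vec (Wt x)) \<longlongrightarrow> \<eta>) at_top"
    and x: "X \<le> x"
  shows "norm (exp (- nu * of_real x) * row_pair \<eta> (W x) - cdot (Wt 0) (W 0))
    \<le> 8 * S * (2 * L * growth_const L R + 2 * F * sqrt (fast_const L R X)) * exp (- x / 8)"
proof -
  define G where "G = growth_const L R"
  define K where "K = sqrt (fast_const L R X)"
  have K0: "0 \<le> K" by (simp add: K_def fast_const_def)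
  have L0: "0 \<le> L" using lam(1) norm_ge_zero order_trans by blast
  have S0: "0 \<le> S" using \<eta> norm_ge_zero order_trans by blast
  have F0: "0 \<le> F" using f(3)[of 0] abs_ge_zero order_trans by force
  have v0: "0 \<le> v x" if "X \<le> x" for x using v(1)[of x] vi X that by linarith
  have f0: "f x \<le> 0" if "X \<le> x" for x using f(1)[OF that] by simp
  have vub: "v x \<le> vi + exp (- x / 2)" if "X \<le> x" for x using v(3)[of x] X that by linarith
  have Wg: "norm (W x) \<le> G * exp (x / 32)" if "X \<le> x" for x
    unfolding G_def by (rule forward_growth[OF lam X v0 v(2) f0 W R that])
  have W3: "norm (W x $ 3) \<le> K * (vi * exp (x / 32) + exp (- x / 8))" if "X \<le> x" for x
    unfolding K_def by (rule fast_component_decay[OF lam X vi v0 v(2) vub f(1) W R that])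
  obtain k2 k3 where V: "vieta vi fi lam nu k2 k3" "Re k2 \<le> Re nu" "Re k3 \<le> Re nu"
    using dominant_root[OF f(2) lam(2) nu(2)] by blast
  obtain C where C: "\<And>x. 0 \<le> x \<Longrightarrow> \<bar>f x - fi\<bar> \<le> C * exp (- x / 2)" using f(5) by blast
  have C': "\<bar>f x - fi\<bar> \<le> max 1 C * exp (- (1 / 2) * x)" "\<bar>v x - vi\<bar> \<le> max 1 C * exp (- (1 / 2) * x)" if "0 \<le> x" for x
  proof -
    have e: "exp (- x / 2) = exp (- (1 / 2) * x)" by simp
    have "C * exp (- x / 2) \<le> max 1 C * exp (- x / 2)" "1 * exp (- x / 2) \<le> max 1 C * exp (- x / 2)"
      by (intro mult_right_mono; simp)+
    moreover have "\<bar>v x - vi\<bar> = v x - vi" using v(1)[OF that] by simp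
    ultimately show "\<bar>f x - fi\<bar> \<le> max 1 C * exp (- (1 / 2) * x)" "\<bar>v x - vi\<bar> \<le> max 1 C * exp (- (1 / 2) * x)"
      using C[OF that] v(3)[OF that] unfolding e by linarith+
  qed
  define y where "y x = exp (nu * of_real x) *s cnj_vec (Wt x) - \<eta>" for x :: real
  have "exp_decaying (1 / 2) y" unfolding y_def
    by (rule adjoint_mode_decay[OF _ C'(2,1) Wt V eig lim]) auto
  then obtain D where D: "\<And>x. 0 \<le> x \<Longrightarrow> norm (y x) \<le> D * exp (- (1 / 2) * x)"
    unfolding exp_decaying_def by blast
  define g where "g x = exp (- nu * of_real x) * row_pair \<eta> (W x)" for x :: real
  define u where "u x = g x - cdot (Wt 0) (W 0)" for x
  have u_eq: "u x = - (exp (- nu * of_real x) * row_pair (y x) (W x))" for x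
  proof -
    have "cdot (Wt 0) (W 0) = cdot (Wt x) (W x)" by (rule evans_constant[OF W Wt, symmetric])
    also have "\<dots> = (exp (- nu * of_real x) * exp (nu * of_real x)) * row_pair (cnj_vec (Wt x)) (W x)"
      by (simp add: cdot_def row_pair_def cnj_vec_def flip: exp_add)
    also have "\<dots> = exp (- nu * of_real x) * row_pair (y x + \<eta>) (W x)"
      by (simp add: y_def row_pair_def sum_distrib_left mult.assoc)
    finally show ?thesis
      by (simp add: u_def g_def row_pair_def sum.distrib algebra_simps)
  qed
  have enu: "norm (exp (- nu * of_real x)) \<le> 1" if "0 \<le> x" for x :: real
    using nu that by simp
  have u_lim: "(u \<longlongrightarrow> 0) at_top"
  proof (rule Lim_null_comparison)
    show "eventually (\<lambda>x. norm (u x) \<le> 3 * D * G * exp (- (15 / 32) * x)) at_top"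
      using eventually_ge_at_top[of X]
    proof eventually_elim
      case (elim x)
      then have x0: "0 \<le> x" using X by simp
      have "norm (row_pair (y x) (W x)) \<le> (\<Sum>i\<in>(UNIV::3 set). norm (y x) * norm (W x))"
        unfolding row_pair_def
        by (rule sum_norm_le) (auto simp: norm_mult intro!: mult_mono Finite_Cartesian_Product.norm_nth_le)
      also have "\<dots> = 3 * (norm (y x) * norm (W x))" by simp
      also have "\<dots> \<le> 3 * ((D * exp (- (1 / 2) * x)) * (G * exp (x / 32)))"
        using D[OF x0] Wg[OF elim] by (intro mult_left_mono mult_mono) (auto intro: order_trans[OF norm_ge_zero])
      also have "\<dots> = 3 * D * G * exp (- (15 / 32) * x)"
        by (simp add: field_simps flip: exp_add)
      finally have "norm (row_pair (y x) (W x)) \<le> 3 * D * G * exp (- (15 / 32) * x)" .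
      moreover have "norm (u x) \<le> 1 * norm (row_pair (y x) (W x))"
        unfolding u_eq norm_minus_cancel norm_mult by (intro mult_right_mono enu x0) auto
      ultimately show ?case by simp
    qed
    show "((\<lambda>x. 3 * D * G * exp (- (15 / 32) * x)) \<longlongrightarrow> 0) at_top" by real_asymp
  qed
  define g' where "g' x = exp (- nu * of_real x) * (\<eta> $ 3 * (lam * of_real (v x - vi) * (W x $ 1 + W x $ 2) + of_real (f x - fi) * W x $ 3))" for x
  have u_der: "(u has_vector_derivative 0 * u x + g' x) (at x)" for x
  proof -
    have "((\<lambda>z. exp (- nu * z)) has_field_derivative (- nu * exp (- nu * of_real x))) (at (of_real x))"
      by (auto intro!: derivative_eq_intros)
    then have e: "((\<lambda>t. exp (- nu * of_real t)) has_vector_derivative (- nu * exp (- nu * of_real x))) (at x)"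
      by (rule has_vector_derivative_real_field)
    let ?A = "coeff_matrix (v x) (f x) lam"
    have r: "((\<lambda>x. row_pair \<eta> (W x)) has_vector_derivative row_pair \<eta> (?A *v W x)) (at x)"
      unfolding row_pair_def
      by (intro has_vector_derivative_sum has_vector_derivative_mult_right solves_componentD[OF W])
    have "(g has_vector_derivative exp (- nu * of_real x) * row_pair \<eta> (?A *v W x)
        + (- nu * exp (- nu * of_real x)) * row_pair \<eta> (W x)) (at x)"
      unfolding g_def[abs_def] by (rule has_vector_derivative_mult[OF e r])
    moreover have "exp (- nu * of_real x) * row_pair \<eta> (?A *v W x)
        + (- nu * exp (- nu * of_real x)) * row_pair \<eta> (W x) = g' x"
    proof -
      have "nu * \<eta> $ 1 = lam * of_real vi * \<eta> $ 3" "nu * \<eta> $ 2 = lam * \<eta> $ 1 + lam * of_real vi * \<eta> $ 3"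
        "nu * \<eta> $ 3 = \<eta> $ 1 + \<eta> $ 2 + (of_real fi - lam) * \<eta> $ 3"
        using eig by (simp_all add: vec_eq_iff forall_3 row_adjoint_mult algebra_simps add_eq_0_iff)
      then have "nu * row_pair \<eta> (W x) = (lam * of_real vi * \<eta> $ 3) * W x $ 1
          + (lam * \<eta> $ 1 + lam * of_real vi * \<eta> $ 3) * W x $ 2 + (\<eta> $ 1 + \<eta> $ 2 + (of_real fi - lam) * \<eta> $ 3) * W x $ 3"
        by (simp add: row_pair_def sum_3 distrib_left flip: mult.assoc)
      then have E: "row_pair \<eta> (?A *v W x) - nu * row_pair \<eta> (W x)
         = \<eta> $ 3 * (lam * of_real (v x - vi) * (W x $ 1 + W x $ 2) + of_real (f x - fi) * W x $ 3)"
        by (simp add: row_pair_def sum_3 coeff_matrix_mult algebra_simps)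
      show ?thesis unfolding g'_def E[symmetric] by (simp add: algebra_simps)
    qed
    ultimately show ?thesis unfolding u_def[abs_def]
      by (auto intro!: derivative_eq_intros)
  qed
  have "norm (u x) \<le> (S * (2 * L * G + 2 * F * K)) / (Re 0 + 1 / 8) * exp (- (1 / 8) * x)"
  proof (rule variation_of_constants_bound[OF u_der _ _ _ x])
    fix t assume t: "X \<le> t"
    then have t0: "0 \<le> t" using X by simp
    have e1: "exp (- t / 2) * exp (t / 32) \<le> exp (- (1 / 8) * t)" using t0 by (simp flip: exp_add)
    have "norm (W t $ 1 + W t $ 2) \<le> G * exp (t / 32) + G * exp (t / 32)"
      using Wg[OF t] Finite_Cartesian_Product.norm_nth_le[of "W t"]
      by (intro order_trans[OF norm_triangle_ineq] add_mono) (blast intro: order_trans)+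
    then have "norm (lam * of_real (v t - vi) * (W t $ 1 + W t $ 2)) \<le> L * exp (- t / 2) * (G * exp (t / 32) + G * exp (t / 32))"
      unfolding norm_mult norm_of_real using lam v(1,3)[OF t0] L0 by (intro mult_mono) auto
    also have "\<dots> = 2 * L * G * (exp (- t / 2) * exp (t / 32))" by simp
    also have "\<dots> \<le> 2 * L * G * exp (- (1 / 8) * t)"
      using e1 L0 order_trans[OF norm_ge_zero Wg[OF t]] by (intro mult_left_mono) (auto simp: zero_le_mult_iff)
    finally have a1: "norm (lam * of_real (v t - vi) * (W t $ 1 + W t $ 2)) \<le> 2 * L * G * exp (- (1 / 8) * t)" .
    have "norm (of_real (f t - fi) * W t $ 3) \<le> \<bar>f t - fi\<bar> * (K * (vi * exp (t / 32) + exp (- t / 8)))"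
      unfolding norm_mult norm_of_real by (intro mult_left_mono W3 t) auto
    also have "\<dots> = K * ((vi * \<bar>f t - fi\<bar>) * exp (t / 32) + \<bar>f t - fi\<bar> * exp (- t / 8))" by (simp add: algebra_simps)
    also have "\<dots> \<le> K * (F * exp (- t / 2) * exp (t / 32) + F * exp (- t / 8))"
      by (intro mult_left_mono add_mono mult_right_mono f(3,4) t0 K0) auto
    also have "\<dots> \<le> K * (F * exp (- (1 / 8) * t) + F * exp (- (1 / 8) * t))"
      using e1 F0 K0 by (intro mult_left_mono add_mono) (auto simp: mult.assoc intro!: mult_left_mono)
    finally have a2: "norm (of_real (f t - fi) * W t $ 3) \<le> 2 * F * K * exp (- (1 / 8) * t)" by (simp add: algebra_simps)
    have "norm (g' t) \<le> 1 * (S * ((2 * L * G + 2 * F * K) * exp (- (1 / 8) * t)))"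
      unfolding g'_def norm_mult[of "exp _"] norm_mult[of "\<eta> $ 3"] using a1 a2 S0
      by (intro mult_mono enu t0 \<eta> order_trans[OF norm_triangle_ineq]) (auto simp: distrib_right)
    then show "norm (g' t) \<le> (S * (2 * L * G + 2 * F * K)) * exp (- (1 / 8) * t)" by (simp add: mult.assoc)
  next
    show "((\<lambda>x. exp (- 0 * of_real x) * u x) \<longlongrightarrow> 0) at_top" using u_lim by simp
  qed auto
  then show ?thesis by (simp add: u_def g_def G_def K_def mult_ac)
qed

section \<open>Convergence along sequences\<close>

lemma mu0_minus_properties:
  assumes "0 \<le> Re lam"
  shows "(mu0_minus lam)\<^sup>2 = mu0_minus lam + lam" "1 \<le> Re (mu0_minus lam)"
    "1 \<le> Re (lam / mu0_minus lam + mu0_minus lam)"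
proof -
  define s where "s = csqrt (1 + 4 * lam)"
  have s2: "s\<^sup>2 = 1 + 4 * lam" by (simp add: s_def)
  have m: "mu0_minus lam = (1 + s) / 2" by (simp add: mu0_minus_def s_def)
  have "(Re s)\<^sup>2 - (Im s)\<^sup>2 = 1 + 4 * Re lam" using arg_cong[OF s2, of Re] by (simp add: Re_power2)
  then have "1\<^sup>2 \<le> (Re s)\<^sup>2" using assms zero_le_power2[of "Im s"] unfolding one_power2 by linarith
  then have s1: "1 \<le> Re s" using csqrt_principal[of "1 + 4 * lam"] by (intro power2_le_imp_le[of 1]) (auto simp: s_def)
  have "(mu0_minus lam)\<^sup>2 = (1 + 2 * s + s\<^sup>2) / 4" by (simp add: m power2_eq_square algebra_simps)
  also have "\<dots> = mu0_minus lam + lam" unfolding s2 m by (simp add: field_simps)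
  finally show e: "(mu0_minus lam)\<^sup>2 = mu0_minus lam + lam" .
  show "1 \<le> Re (mu0_minus lam)" using s1 by (simp add: m)
  then have nz: "mu0_minus lam \<noteq> 0" by auto
  have "lam = mu0_minus lam * (mu0_minus lam - 1)" using e by (simp add: power2_eq_square algebra_simps)
  then have "lam / mu0_minus lam = mu0_minus lam - 1" using nz by (metis nonzero_mult_div_cancel_left)
  then have "lam / mu0_minus lam + mu0_minus lam = s" by (simp add: m)
  then show "1 \<le> Re (lam / mu0_minus lam + mu0_minus lam)" using s1 by simp
qed

lemma adjoint_eigenvalue_cubic:
  assumes "\<eta> \<noteq> 0" "row_adjoint v f lam *v \<eta> = - nu *s \<eta>" "nu \<noteq> 0"
  shows "nu ^ 3 + (lam - of_real f) * nu\<^sup>2 - 2 * lam * of_real v * nu - lam\<^sup>2 * of_real v = 0"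
proof -
  have e: "nu * \<eta> $ 1 = lam * of_real v * \<eta> $ 3" "nu * \<eta> $ 2 = lam * \<eta> $ 1 + lam * of_real v * \<eta> $ 3"
    "nu * \<eta> $ 3 = \<eta> $ 1 + \<eta> $ 2 + (of_real f - lam) * \<eta> $ 3"
    using assms(2) by (simp_all add: vec_eq_iff forall_3 row_adjoint_mult algebra_simps add_eq_0_iff)
  have "\<eta> $ 3 \<noteq> 0"
  proof
    assume "\<eta> $ 3 = 0"
    with e assms(3) have "\<eta> $ 1 = 0" "\<eta> $ 2 = 0" by auto
    with \<open>\<eta> $ 3 = 0\<close> have "\<eta> = 0" by (simp add: vec_eq_iff forall_3)
    with assms(1) show False by simp
  qed
  moreover have "(nu ^ 3 + (lam - of_real f) * nu\<^sup>2 - 2 * lam * of_real v * nu - lam\<^sup>2 * of_real v) * \<eta> $ 3 = 0"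
  proof -
    have a: "nu\<^sup>2 * \<eta> $ 1 = lam * of_real v * nu * \<eta> $ 3" using e(1) by (simp add: power2_eq_square)
    have "nu\<^sup>2 * \<eta> $ 2 = nu * (nu * \<eta> $ 2)" by (simp add: power2_eq_square)
    also have "\<dots> = lam * (nu * \<eta> $ 1) + lam * of_real v * nu * \<eta> $ 3"
      unfolding e(2) by (simp add: algebra_simps)
    finally have b: "nu\<^sup>2 * \<eta> $ 2 = lam * (lam * of_real v * \<eta> $ 3) + lam * of_real v * nu * \<eta> $ 3"
      unfolding e(1) .
    have "nu ^ 3 * \<eta> $ 3 = nu\<^sup>2 * (nu * \<eta> $ 3)" by (simp add: power2_eq_square power3_eq_cube)
    also have "\<dots> = nu\<^sup>2 * \<eta> $ 1 + nu\<^sup>2 * \<eta> $ 2 + (of_real f - lam) * nu\<^sup>2 * \<eta> $ 3"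
      unfolding e(3) by (simp add: algebra_simps)
    finally have c: "nu ^ 3 * \<eta> $ 3 = nu\<^sup>2 * \<eta> $ 1 + nu\<^sup>2 * \<eta> $ 2 + (of_real f - lam) * nu\<^sup>2 * \<eta> $ 3" .
    have "(nu ^ 3 + (lam - of_real f) * nu\<^sup>2 - 2 * lam * of_real v * nu - lam\<^sup>2 * of_real v) * \<eta> $ 3
      = nu ^ 3 * \<eta> $ 3 + (lam - of_real f) * nu\<^sup>2 * \<eta> $ 3 - 2 * lam * of_real v * nu * \<eta> $ 3 - lam\<^sup>2 * of_real v * \<eta> $ 3"
      by (simp add: algebra_simps)
    also have "\<dots> = 0" unfolding c a b by (simp add: power2_eq_square algebra_simps)
    finally show ?thesis .
  qed
  ultimately show ?thesis by simp
qed

lemma coeff_matrix_tendsto: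
  assumes "v \<longlonglongrightarrow> v0" "f \<longlonglongrightarrow> f0" "lam \<longlonglongrightarrow> lam0" "w \<longlonglongrightarrow> w0"
  shows "(\<lambda>n. coeff_matrix (v n) (f n) (lam n) *v w n) \<longlonglongrightarrow> coeff_matrix v0 f0 lam0 *v w0"
proof (rule vec_tendstoI)
  fix i :: 3
  have "\<forall>i. (\<lambda>n. (coeff_matrix (v n) (f n) (lam n) *v w n) $ i) \<longlonglongrightarrow> (coeff_matrix v0 f0 lam0 *v w0) $ i"
    unfolding forall_3 coeff_matrix_mult by (intro conjI tendsto_intros assms)
  then show "(\<lambda>n. (coeff_matrix (v n) (f n) (lam n) *v w n) $ i) \<longlonglongrightarrow> (coeff_matrix v0 f0 lam0 *v w0) $ i" ..
qed

lemma eigenvalue_tendsto: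
  fixes V :: "nat \<Rightarrow> complex^3"
  assumes "V \<longlonglongrightarrow> V0" "(\<lambda>n. mu n *s V n) \<longlonglongrightarrow> mu0 *s V0" "V0 \<noteq> 0"
  shows "mu \<longlonglongrightarrow> mu0"
proof -
  obtain i where i: "V0 $ i \<noteq> 0" using assms(3) by (auto simp: vec_eq_iff)
  have Vi: "(\<lambda>n. V n $ i) \<longlonglongrightarrow> V0 $ i" by (intro tendsto_intros assms)
  have "(\<lambda>n. (mu n *s V n) $ i / V n $ i) \<longlonglongrightarrow> (mu0 *s V0) $ i / V0 $ i"
    by (intro tendsto_intros assms i)
  moreover have "eventually (\<lambda>n. (mu n *s V n) $ i / V n $ i = mu n) sequentially"
    using tendsto_imp_eventually_ne[OF Vi i] by eventually_elim simp
  ultimately show ?thesis using i by (simp add: tendsto_cong)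
qed

text \<open>
  The bound of \<open>evans_tail\<close> holds with one constant \<open>B\<close> for almost all members of the sequence and for
  the limiting problem (\<open>vi = 0\<close>, \<open>fi = -1\<close>, \<open>\<nu> = 0\<close>), from a common point \<open>X\<close> on. At a fixed \<open>x \<ge> X\<close> the
  approximate values converge to \<open>zg \<bullet> W0(x)\<close>, where \<open>zg = (0, 1, 1 / (\<gamma> + lam0))\<close>; replacing \<open>zg\<close> by
  \<open>z1 = (0, 1, 1 / (1 + lam0))\<close> costs a multiple of the third component of \<open>W0(x)\<close>.
\<close>

lemma evans_sequence_convergence:
  fixes vp :: "nat \<Rightarrow> real" and lam mu mt :: "nat \<Rightarrow> complex" and v :: "nat \<Rightarrow> real \<Rightarrow> real"
    and V Vt :: "nat \<Rightarrow> complex^3" and W Wt :: "nat \<Rightarrow> real \<Rightarrow> complex^3"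
  assumes g: "1 \<le> \<gamma>" and vp: "\<And>n. 0 < vp n" "\<And>n. vp n \<le> 1 / 4" "vp \<longlonglongrightarrow> 0"
    and lam: "\<And>n. 0 \<le> Re (lam n)" "lam \<longlonglongrightarrow> lam0"
    and prof: "\<And>n. is_profile \<gamma> (vp n) (v n)"
    and minus: "\<And>n. 0 < Re (mu n)" "\<And>n. eigenpair (A_minus \<gamma> (vp n) (lam n)) (mu n) (V n)"
    and V: "V \<longlonglongrightarrow> V0" and V0: "eigenpair (A0_minus lam0) (mu0_minus lam0) V0"
    and W: "\<And>n. solves_linear_ode (\<lambda>x. A_mat \<gamma> (vp n) (v n x) (lam n)) (W n)"
      "\<And>n. has_exp_asymptotics at_bot (mu n) (V n) (W n)"
    and W0: "solves_linear_ode (\<lambda>x. A0_mat (limit_profile x) lam0) W0"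
      "has_exp_asymptotics at_bot (mu0_minus lam0) V0 W0"
    and plus: "\<And>n. lam n \<noteq> 0 \<Longrightarrow> Re (mt n) < 0" "\<And>n. lam n = 0 \<Longrightarrow> mt n = 0"
      "\<And>n. eigenpair (- conj_transpose (A_plus \<gamma> (vp n) (lam n))) (mt n) (Vt n)"
    and Vt: "Vt \<longlonglongrightarrow> adjoint_plus_limit \<gamma> lam0"
    and Wt: "\<And>n. solves_linear_ode (\<lambda>x. - conj_transpose (A_mat \<gamma> (vp n) (v n x) (lam n))) (Wt n)"
      "\<And>n. has_exp_asymptotics at_top (mt n) (Vt n) (Wt n)"
    and Wt0: "solves_linear_ode (\<lambda>x. - conj_transpose (A0_mat (limit_profile x) lam0)) Wt0"
      "(Wt0 \<longlongrightarrow> adjoint_plus_limit 1 lam0) at_top"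
  shows "(\<lambda>n. cdot (Wt n 0) (W n 0)) \<longlonglongrightarrow> cdot (Wt0 0) (W0 0)"
proof -
  have vp1: "vp n < 1" for n using vp(2)[of n] by simp
  have lam0: "0 \<le> Re lam0"
    by (rule tendsto_lowerbound[OF tendsto_Re[OF lam(2)]]) (use lam(1) in auto)
  define f where "f n x = coeff_f \<gamma> (vp n) (v n x)" for n x
  define phi where "phi n = coeff_f \<gamma> (vp n) 1" for n
  define v0 where "v0 = limit_profile"
  define f0 where "f0 x = coeff_f0 (v0 x)" for x
  have A: "A_mat \<gamma> (vp n) (v n x) (lam n) = coeff_matrix (v n x) (f n x) (lam n)" for n x
    by (simp add: A_mat_def f_def)
  have A0: "A0_mat (limit_profile x) lam0 = coeff_matrix (v0 x) (f0 x) lam0" for x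
    by (simp add: A0_mat_def f0_def v0_def)
  note W = W[unfolded A] and W0 = W0[unfolded A0] and Wt = Wt[unfolded A] and Wt0 = Wt0[unfolded A0]
  have SL: "shock_layer (vp n) (v n)" for n
    by (rule profile_is_shock_layer[OF g vp(1) vp1 prof])
  have SL0: "shock_layer 0 v0" unfolding v0_def by (rule limit_profile_is_shock_layer)
  have vb: "vp n \<le> v n x" "v n x \<le> 1" for n x using SL[of n] by (elim shock_layerE; blast)+
  have v0b: "0 < v0 x" "v0 x \<le> 1" for x unfolding v0_def by (rule limit_profile_pos limit_profile_le_1)+
  note left = shock_layer_decay_left[OF SL vp(2)]
  note left0 = shock_layer_decay_left[OF SL0, simplified]
  note right = shock_layer_decay_right[OF SL]
  note right0 = shock_layer_decay_right[OF SL0]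
  have e48: "exp (x / 4) \<le> exp (x / 8)" if "x \<le> 0" for x :: real using that by simp
  have phi: "\<bar>phi n - 1\<bar> \<le> \<gamma> * vp n" for n
  proof -
    have "phi n - 1 = - (\<gamma> * shock_const \<gamma> (vp n))"
      by (simp add: phi_def coeff_f_eq pressure_term_def)
    then show ?thesis using shock_const_bounds[OF g vp(1) vp1, of n] g by simp
  qed
  have philim: "phi \<longlonglongrightarrow> 1"
  proof -
    have "(\<lambda>n. \<gamma> * vp n) \<longlonglongrightarrow> 0" using tendsto_mult_right_zero[OF vp(3)] .
    then have "(\<lambda>n. phi n - 1) \<longlonglongrightarrow> 0"
      by (rule Lim_null_comparison[rotated]) (use phi in auto)
    then show ?thesis by (rule LIM_zero_cancel)
  qed
  let ?m = "mu0_minus lam0"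
  have eig: "V n \<noteq> 0" "coeff_matrix 1 (phi n) (lam n) *v V n = mu n *s V n" for n
    using minus(2)[of n] by (auto simp: eigenpair_def A_minus_def A_mat_def phi_def)
  have eig0: "V0 \<noteq> 0" "coeff_matrix 1 1 lam0 *v V0 = ?m *s V0"
    using V0 by (auto simp: eigenpair_def A0_minus_def A0_mat_def coeff_f0_def)
  have mulim: "mu \<longlonglongrightarrow> ?m"
  proof (rule eigenvalue_tendsto[OF V _ eig0(1)])
    show "(\<lambda>n. mu n *s V n) \<longlonglongrightarrow> ?m *s V0"
      unfolding eig(2)[symmetric] eig0(2)[symmetric]
      by (rule coeff_matrix_tendsto[OF tendsto_const philim lam(2) V])
  qed
  note m = mu0_minus_properties[OF lam0]
  define e where "e n = 2 * vp n powr (1 / 14) + \<gamma> * vp n" for n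
  have elim: "e \<longlonglongrightarrow> 0"
  proof -
    have "e \<longlonglongrightarrow> 2 * 0 powr (1 / 14) + \<gamma> * 0"
      unfolding e_def[abs_def] using vp by (intro tendsto_intros tendsto_powr') (auto simp: less_imp_le)
    then show ?thesis by simp
  qed
  have fphi: "\<bar>f n x - phi n - 2 * (v n x - 1)\<bar> \<le> \<gamma> * vp n * exp (x / 8)" if x: "x \<le> 0" for n x
  proof -
    have "\<bar>f n x - phi n - 2 * (v n x - 1)\<bar> \<le> 2 * (\<gamma> - 1) * vp n * (1 - v n x)"
      unfolding f_def phi_def using coeff_f_dist_minus[OF g vp(1) vp1 vb(1) left(1)[OF x] vb(2)] by simp
    also have "\<dots> \<le> 2 * (\<gamma> - 1) * vp n * (exp (x / 4) / 2)"
      using left(2)[OF x] g vp(1)[of n] by (intro mult_left_mono) auto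
    also have "\<dots> = (\<gamma> - 1) * vp n * exp (x / 4)" by simp
    also have "\<dots> \<le> \<gamma> * vp n * exp (x / 8)"
      using g vp(1)[of n] e48[OF x] by (intro mult_mono) auto
    finally show ?thesis .
  qed
  have "\<exists>X\<le>0. (\<lambda>n. W n X) \<longlonglongrightarrow> W0 X"
  proof (rule unstable_mode_convergence[OF lam(2) mulim philim V elim eig(1) _ eig(2) m(1) m(3) _ _ eig0(2) _ _ _ _ _ _ _ W W0])
    show "mu n \<noteq> 0" for n using minus(1)[of n] by auto
    show "1 \<le> Re (lam0 + ?m)" using m(2) lam0 by simp
    show "?m \<noteq> 0" using m(2) by auto
    show "0 < (1 / 8 :: real)" by simp
    fix n and x :: real assume x: "x \<le> 0"
    have d: "\<bar>v n x - v0 x\<bar> \<le> vp n powr (1 / 14) * exp (x / 8)"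
      by (rule shock_layer_dist_left[OF SL vp(2) SL0 x])
    have ge: "exp (x / 4) / 2 \<le> exp (x / 8)" using e48[OF x] exp_gt_zero[of "x / 4"] by linarith
    have C1: "exp (x / 8) \<le> (\<gamma> + 1) * exp (1 / 8 * x)" using g by simp
    show "\<bar>v n x - 1\<bar> \<le> (\<gamma> + 1) * exp (1 / 8 * x)"
      using left(2)[OF x, of n] vb(2)[of n x] ge C1 by linarith
    show "\<bar>v0 x - 1\<bar> \<le> (\<gamma> + 1) * exp (1 / 8 * x)"
      using left0(2)[OF x] v0b(2)[of x] ge C1 by linarith
    show "\<bar>f0 x - 1\<bar> \<le> (\<gamma> + 1) * exp (1 / 8 * x)"
    proof -
      have f01: "\<bar>f0 x - 1\<bar> = 2 - v0 x * 2" using v0b(2)[of x] by (simp add: f0_def coeff_f0_def)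
      show ?thesis unfolding f01 using left0(2)[OF x] e48[OF x] C1 by linarith
    qed
    have "\<gamma> * vp n * exp (x / 8) \<le> \<gamma> * 1 * exp (x / 8)"
      using vp1[of n] g by (intro mult_right_mono mult_left_mono) auto
    moreover have "\<bar>f n x - phi n\<bar> \<le> \<bar>f n x - phi n - 2 * (v n x - 1)\<bar> + 2 * (1 - v n x)"
      using vb(2)[of n x] by (auto simp: abs_if)
    moreover have "2 * (1 - v n x) \<le> exp (x / 8)"
      using order_trans[OF _ e48[OF x], of "2 * (1 - v n x)"] left(2)[OF x, of n] by simp
    moreover have "(\<gamma> + 1) * exp (1 / 8 * x) = \<gamma> * 1 * exp (x / 8) + exp (x / 8)" by (simp add: distrib_right)
    ultimately show "\<bar>f n x - phi n\<bar> \<le> (\<gamma> + 1) * exp (1 / 8 * x)"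
      using fphi[OF x, of n] by linarith
    have en: "e n * exp (1 / 8 * x) = 2 * (vp n powr (1 / 14) * exp (x / 8)) + \<gamma> * vp n * exp (x / 8)"
      by (simp add: e_def algebra_simps)
    have nn: "0 \<le> \<gamma> * vp n * exp (x / 8)" using g vp(1)[of n] by simp
    show "\<bar>v n x - v0 x\<bar> \<le> e n * exp (1 / 8 * x)"
      unfolding en using d nn by linarith
    have "f n x - phi n - (f0 x - 1) = 2 * (v n x - v0 x) + (f n x - phi n - 2 * (v n x - 1))"
      by (simp add: f0_def coeff_f0_def)
    also have "\<bar>\<dots>\<bar> \<le> 2 * (vp n powr (1 / 14) * exp (x / 8)) + \<gamma> * vp n * exp (x / 8)"
      using d by (intro order_trans[OF abs_triangle_ineq] add_mono fphi x) (simp add: abs_mult)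
    finally show "\<bar>f n x - phi n - (f0 x - 1)\<bar> \<le> e n * exp (1 / 8 * x)" unfolding en .
  qed
  then obtain Y where Y: "Y \<le> 0" "(\<lambda>n. W n Y) \<longlonglongrightarrow> W0 Y" by blast
  have vlim: "(\<lambda>n. v n x) \<longlonglongrightarrow> v0 x" for x
  proof -
    have "(\<lambda>n. vp n * exp (3 / 2 * \<bar>x\<bar>)) \<longlonglongrightarrow> 0" using tendsto_mult_left_zero[OF vp(3)] .
    then have "(\<lambda>n. v n x - v0 x) \<longlonglongrightarrow> 0"
      by (rule Lim_null_comparison[rotated]) (use shock_layer_dist[OF SL SL0] in auto)
    then show ?thesis by (rule LIM_zero_cancel)
  qed
  have Wlim: "(\<lambda>n. W n x) \<longlonglongrightarrow> W0 x" if x: "0 \<le> x" for x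
  proof -
    define E where "E = exp (3 / 2 * (\<bar>Y\<bar> + x))"
    define d where "d n = 2 * (vp n * E) + \<gamma> * vp n / v n x + \<gamma> * vp n" for n
    have "d \<longlonglongrightarrow> 2 * (0 * E) + \<gamma> * 0 / v0 x + \<gamma> * 0"
      unfolding d_def[abs_def] using v0b(1)[of x] by (intro tendsto_intros vp vlim) auto
    then have dlim: "d \<longlonglongrightarrow> 0" by simp
    show ?thesis
    proof (rule solution_convergence_forward[OF _ lam(2) dlim _ _ _ _ W(1) W0(1) Y(2), of x 1])
      show "Y \<le> x" using x Y by simp
      fix n t assume t: "Y \<le> t" "t \<le> x"
      show "\<bar>v n t\<bar> \<le> 1" using vb[of n t] vp(1)[of n] by simp
      show "\<bar>f0 t\<bar> \<le> 1" using v0b[of t] by (simp add: f0_def coeff_f0_def abs_le_iff)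
      have "\<bar>v n t - v0 t\<bar> \<le> vp n * exp (3 / 2 * \<bar>t\<bar>)" by (rule shock_layer_dist[OF SL SL0])
      also have "\<dots> \<le> vp n * E" unfolding E_def using t Y x vp(1)[of n] by (intro mult_left_mono) auto
      finally have vd: "\<bar>v n t - v0 t\<bar> \<le> vp n * E" .
      have pos: "0 < v n x" using vb(1)[of n x] vp(1)[of n] by linarith
      have nn: "0 \<le> \<gamma> * vp n / v n x" "0 \<le> \<gamma> * vp n" "0 \<le> vp n * E"
        using g vp(1)[of n] pos by (auto simp: E_def)
      show "\<bar>v n t - v0 t\<bar> \<le> d n" using vd nn by (simp add: d_def)
      have "antimono (v n)" using SL[of n] by (elim shock_layerE) blast
      then have "v n x \<le> v n t" using t(2) by (rule antimonoD)
      then have "\<gamma> * vp n / v n t \<le> \<gamma> * vp n / v n x"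
        using pos nn by (intro divide_left_mono) auto
      then have "\<bar>f n t - coeff_f0 (v n t)\<bar> \<le> \<gamma> * vp n / v n x + \<gamma> * vp n"
        unfolding f_def using coeff_f_dist_limit[OF g vp(1) vp1 vb, of n t] by linarith
      moreover have "coeff_f0 (v n t) - f0 t = 2 * (v n t - v0 t)" by (simp add: f0_def coeff_f0_def)
      ultimately show "\<bar>f n t - f0 t\<bar> \<le> d n" using vd by (simp add: d_def)
    qed
  qed
  define L where "L = norm lam0 + 1"
  \<comment> \<open>The smallness of \<open>v\<close> under which \<open>forward_growth\<close> applies with the bound \<open>L\<close> for \<open>lam\<close>.\<close>
  define vs where "vs = 1 / (131072 * (L + 1)\<^sup>2)"
  have L1: "1 \<le> L" by (simp add: L_def)
  have vs: "0 < vs" "vs \<le> 1 / 4"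
  proof -
    have q: "1 * 1 \<le> (L + 1)\<^sup>2" unfolding power2_eq_square using L1 by (intro mult_mono) auto
    show "0 < vs" using L1 by (simp add: vs_def)
    show "vs \<le> 1 / 4" unfolding vs_def by (rule frac_le) (use q in auto)
  qed
  define X where "X = max 0 (- 2 * ln vs)"
  have X: "0 \<le> X" by (simp add: X_def)
  have expX: "exp (- x / 2) \<le> vs" if "X \<le> x" for x
  proof -
    have "- x / 2 \<le> ln vs" using that by (simp add: X_def)
    then have "exp (- x / 2) \<le> exp (ln vs)" by (simp only: exp_le_cancel_iff)
    then show ?thesis using vs by simp
  qed
  define R where "R = norm (W0 X) + 1"
  define S where "S = norm (inverse (of_real \<gamma> + lam0)) + norm (inverse (1 + lam0)) + 1"
  define F where "F = \<gamma>\<^sup>2 + \<gamma> + 1"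
  have F: "1 \<le> F" "\<gamma> + 1 \<le> F" "\<gamma>\<^sup>2 + 1 \<le> F" using g by (auto simp: F_def)
  define B where "B = 8 * S * (2 * L * growth_const L R + 2 * F * sqrt (fast_const L R X))"
  define \<eta> where "\<eta> n = cnj_vec (Vt n)" for n
  define zg where "zg = cnj_vec (adjoint_plus_limit \<gamma> lam0)"
  define z1 where "z1 = cnj_vec (adjoint_plus_limit 1 lam0)"
  have zg: "zg $ 1 = 0" "zg $ 2 = 1" "zg $ 3 = inverse (of_real \<gamma> + lam0)"
    and z1: "z1 $ 1 = 0" "z1 $ 2 = 1" "z1 $ 3 = inverse (1 + lam0)"
    by (simp_all add: zg_def z1_def cnj_vec_def adjoint_plus_limit_def)
  define nu where "nu n = - cnj (mt n)" for n
  have cnj_tendsto: "((\<lambda>n. cnj_vec (u n)) \<longlongrightarrow> cnj_vec l) G" if "(u \<longlongrightarrow> l) G" for u l and G :: "'z filter"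
    by (rule vec_tendstoI) (auto simp: cnj_vec_def intro!: tendsto_cnj tendsto_vec_nth that)
  have \<eta>lim: "\<eta> \<longlonglongrightarrow> zg" unfolding \<eta>_def[abs_def] zg_def by (rule cnj_tendsto[OF Vt])
  have \<eta>0: "\<eta> n \<noteq> 0" for n
    using plus(3)[of n] by (auto simp: \<eta>_def eigenpair_def cnj_vec_def vec_eq_iff)
  define fi where "fi n = coeff_f \<gamma> (vp n) (vp n)" for n
  have \<eta>eig: "row_adjoint (vp n) (fi n) (lam n) *v \<eta> n = - nu n *s \<eta> n" for n
  proof -
    have "- conj_transpose (coeff_matrix (vp n) (fi n) (lam n)) *v Vt n = mt n *s Vt n"
      using plus(3)[of n] by (simp add: eigenpair_def A_plus_def A_mat_def fi_def)
    then have "row_adjoint (vp n) (fi n) (lam n) *v \<eta> n = cnj_vec (mt n *s Vt n)"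
      by (simp add: \<eta>_def flip: cnj_vec_adjoint)
    also have "\<dots> = - nu n *s \<eta> n" by (simp add: cnj_vec_def \<eta>_def nu_def vec_eq_iff)
    finally show ?thesis .
  qed
  \<comment> \<open>Second component of the eigenvector equation, where \<open>\<eta>\<close> tends to \<open>(0, 1, _)\<close> and \<open>vp\<close> to \<open>0\<close>.\<close>
  have nulim: "nu \<longlonglongrightarrow> 0"
  proof -
    have "nu n * \<eta> n $ 2 = lam n * \<eta> n $ 1 + lam n * of_real (vp n) * \<eta> n $ 3" for n
      using \<eta>eig[of n] by (simp add: vec_eq_iff forall_3 row_adjoint_mult algebra_simps add_eq_0_iff)
    moreover have "(\<lambda>n. (lam n * \<eta> n $ 1 + lam n * of_real (vp n) * \<eta> n $ 3) / \<eta> n $ 2)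
        \<longlonglongrightarrow> (lam0 * zg $ 1 + lam0 * of_real 0 * zg $ 3) / zg $ 2"
      by (intro tendsto_intros lam \<eta>lim vp) (simp add: zg)
    ultimately have "(\<lambda>n. nu n * \<eta> n $ 2 / \<eta> n $ 2) \<longlonglongrightarrow> 0" by (simp add: zg)
    moreover have "eventually (\<lambda>n. nu n * \<eta> n $ 2 / \<eta> n $ 2 = nu n) sequentially"
    proof -
      have "eventually (\<lambda>n. \<eta> n $ 2 \<noteq> 0) sequentially"
        by (rule tendsto_imp_eventually_ne[OF tendsto_vec_nth[OF \<eta>lim]]) (simp add: zg)
      then show ?thesis by eventually_elim simp
    qed
    ultimately show ?thesis by (simp add: tendsto_cong)
  qed
  have nu0: "0 \<le> Re (nu n)" for n
    using plus(1,2)[of n] by (cases "lam n = 0") (auto simp: nu_def)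
  have tail: "eventually (\<lambda>n. \<forall>x\<ge>X. norm (exp (- nu n * of_real x) * row_pair (\<eta> n) (W n x) - cdot (Wt n 0) (W n 0))
     \<le> B * exp (- x / 8)) sequentially"
  proof -
    have "eventually (\<lambda>n. norm (lam n) < L) sequentially"
      by (rule order_tendstoD[OF tendsto_norm[OF lam(2)]]) (simp add: L_def)
    moreover have "eventually (\<lambda>n. vp n < vs / 2) sequentially"
      by (rule order_tendstoD[OF vp(3)]) (use vs in simp)
    moreover have "eventually (\<lambda>n. norm (W n X) < R) sequentially"
      by (rule order_tendstoD[OF tendsto_norm[OF Wlim[OF X]]]) (simp add: R_def)
    moreover have "eventually (\<lambda>n. norm (\<eta> n $ 3) < S) sequentially"
    proof (rule order_tendstoD[OF tendsto_norm[OF tendsto_vec_nth[OF \<eta>lim]]])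
      show "norm (zg $ 3) < S" unfolding zg S_def using norm_ge_zero[of "inverse (1 + lam0)"] by linarith
    qed
    ultimately show ?thesis
    proof eventually_elim
      case (elim n)
      have half: "v n x \<le> 1 / 2" if "0 \<le> x" for x using right(1)[OF that] .
      have dec: "v n x - vp n \<le> exp (- x / 2) / 2" if "0 \<le> x" for x using right(2)[OF that] .
      have dec1: "v n x - vp n \<le> exp (- x / 2)" if "0 \<le> x" for x
        using dec[OF that] exp_gt_zero[of "- x / 2"] by linarith
      have vX: "v n x \<le> vs" if "X \<le> x" for x
        using dec[of x] that X expX[OF that] elim by linarith
      show ?case unfolding B_def
      proof (intro allI impI)
        fix x assume x: "X \<le> x"
        show "norm (exp (- nu n * of_real x) * row_pair (\<eta> n) (W n x) - cdot (Wt n 0) (W n 0))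
          \<le> 8 * S * (2 * L * growth_const L R + 2 * F * sqrt (fast_const L R X)) * exp (- x / 8)"
        proof (rule evans_tail[OF _ lam(1) X vb(1) _ _ _ _ _ _ _ W(1) Wt(1) _ _ nu0 _ \<eta>eig _ _ x])
          show "norm (lam n) \<le> L" "norm (W n X) \<le> R" "norm (\<eta> n $ 3) \<le> S" "0 \<le> vp n"
            using elim vp(1)[of n] by auto
          show "fi n < 0" using coeff_f_le[of \<gamma> "vp n" "vp n"] g vp(1,2)[of n] by (simp add: fi_def)
          show "0 < vp n \<and> lam n \<noteq> 0 \<and> 0 < Re (nu n) \<and>
            nu n ^ 3 + (lam n - of_real (fi n)) * (nu n)\<^sup>2 - 2 * lam n * of_real (vp n) * nu n - (lam n)\<^sup>2 * of_real (vp n) = 0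
            \<or> nu n = 0 \<and> (lam n = 0 \<or> vp n = 0)"
          proof (cases "lam n = 0")
            case True then show ?thesis using plus(2) by (simp add: nu_def)
          next
            case False
            then have r: "0 < Re (nu n)" using plus(1) by (simp add: nu_def)
            then have "nu n \<noteq> 0" by auto
            then show ?thesis using adjoint_eigenvalue_cubic[OF \<eta>0 \<eta>eig] False r vp(1) by blast
          qed
          have "exp (nu n * of_real x) *s cnj_vec (Wt n x) = cnj_vec (exp (- mt n * of_real x) *s Wt n x)" for x
            by (simp add: cnj_vec_def vec_eq_iff nu_def exp_cnj)
          then show "((\<lambda>x. exp (nu n * of_real x) *s cnj_vec (Wt n x)) \<longlongrightarrow> \<eta> n) at_top"
            unfolding \<eta>_def using cnj_tendsto[OF Wt(2)[of n, unfolded has_exp_asymptotics_def]] by simp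
          have bnd: "\<bar>f n x - fi n\<bar> \<le> (\<gamma>\<^sup>2 + 1) / vp n * exp (- x / 2)" if "0 \<le> x" for x
          proof -
            have "vp n * \<bar>f n x - fi n\<bar> \<le> (\<gamma>\<^sup>2 + 1) * (v n x - vp n)"
              unfolding f_def fi_def by (rule coeff_f_dist_plus(2)[OF g vp(1) vp1 vb])
            also have "\<dots> \<le> (\<gamma>\<^sup>2 + 1) * exp (- x / 2)"
              using dec1[OF that] by (intro mult_left_mono) auto
            finally show ?thesis using vp(1)[of n] by (simp add: field_simps)
          qed
          then show "\<exists>C. \<forall>x\<ge>0. \<bar>f n x - fi n\<bar> \<le> C * exp (- x / 2)" by blast
          fix t
          show "v n t \<le> 1 / (131072 * (L + 1)\<^sup>2)" if "X \<le> t" using vX[OF that] by (simp add: vs_def)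
          show "v n t - vp n \<le> exp (- t / 2)" if "0 \<le> t" by (rule dec1[OF that])
          show "f n t \<le> - 1 / 2" if "X \<le> t"
            using coeff_f_le[OF g vp(1) vp1 vb, of n t] vX[OF that] vs unfolding f_def by linarith
          have "\<bar>f n t - fi n\<bar> \<le> \<gamma> + 1"
            unfolding f_def fi_def by (rule coeff_f_dist_plus(1)[OF g vp(1) vp1 vb])
          then show "\<bar>f n t - fi n\<bar> \<le> F" using F by simp
          show "vp n * \<bar>f n t - fi n\<bar> \<le> F * exp (- t / 2)" if "0 \<le> t"
          proof -
            have "vp n * \<bar>f n t - fi n\<bar> \<le> (\<gamma>\<^sup>2 + 1) * exp (- t / 2)"
              using bnd[OF that] vp(1)[of n] by (simp add: field_simps)
            also have "\<dots> \<le> F * exp (- t / 2)" using F by (intro mult_right_mono) auto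
            finally show ?thesis .
          qed
        qed
      qed
    qed
  qed
  have vX0: "v0 x \<le> vs" "f0 x \<le> - 1 / 2" if "X \<le> x" for x
  proof -
    show "v0 x \<le> vs" using right0(2)[of x] that X expX[OF that] exp_gt_zero[of "- x / 2"] by linarith
    then show "f0 x \<le> - 1 / 2" using vs by (simp add: f0_def coeff_f0_def)
  qed
  have r0: "v0 x \<le> exp (- x / 2) / 2" if "0 \<le> x" for x using right0(2)[OF that] by simp
  have nlam0: "norm lam0 \<le> L" "norm (W0 X) \<le> R" by (auto simp: L_def R_def)
  have tail0: "norm (row_pair z1 (W0 x) - cdot (Wt0 0) (W0 0)) \<le> B * exp (- x / 8)" if x: "X \<le> x" for x
  proof -
    have "norm (exp (- 0 * of_real x) * row_pair z1 (W0 x) - cdot (Wt0 0) (W0 0))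
          \<le> 8 * S * (2 * L * growth_const L R + 2 * F * sqrt (fast_const L R X)) * exp (- x / 8)"
    proof (rule evans_tail[OF nlam0(1) lam0 X _ _ _ _ _ _ _ _ W0(1) Wt0(1) nlam0(2) _ _ _ _ _ _ x, where vi = 0 and fi = "- 1"])
      show "0 \<le> v0 t" for t using v0b[of t] by simp
      show "v0 t \<le> 1 / (131072 * (L + 1)\<^sup>2)" "f0 t \<le> - 1 / 2" if "X \<le> t" for t
        using vX0[OF that] by (auto simp: vs_def)
      fix t :: real
      show "v0 t - 0 \<le> exp (- t / 2)" if "0 \<le> t" using r0[OF that] exp_gt_zero[of "- t / 2"] by linarith
      have ff: "\<bar>f0 t - - 1\<bar> = 2 * v0 t" using v0b(1)[of t] by (simp add: f0_def coeff_f0_def)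
      show "\<bar>f0 t - - 1\<bar> \<le> F" if "0 \<le> t" unfolding ff using right0(1)[OF that] F by simp
      show "0 * \<bar>f0 t - - 1\<bar> \<le> F * exp (- t / 2)" using F by simp
      show "\<exists>C. \<forall>x\<ge>0. \<bar>f0 x - - 1\<bar> \<le> C * exp (- x / 2)"
      proof (intro exI[of _ 1] allI impI)
        fix s :: real assume s: "0 \<le> s"
        show "\<bar>f0 s - - 1\<bar> \<le> 1 * exp (- s / 2)"
          using r0[OF s] v0b(1)[of s] by (simp add: f0_def coeff_f0_def)
      qed
      have nz: "1 + lam0 \<noteq> 0" using lam0 by (auto simp: complex_eq_iff)
      then have inv: "inverse (1 + lam0) + lam0 * inverse (1 + lam0) = 1"
        by (simp add: field_simps)
      show "row_adjoint 0 (- 1) lam0 *v z1 = - 0 *s z1"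
        using inv by (simp add: vec_eq_iff forall_3 row_adjoint_mult z1 algebra_simps)
      show "norm (z1 $ 3) \<le> S" unfolding z1 S_def using norm_ge_zero[of "inverse (of_real \<gamma> + lam0)"] by linarith
      show "((\<lambda>x. exp (0 * of_real x) *s cnj_vec (Wt0 x)) \<longlongrightarrow> z1) at_top"
        unfolding z1_def using cnj_tendsto[OF Wt0(2)] by simp
    qed auto
    then show ?thesis by (simp add: B_def)
  qed
  define K where "K = sqrt (fast_const L R X)"
  have w3: "norm (W0 x $ 3) \<le> K * exp (- x / 8)" if x: "X \<le> x" for x
  proof -
    have "norm (W0 x $ 3) \<le> K * (0 * exp (x / 32) + exp (- x / 8))"
      unfolding K_def
    proof (rule fast_component_decay[OF nlam0(1) lam0 X _ _ _ _ _ W0(1) nlam0(2) x])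
      fix t :: real assume t: "X \<le> t"
      show "0 \<le> v0 t" using v0b[of t] by simp
      show "v0 t \<le> 1 / (131072 * (L + 1)\<^sup>2)" "f0 t \<le> - 1 / 2" using vX0[OF t] by (auto simp: vs_def)
      show "v0 t \<le> 0 + exp (- t / 2)" using r0[of t] t X exp_gt_zero[of "- t / 2"] by linarith
    qed simp
    then show ?thesis by simp
  qed
  have diff: "norm (row_pair zg (W0 x) - row_pair z1 (W0 x)) \<le> S * K * exp (- x / 8)" if x: "X \<le> x" for x
  proof -
    have "row_pair zg (W0 x) - row_pair z1 (W0 x) = (inverse (of_real \<gamma> + lam0) - inverse (1 + lam0)) * W0 x $ 3"
      by (simp add: row_pair_def sum_3 zg z1 algebra_simps)
    also have "norm \<dots> \<le> S * (K * exp (- x / 8))"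
      unfolding norm_mult
      using norm_triangle_ineq4[of "inverse (of_real \<gamma> + lam0)" "inverse (1 + lam0)"] w3[OF x]
      by (intro mult_mono) (auto simp: S_def)
    finally show ?thesis by simp
  qed
  show ?thesis
  proof (rule tendstoI)
    fix \<epsilon> :: real assume \<epsilon>: "0 < \<epsilon>"
    have "((\<lambda>x::real. (2 * B + S * K) * exp (- x / 8)) \<longlongrightarrow> 0) at_top" by real_asymp
    then have "eventually (\<lambda>x. (2 * B + S * K) * exp (- x / 8) < \<epsilon> / 2) at_top"
      by (rule order_tendstoD) (use \<epsilon> in simp)
    then obtain x where x: "X \<le> x" "(2 * B + S * K) * exp (- x / 8) < \<epsilon> / 2"
      using eventually_happens[OF eventually_conj[OF eventually_ge_at_top[of X]]] by fastforce
    have rp: "(\<lambda>n. exp (- nu n * of_real x) * row_pair (\<eta> n) (W n x)) \<longlonglongrightarrow> exp (- 0 * of_real x) * row_pair zg (W0 x)"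
      unfolding row_pair_def using x X by (intro tendsto_intros nulim \<eta>lim Wlim) auto
    then have "eventually (\<lambda>n. dist (exp (- nu n * of_real x) * row_pair (\<eta> n) (W n x)) (row_pair zg (W0 x)) < \<epsilon> / 2) sequentially"
      using tendstoD[OF rp, of "\<epsilon> / 2"] \<epsilon> by simp
    with tail show "eventually (\<lambda>n. dist (cdot (Wt n 0) (W n 0)) (cdot (Wt0 0) (W0 0)) < \<epsilon>) sequentially"
    proof eventually_elim
      case (elim n)
      define p where "p = exp (- nu n * of_real x) * row_pair (\<eta> n) (W n x)"
      have "norm (p - cdot (Wt n 0) (W n 0)) \<le> B * exp (- x / 8)" using elim(1) x by (simp add: p_def)
      moreover have "dist p (row_pair zg (W0 x)) < \<epsilon> / 2" using elim(2) by (simp add: p_def)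
      moreover note diff[OF x(1)] tail0[OF x(1)]
      moreover have "dist (cdot (Wt n 0) (W n 0)) (cdot (Wt0 0) (W0 0))
          \<le> dist (cdot (Wt n 0) (W n 0)) p + dist p (row_pair zg (W0 x))
            + dist (row_pair zg (W0 x)) (row_pair z1 (W0 x)) + dist (row_pair z1 (W0 x)) (cdot (Wt0 0) (W0 0))"
        by metric
      ultimately show ?case using x(2) unfolding dist_norm norm_minus_commute[of "cdot (Wt n 0) (W n 0)" p]
        by (simp add: algebra_simps)
    qed
  qed
qed

section \<open>Uniform convergence on compact sets\<close>

text \<open>
  Near each \<open>z\<close> all values \<open>D t w\<close> with small \<open>t\<close> are close to \<open>l z\<close>. Letting \<open>t\<close> tend to \<open>0\<close> at fixed \<open>w\<close>
  shows that \<open>l w\<close> is close to \<open>l z\<close> as well, so continuity of \<open>l\<close> comes for free and a finite cover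
  finishes the proof.
\<close>

lemma uniform_limit_of_joint_convergence:
  fixes D :: "real \<Rightarrow> 'a::metric_space \<Rightarrow> 'b::metric_space"
  assumes b: "0 < b"
    and joint: "\<And>z. z \<in> S \<Longrightarrow> ((\<lambda>p. D (fst p) (snd p)) \<longlongrightarrow> l z) (at (0, z) within {0<..<b} \<times> S)"
    and K: "compact K" "K \<subseteq> S"
  shows "uniform_limit K D l (at_right 0)"
  unfolding uniform_limit_iff
proof (intro allI impI)
  fix e :: real assume e: "0 < e"
  have near: "\<exists>d>0. \<forall>t z'. 0 < t \<longrightarrow> t < d \<longrightarrow> z' \<in> S \<longrightarrow> dist z' z < d \<longrightarrow> dist (D t z') (l z) < r"
    if z: "z \<in> S" and r: "0 < r" for z r
  proof -
    obtain d where d: "0 < d" "\<And>p. p \<in> {0<..<b} \<times> S \<Longrightarrow> p \<noteq> (0, z) \<Longrightarrow> dist p (0, z) < d \<Longrightarrow>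
        dist (D (fst p) (snd p)) (l z) < r"
      using tendstoD[OF joint[OF z] r] unfolding eventually_at by auto
    show ?thesis
    proof (intro exI[of _ "min b (d / 2)"] conjI allI impI)
      show "0 < min b (d / 2)" using b d by simp
      fix t z' assume t: "0 < t" "t < min b (d / 2)" "z' \<in> S" "dist z' z < min b (d / 2)"
      have "dist (t, z') (0, z) \<le> dist t 0 + dist z' z"
        unfolding dist_Pair_Pair by (rule sqrt_sum_squares_le_sum) auto
      also have "\<dots> < d" using t by simp
      finally show "dist (D t z') (l z) < r" using d(2)[of "(t, z')"] t by simp
    qed
  qed
  have "\<forall>z\<in>S. \<exists>d>0. \<forall>t z'. 0 < t \<longrightarrow> t < d \<longrightarrow> z' \<in> S \<longrightarrow> dist z' z < d \<longrightarrow> dist (D t z') (l z) < e / 3"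
    using near[of _ "e / 3"] e by simp
  then obtain d where d: "\<And>z. z \<in> S \<Longrightarrow> 0 < d z"
    "\<And>z t z'. z \<in> S \<Longrightarrow> 0 < t \<Longrightarrow> t < d z \<Longrightarrow> z' \<in> S \<Longrightarrow> dist z' z < d z \<Longrightarrow> dist (D t z') (l z) < e / 3"
    by metis
  have "K \<subseteq> (\<Union>z\<in>K. ball z (d z))" using d(1) K(2) by force
  then obtain F where F: "F \<subseteq> K" "finite F" "K \<subseteq> (\<Union>z\<in>F. ball z (d z))"
    using compactE_image[OF K(1), of K "\<lambda>z. ball z (d z)"] by auto
  have "\<forall>z\<in>F. eventually (\<lambda>t. t < d z) (at_right 0)"
    using F(1) K(2) d(1) by (auto intro!: order_tendstoD[OF tendsto_ident_at])
  then have "eventually (\<lambda>t. \<forall>z\<in>F. t < d z) (at_right 0)"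
    using F(2) by (simp add: eventually_ball_finite)
  then show "eventually (\<lambda>t. \<forall>w\<in>K. dist (D t w) (l w) < e) (at_right 0)"
    using eventually_at_right_less[of 0]
  proof eventually_elim
    case (elim t)
    show ?case
    proof
      fix w assume w: "w \<in> K"
      then obtain z where z: "z \<in> F" "dist w z < d z" using F(3) by (auto simp: dist_commute)
      have S: "w \<in> S" "z \<in> S" using w z F K by auto
      obtain d' where d': "0 < d'" "\<And>s. 0 < s \<Longrightarrow> s < d' \<Longrightarrow> dist (D s w) (l w) < e / 3"
        using near[OF S(1), of "e / 3"] e S(1) by (metis dist_self zero_less_divide_iff zero_less_numeral)
      \<comment> \<open>An auxiliary parameter that compares \<open>l w\<close> with \<open>l z\<close>.\<close>
      define s where "s = min d' (d z) / 2"
      have s: "0 < s" "s < d'" "s < d z" using d'(1) d(1)[OF S(2)] by (auto simp: s_def min_def)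
      have "dist (D t w) (l z) < e / 3" using d(2)[OF S(2) _ _ S(1) z(2)] elim z(1) by auto
      moreover have "dist (D s w) (l z) < e / 3" using d(2)[OF S(2) s(1,3) S(1) z(2)] .
      moreover have "dist (D s w) (l w) < e / 3" by (rule d'(2)[OF s(1,2)])
      moreover have "dist (D t w) (l w) \<le> dist (D t w) (l z) + dist (D s w) (l z) + dist (D s w) (l w)"
        by metric
      ultimately show "dist (D t w) (l w) < e" by simp
    qed
  qed
qed

lemma uniform_limit_diagonal:
  fixes V :: "real \<Rightarrow> complex \<Rightarrow> complex^3"
  assumes unif: "\<And>C. compact C \<Longrightarrow> C \<subseteq> S \<Longrightarrow> uniform_limit C V l (at_right 0)"
    and cont: "continuous_on S l"
    and t: "\<And>n::nat. 0 < t n" "t \<longlonglongrightarrow> 0" and z: "\<And>n. z n \<in> S" "z \<longlonglongrightarrow> z0" "z0 \<in> S"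
  shows "(\<lambda>n. V (t n) (z n)) \<longlonglongrightarrow> l z0"
proof -
  define C where "C = insert z0 (range z)"
  have C: "compact C" "C \<subseteq> S" using z by (auto simp: C_def intro: compact_sequence_with_limit)
  have tr: "filterlim t (at_right 0) sequentially"
  proof -
    have "t n \<in> {0<..} \<and> t n \<noteq> 0" for n using t(1)[of n] by simp
    then show ?thesis unfolding filterlim_at using t(2) by (simp add: always_eventually)
  qed
  have "(\<lambda>n. V (t n) (z n) - l (z n)) \<longlonglongrightarrow> 0"
  proof (rule tendstoI)
    fix e :: real assume "0 < e"
    then have "eventually (\<lambda>s. \<forall>w\<in>C. dist (V s w) (l w) < e) (at_right 0)"
      using unif[OF C] by (simp add: uniform_limit_iff)
    from eventually_compose_filterlim[OF this tr]
    show "eventually (\<lambda>n. dist (V (t n) (z n) - l (z n)) 0 < e) sequentially"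
      by eventually_elim (auto simp: C_def dist_norm)
  qed
  moreover have "(\<lambda>n. l (z n)) \<longlonglongrightarrow> l z0"
    using continuous_on_tendsto_compose[OF cont z(2,3)] z(1) by simp
  ultimately show ?thesis using tendsto_add by fastforce
qed

lemma analytic_vec_on_imp_continuous_on:
  assumes "analytic_vec_on V S" shows "continuous_on S V"
proof -
  have "continuous_on S (\<lambda>z. \<chi> i. V z $ i)"
    using assms unfolding analytic_vec_on_def
    by (intro continuous_on_vec_lambda holomorphic_on_imp_continuous_on analytic_imp_holomorphic) auto
  then show ?thesis by simp
qed

lemma continuous_adjoint_plus_limit:
  assumes "0 < c"
  shows "continuous_on closed_right_half_plane (adjoint_plus_limit c)"
proof -
  have nz: "of_real c + cnj z \<noteq> 0" if "0 \<le> Re z" for z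
    using that assms by (auto simp: complex_eq_iff)
  have "\<forall>i. continuous_on closed_right_half_plane (\<lambda>z. adjoint_plus_limit c z $ i)"
    unfolding forall_3 adjoint_plus_limit_def using nz
    by (auto intro!: continuous_intros)
  then have "continuous_on closed_right_half_plane (\<lambda>z. \<chi> i. adjoint_plus_limit c z $ i)"
    by (intro continuous_on_vec_lambda) auto
  then show ?thesis by simp
qed

theorem theorem1:
  fixes \<gamma> :: real
    and vhat :: "real \<Rightarrow> real \<Rightarrow> real"
    and mu mut :: "real \<Rightarrow> complex \<Rightarrow> complex"
    and V Vt :: "real \<Rightarrow> complex \<Rightarrow> complex^3"
    and V0 :: "complex \<Rightarrow> complex^3"
    and W Wt :: "real \<Rightarrow> complex \<Rightarrow> real \<Rightarrow> complex^3"
    and W0 Wt0 :: "complex \<Rightarrow> real \<Rightarrow> complex^3"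
    and K :: "complex set"
  assumes "\<gamma> \<ge> 1"
    and profile: "\<And>vp. vp \<in> {0<..<1/2} \<Longrightarrow> is_profile \<gamma> vp (vhat vp)"
    and V: "\<And>vp. vp \<in> {0<..<1/2} \<Longrightarrow> is_minus_mode \<gamma> vp (mu vp) (V vp)"
    and V0: "is_minus_mode0 V0"
    and V_lim: "\<And>C. compact C \<Longrightarrow> C \<subseteq> closed_right_half_plane \<Longrightarrow>
        uniform_limit C V V0 (at_right 0)"
    and W: "\<And>vp lam. vp \<in> {0<..<1/2} \<Longrightarrow> 0 \<le> Re lam \<Longrightarrow>
        solves_linear_ode (\<lambda>x. A_mat \<gamma> vp (vhat vp x) lam) (W vp lam) \<and>
        has_exp_asymptotics at_bot (mu vp lam) (V vp lam) (W vp lam)"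
    and W0: "\<And>lam. 0 \<le> Re lam \<Longrightarrow>
        solves_linear_ode (\<lambda>x. A0_mat (limit_profile x) lam) (W0 lam) \<and>
        has_exp_asymptotics at_bot (mu0_minus lam) (V0 lam) (W0 lam)"
    and Vt: "\<And>vp. vp \<in> {0<..<1/2} \<Longrightarrow> is_adjoint_plus_mode \<gamma> vp (mut vp) (Vt vp)"
    and Vt_lim: "\<And>C. compact C \<Longrightarrow> C \<subseteq> closed_right_half_plane \<Longrightarrow>
        uniform_limit C Vt (adjoint_plus_limit \<gamma>) (at_right 0)"
    and Wt: "\<And>vp lam. vp \<in> {0<..<1/2} \<Longrightarrow> 0 \<le> Re lam \<Longrightarrow>
        solves_linear_ode (\<lambda>x. - conj_transpose (A_mat \<gamma> vp (vhat vp x) lam)) (Wt vp lam) \<and>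
        has_exp_asymptotics at_top (mut vp lam) (Vt vp lam) (Wt vp lam)"
    and Wt0: "\<And>lam. 0 \<le> Re lam \<Longrightarrow>
        solves_linear_ode (\<lambda>x. - conj_transpose (A0_mat (limit_profile x) lam)) (Wt0 lam) \<and>
        (Wt0 lam \<longlongrightarrow> adjoint_plus_limit 1 lam) at_top"
    and "compact K" and "K \<subseteq> closed_right_half_plane"
  shows "uniform_limit K (\<lambda>vp. evans (Wt vp) (W vp)) (evans Wt0 W0) (at_right 0)"
proof (rule uniform_limit_of_joint_convergence[of "1 / 4"])
  show "compact K" "K \<subseteq> closed_right_half_plane" "0 < (1 / 4 :: real)" using assms by auto
next
  fix lam0 :: complex assume "lam0 \<in> closed_right_half_plane"
  then have lam0: "0 \<le> Re lam0" by simp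
  have cV0: "continuous_on closed_right_half_plane V0"
    using V0 by (intro analytic_vec_on_imp_continuous_on) (simp add: is_minus_mode0_def)
  show "((\<lambda>p. evans (Wt (fst p)) (W (fst p)) (snd p)) \<longlongrightarrow> evans Wt0 W0 lam0)
      (at (0, lam0) within {0<..<1 / 4} \<times> closed_right_half_plane)"
    unfolding tendsto_at_iff_sequentially
  proof (intro allI impI)
    fix X :: "nat \<Rightarrow> real \<times> complex"
    assume X: "\<forall>i. X i \<in> {0<..<1 / 4} \<times> closed_right_half_plane - {(0, lam0)}" and Xlim: "X \<longlonglongrightarrow> (0, lam0)"
    define vp where "vp n = fst (X n)" for n
    define lam where "lam n = snd (X n)" for n
    have vp: "0 < vp n" "vp n < 1 / 4" and lam: "0 \<le> Re (lam n)" for n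
      using X by (auto simp: vp_def lam_def mem_Times_iff)
    have lims: "vp \<longlonglongrightarrow> 0" "lam \<longlonglongrightarrow> lam0"
      using tendsto_fst[OF Xlim] tendsto_snd[OF Xlim] by (simp_all add: vp_def[abs_def] lam_def[abs_def])
    have vp2: "vp n \<in> {0<..<1/2}" for n using vp[of n] by simp
    have minus: "0 < Re (mu (vp n) (lam n))" "eigenpair (A_minus \<gamma> (vp n) (lam n)) (mu (vp n) (lam n)) (V (vp n) (lam n))" for n
      using V[OF vp2] lam by (auto simp: is_minus_mode_def)
    have plus: "lam n \<noteq> 0 \<Longrightarrow> Re (mut (vp n) (lam n)) < 0" "lam n = 0 \<Longrightarrow> mut (vp n) (lam n) = 0"
      "eigenpair (- conj_transpose (A_plus \<gamma> (vp n) (lam n))) (mut (vp n) (lam n)) (Vt (vp n) (lam n))" for n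
      using Vt[OF vp2] lam by (auto simp: is_adjoint_plus_mode_def)
    note Wn = W[OF vp2 lam, THEN conjunct1] W[OF vp2 lam, THEN conjunct2]
      and Wtn = Wt[OF vp2 lam, THEN conjunct1] Wt[OF vp2 lam, THEN conjunct2]
    have "(\<lambda>n. cdot (Wt (vp n) (lam n) 0) (W (vp n) (lam n) 0)) \<longlonglongrightarrow> cdot (Wt0 lam0 0) (W0 lam0 0)"
    proof (rule evans_sequence_convergence[where vp = vp and lam = lam and v = "\<lambda>n. vhat (vp n)"
          and mu = "\<lambda>n. mu (vp n) (lam n)" and mt = "\<lambda>n. mut (vp n) (lam n)"])
      show "(\<lambda>n. V (vp n) (lam n)) \<longlonglongrightarrow> V0 lam0"
        by (rule uniform_limit_diagonal[OF V_lim cV0]) (use vp lam lims lam0 in auto)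
      show "(\<lambda>n. Vt (vp n) (lam n)) \<longlonglongrightarrow> adjoint_plus_limit \<gamma> lam0"
        by (rule uniform_limit_diagonal[OF Vt_lim continuous_adjoint_plus_limit])
          (use vp lam lims lam0 assms(1) in auto)
      show "eigenpair (A0_minus lam0) (mu0_minus lam0) (V0 lam0)"
        using V0 lam0 by (auto simp: is_minus_mode0_def)
      show "vp n \<le> 1 / 4" for n using vp[of n] by simp
    qed (rule assms(1) vp lam lims minus plus profile[OF vp2] Wn Wtn
        W0[OF lam0, THEN conjunct1] W0[OF lam0, THEN conjunct2]
        Wt0[OF lam0, THEN conjunct1] Wt0[OF lam0, THEN conjunct2] | assumption)+
    then show "((\<lambda>p. evans (Wt (fst p)) (W (fst p)) (snd p)) \<circ> X) \<longlonglongrightarrow> evans Wt0 W0 lam0"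
      by (simp add: evans_def o_def vp_def lam_def)
  qed
qed

end
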